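(* Suppose $1\le p<\infty$ and let $\{\phi_t:t\ge0\}$ be a semigroup of analytic self-maps of the upper half-plane $\mathbb{U}$ such that every composition operator $T_t(f)=f\circ\phi_t$, $t\ge0$, is bounded on $H^p(\mathbb{U})$. Then (1) $\{T_t\}$ is strongly continuous on $H^p(\mathbb{U})$, i.e. $\lim_{t\to0}\|T_t(f)-f\|_p=0$ for every $f\in H^p(\mathbb{U})$. (2) If $G$ is the infinitesimal generator of $\{\phi_t\}$, then the infinitesimal generator $\Gamma$ of $\{T_t\}$ has domain of definition $$D(\Gamma)=\{f\in H^p(\mathbb{U}): Gf'\in H^p(\mathbb{U})\}$$ and is given by $\Gamma(f)=Gf'$ for $f\in D(\Gamma)$.
   Context: $\mathbb{U}=\{z\in\mathbb{C}:\operatorname{Im} z>0\}$. $H^p(\mathbb{U})$ is the space of analytic $f:\mathbb{U}\to\mathbb{C}$ with $\|f\|_p=\sup_{y>0}\left(\int_{-\infty}^{\infty}|f(x+iy)|^p\,dx\right)^{1/p}<\infty$, a Banach space for $p\ge1$. A semigroup of analytic self-maps of $\mathbb{U}$ is a family $\{\phi_t:t\ge0\}$ of analytic maps $\phi_t:\mathbb{U}\to\mathbb{U}$ such that $\phi_0(z)\equiv z$, $\phi_{t+s}=\phi_t\circ\phi_s$ for $t,s\ge0$, and $(t,z)\mapsto\phi_t(z)$ is jointly continuous on $[0,\infty)\times\mathbb{U}$. Its infinitesimal generator is the analytic function $G:\mathbb{U}\to\mathbb{C}$, $G(z)=\lim_{t\to0}\frac{\partial\phi_t(z)}{\partial t}$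 (it always exists, and $G(\phi_t(z))=\frac{\partial\phi_t(z)}{\partial t}$ for $z\in\mathbb{U}$, $t\ge0$). The infinitesimal generator $\Gamma$ of the operator semigroup $\{T_t\}$ has as domain $D(\Gamma)$ the set of $f\in H^p(\mathbb{U})$ for which $\lim_{t\to0}\frac{T_t(f)-f}{t}$ exists in the norm of $H^p(\mathbb{U})$, and $\Gamma(f)$ is this limit. *)

theory Defs
  imports "HOL-Analysis.Analysis"
begin

text \<open>
  Functions on the upper half-plane are represented by total functions
  \<open>complex \<Rightarrow> complex\<close>. Everything below depends only on their values on the half-plane,
  so two functions that agree there represent the same element of the Hardy space.
\<close>

definition upper_halfplane :: "complex set" where
  "upper_halfplane = {z. Im z > 0}"

definition Hardy_mean :: "real \<Rightarrow> (complex \<Rightarrow> complex) \<Rightarrow> real \<Rightarrow> real" where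
  "Hardy_mean p f y = (LINT x|lborel. norm (f (Complex x y)) powr p) powr (1 / p)"

text \<open>
  Integrability on every horizontal line together with boundedness of the means
  expresses that the supremum defining the norm is finite.
\<close>

definition Hardy_space :: "real \<Rightarrow> (complex \<Rightarrow> complex) set" where
  "Hardy_space p = {f. f holomorphic_on upper_halfplane \<and>
     (\<forall>y>0. integrable lborel (\<lambda>x. norm (f (Complex x y)) powr p)) \<and>
     bdd_above (Hardy_mean p f ` {0<..})}"

text \<open>Being real-valued, this is the norm only on members of the Hardy space.\<close>

definition Hardy_norm :: "real \<Rightarrow> (complex \<Rightarrow> complex) \<Rightarrow> real" where
  "Hardy_norm p f = (SUP y\<in>{0<..}. Hardy_mean p f y)"

definition analytic_semigroup :: "(real \<Rightarrow> complex \<Rightarrow> complex) \<Rightarrow> bool" where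
  "analytic_semigroup \<phi> \<longleftrightarrow>
     (\<forall>t\<ge>0. \<phi> t holomorphic_on upper_halfplane \<and> \<phi> t \<in> upper_halfplane \<rightarrow> upper_halfplane) \<and>
     (\<forall>z\<in>upper_halfplane. \<phi> 0 z = z) \<and>
     (\<forall>t\<ge>0. \<forall>s\<ge>0. \<forall>z\<in>upper_halfplane. \<phi> (t + s) z = \<phi> t (\<phi> s z)) \<and>
     continuous_on ({0..} \<times> upper_halfplane) (\<lambda>(t, z). \<phi> t z)"

definition semigroup_generator :: "(real \<Rightarrow> complex \<Rightarrow> complex) \<Rightarrow> complex \<Rightarrow> complex" where
  "semigroup_generator \<phi> z =
     Lim (at_right 0) (\<lambda>t. vector_derivative (\<lambda>s. \<phi> s z) (at t))"

definition composition_op ::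
  "(real \<Rightarrow> complex \<Rightarrow> complex) \<Rightarrow> real \<Rightarrow> (complex \<Rightarrow> complex) \<Rightarrow> complex \<Rightarrow> complex" where
  "composition_op \<phi> t f = f \<circ> \<phi> t"

definition Hardy_bounded_op ::
  "real \<Rightarrow> ((complex \<Rightarrow> complex) \<Rightarrow> complex \<Rightarrow> complex) \<Rightarrow> bool" where
  "Hardy_bounded_op p A \<longleftrightarrow> (\<forall>f\<in>Hardy_space p. A f \<in> Hardy_space p) \<and>
     (\<exists>C. \<forall>f\<in>Hardy_space p. Hardy_norm p (A f) \<le> C * Hardy_norm p f)"

definition Hardy_strongly_continuous ::
  "real \<Rightarrow> (real \<Rightarrow> (complex \<Rightarrow> complex) \<Rightarrow> complex \<Rightarrow> complex) \<Rightarrow> bool" where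
  "Hardy_strongly_continuous p T \<longleftrightarrow>
     (\<forall>f\<in>Hardy_space p. ((\<lambda>t. Hardy_norm p (\<lambda>z. T t f z - f z)) \<longlongrightarrow> 0) (at_right 0))"

definition has_generator_limit ::
  "real \<Rightarrow> (real \<Rightarrow> (complex \<Rightarrow> complex) \<Rightarrow> complex \<Rightarrow> complex) \<Rightarrow>
   (complex \<Rightarrow> complex) \<Rightarrow> (complex \<Rightarrow> complex) \<Rightarrow> bool" where
  "has_generator_limit p T f g \<longleftrightarrow> g \<in> Hardy_space p \<and>
     ((\<lambda>t. Hardy_norm p (\<lambda>z. (T t f z - f z) / of_real t - g z)) \<longlongrightarrow> 0) (at_right 0)"

definition generator_domain ::
  "real \<Rightarrow> (real \<Rightarrow> (complex \<Rightarrow> complex) \<Rightarrow> complex \<Rightarrow> complex) \<Rightarrow>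
   (complex \<Rightarrow> complex) set" where
  "generator_domain p T = {f \<in> Hardy_space p. \<exists>g. has_generator_limit p T f g}"

text \<open>
  The limit is unique on the upper half-plane but not as a total function, hence the choice
  operator; only the values on the half-plane are meaningful.
\<close>

definition generator_op ::
  "real \<Rightarrow> (real \<Rightarrow> (complex \<Rightarrow> complex) \<Rightarrow> complex \<Rightarrow> complex) \<Rightarrow>
   (complex \<Rightarrow> complex) \<Rightarrow> complex \<Rightarrow> complex" where
  "generator_op p T f = (SOME g. has_generator_limit p T f g)"

end

theory Submission
  imports Defs "HOL-Complex_Analysis.Complex_Analysis"
begin

text \<open>
  Throughout, \<open>U\<close> is the upper half-plane and the size of a function is measured by the
  integrals of \<open>|F|\<^sup>q\<close> over the horizontal lines inside \<open>U\<close>.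

  \<^emph>\<open>The norms of the composition operators.\<close> If a holomorphic self-map \<open>\<phi>\<close> of \<open>U\<close> satisfies
  \<open>Im \<phi>(z) \<ge> c Im z\<close> with \<open>c > 0\<close>, then \<open>\<parallel>f \<circ> \<phi>\<parallel>\<^sup>p \<le> \<parallel>f\<parallel>\<^sup>p / c\<close>. Indeed \<open>|f|\<^sup>p\<close>, being subharmonic, is
  at most the Poisson integral of its values on a line (\<open>poisson_majorant\<close>). Composed with \<open>\<phi>\<close>, the
  Poisson kernel at the point \<open>s\<close> becomes, up to a factor, the imaginary part of
  \<open>-1 / (\<phi>(z) - s)\<close>, a positive harmonic function, whose integral over a line is controlled by its
  decay at infinity (\<open>total_poisson_mass_le\<close>); integrating over \<open>s\<close> gives
  \<open>level_integral_subordination\<close>. The identity map in place of \<open>\<phi>\<close> shows that the line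
  integrals decrease with the height, for every exponent \<open>q > 0\<close>. Conversely, a bounded composition
  operator forces such an inequality with some \<open>c > 0\<close>, as one sees from the functions
  \<open>(z - cnj w)\<^sup>-\<^sup>2\<close> (\<open>bounded_composition_imp_Im_ge\<close>).

  The best constant, \<open>c(\<phi>) = inf Im \<phi>(z) / Im z\<close>, is also the limit of \<open>\<phi>(z) / z\<close> as \<open>z\<close> tends to
  infinity inside an angle (\<open>Julia_Caratheodory\<close>), so it is multiplicative under
  composition. Along a semigroup, \<open>t \<mapsto> c(\<phi>\<^sub>t)\<close> is thus multiplicative, positive and upper
  semicontinuous. By the Baire category theorem it is bounded below by a positive number on some
  interval, and then multiplicativity makes its lower limit at \<open>0\<close> at least \<open>1\<close>. Hence the
  upper limit of \<open>\<parallel>T\<^sub>t f\<parallel>\<close> is at most \<open>\<parallel>f\<parallel>\<close>.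

  \<^emph>\<open>Strong continuity.\<close> Since \<open>f \<circ> \<phi>\<^sub>t\<close> tends to \<open>f\<close> pointwise, it remains to prove that pointwise
  convergence without increase of norm implies convergence in norm (\<open>Hardy_Kadec_Klee\<close>). This
  rests on the inequality \<open>|(a + b) / 2|\<^sup>p + |a b|\<^sup>p\<^sup>/\<^sup>2 \<le> |a|\<^sup>p + |b|\<^sup>p\<close>, with equality only for
  \<open>a = b\<close>. Put \<open>a = f\<close> and \<open>b = f \<circ> \<phi>\<^sub>t\<close>. Both terms on the left are then powers of moduli of
  holomorphic functions, so their integrals over a line close to the real axis are at least those
  over a fixed line, where Fatou's lemma bounds them from below by almost \<open>2 \<parallel>f\<parallel>\<^sup>p\<close> as \<open>t\<close> tends to
  \<open>0\<close>; the right-hand side contributes at most about \<open>2 \<parallel>f\<parallel>\<^sup>p\<close>. The difference is small, and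
  therefore \<open>a - b\<close> is small in mean. The product term is what makes this work for \<open>p = 1\<close>, where
  the norm alone is not strictly convex.

  \<^emph>\<open>The generator.\<close> Near a given point, for small \<open>\<epsilon>\<close>, the map
  \<open>A(w) = \<integral>\<^sub>0\<^sup>\<epsilon> \<phi>\<^sub>s(w) ds\<close> is invertible, and
  \<open>t \<mapsto> A(\<phi>\<^sub>t(z))\<close> is an integral with variable limits. So \<open>t \<mapsto> \<phi>\<^sub>t(z)\<close> is
  differentiable and solves the equation with right-hand side \<open>G\<close> (\<open>semigroup_generator_ODE\<close>).
  A norm limit of the difference quotients of \<open>T\<^sub>t f\<close> is also a pointwise limit, hence equal to
  \<open>G f'\<close>. If on the other hand \<open>h = G f'\<close> is in \<open>H\<^sup>p\<close>, then \<open>(T\<^sub>t f - f) / t - h\<close> is the mean of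
  \<open>T\<^sub>s h - h\<close> over \<open>0 \<le> s \<le> t\<close>, which is small by Jensen's inequality and strong continuity.
\<close>

section \<open>Mean values of powers of moduli of holomorphic functions\<close>

text \<open>
  Cauchy's formula with absolute values inside the integral. The factor blows up at the circle,
  but points other than the centre are needed later, in order to move the centre of the circle
  while the point stays fixed.
\<close>

lemma holomorphic_mean_bound:
  assumes "continuous_on (cball 0 1) H" "H holomorphic_on ball 0 1" "norm z < 1"
  shows "norm (H z) \<le> 1 / (1 - norm z) * integral {0..1} (\<lambda>t. norm (H (circlepath 0 1 t)))"
proof -
  let ?e = "circlepath 0 1"
  have ne: "norm (?e t) = 1" for t
    by (simp add: circlepath)
  have "((\<lambda>u. H u / (u - z)) has_contour_integral (2 * of_real pi * \<i> * H z)) ?e"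
    using assms by (intro Cauchy_integral_circlepath) auto
  then have I: "((\<lambda>t. H (?e t) / (?e t - z) * (2 * pi * \<i> * exp (2 * of_real pi * \<i> * t)))
      has_integral (2 * of_real pi * \<i> * H z)) {0..1}"
    unfolding has_contour_integral vector_derivative_circlepath by simp
  have contH: "continuous_on {0..1} (\<lambda>t. H (?e t))"
    by (rule continuous_on_compose2[OF assms(1)]) (auto simp: ne circlepath intro!: continuous_intros)
  have "norm (integral {0..1} (\<lambda>t. H (?e t) / (?e t - z) * (2 * pi * \<i> * exp (2 * of_real pi * \<i> * t))))
    \<le> integral {0..1} (\<lambda>t. (2 * pi / (1 - norm z)) * norm (H (?e t)))"
  proof (rule integral_norm_bound_integral)
    show "(\<lambda>t. (2 * pi / (1 - norm z)) * norm (H (?e t))) integrable_on {0..1}"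
      by (intro integrable_continuous_interval continuous_intros contH)
    fix t :: real
    have "1 - norm z \<le> norm (?e t - z)"
      using norm_triangle_ineq2[of "?e t" z] by (simp add: ne)
    then have "norm (H (?e t)) / norm (?e t - z) \<le> norm (H (?e t)) / (1 - norm z)"
      using assms(3) by (intro divide_left_mono mult_pos_pos) auto
    then have "2 * pi * (norm (H (?e t)) / norm (?e t - z)) \<le> 2 * pi * (norm (H (?e t)) / (1 - norm z))"
      by (intro mult_left_mono) auto
    then show "norm (H (?e t) / (?e t - z) * (2 * pi * \<i> * exp (2 * of_real pi * \<i> * t)))
        \<le> (2 * pi / (1 - norm z)) * norm (H (?e t))"
      by (simp add: norm_mult norm_divide mult_ac)
  qed (use I in blast)
  moreover have "norm (2 * of_real pi * \<i> * H z) = 2 * pi * norm (H z)"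
    by (simp add: norm_mult)
  ultimately have "2 * pi * norm (H z) \<le> (2 * pi / (1 - norm z)) * integral {0..1} (\<lambda>t. norm (H (?e t)))"
    using integral_unique[OF I] by simp
  then have "2 * pi * norm (H z) \<le> 2 * pi * (1 / (1 - norm z) * integral {0..1} (\<lambda>t. norm (H (?e t))))"
    by (simp add: field_simps)
  then show ?thesis
    by (subst (asm) mult_le_cancel_left_pos) auto
qed

text \<open>
  The modulus of a Blaschke factor is at most \<open>1\<close> in the disc and equal to \<open>1\<close> on the circle.
\<close>

lemma root_reflection_norm:
  fixes a z :: complex
  assumes "norm a < 1"
  shows "norm z = 1 \<Longrightarrow> norm (1 - cnj a * z) = norm (z - a)"
    and "norm z \<le> 1 \<Longrightarrow> norm (z - a) \<le> norm (1 - cnj a * z)"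
proof -
  have eq: "(norm (1 - cnj a * z))\<^sup>2 - (norm (z - a))\<^sup>2 = (1 - (norm a)\<^sup>2) * (1 - (norm z)\<^sup>2)"
    unfolding cmod_power2 by (simp add: algebra_simps power2_eq_square)
  show "norm (1 - cnj a * z) = norm (z - a)" if "norm z = 1"
    using eq that by simp
  show "norm (z - a) \<le> norm (1 - cnj a * z)" if "norm z \<le> 1"
  proof (rule power2_le_imp_le)
    have "0 \<le> (1 - (norm a)\<^sup>2) * (1 - (norm z)\<^sup>2)"
      using assms that by (intro mult_nonneg_nonneg) (auto simp: abs_square_le_1 power_le_one)
    then show "(norm (z - a))\<^sup>2 \<le> (norm (1 - cnj a * z))\<^sup>2"
      using eq by linarith
  qed auto
qed

text \<open>
  Each root \<open>a\<close> inside the disc is moved outside by replacing the factor \<open>z - a\<close> with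
  \<open>1 - cnj a * z\<close>; this amounts to division by a finite Blaschke product.
\<close>

lemma poly_zero_free_majorant:
  fixes P :: "complex poly"
  assumes "P \<noteq> 0"
  shows "\<exists>Q. (\<forall>z. norm z < 1 \<longrightarrow> poly Q z \<noteq> 0) \<and>
             (\<forall>z. norm z = 1 \<longrightarrow> norm (poly Q z) = norm (poly P z)) \<and>
             (\<forall>z. norm z \<le> 1 \<longrightarrow> norm (poly P z) \<le> norm (poly Q z))"
  using assms
proof (induction "degree P" arbitrary: P rule: less_induct)
  case less
  show ?case
  proof (cases "\<exists>a. norm a < 1 \<and> poly P a = 0")
    case True
    then obtain a where a: "norm a < 1" "poly P a = 0" by blast
    then obtain P1 where P: "P = [:-a, 1:] * P1"
      by (auto simp: poly_eq_0_iff_dvd dvd_def)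
    with less.prems have "P1 \<noteq> 0" by auto
    then have "degree P1 < degree P"
      unfolding P by (subst degree_mult_eq) auto
    from less.hyps[OF this \<open>P1 \<noteq> 0\<close>] obtain Q1 where Q1:
      "\<And>z. norm z < 1 \<Longrightarrow> poly Q1 z \<noteq> 0"
      "\<And>z. norm z = 1 \<Longrightarrow> norm (poly Q1 z) = norm (poly P1 z)"
      "\<And>z. norm z \<le> 1 \<Longrightarrow> norm (poly P1 z) \<le> norm (poly Q1 z)"
      by blast
    let ?Q = "[:1, - cnj a:] * Q1"
    have Qz: "poly ?Q z = (1 - cnj a * z) * poly Q1 z" for z
      by (simp add: algebra_simps)
    have Pz: "poly P z = (z - a) * poly P1 z" for z
      by (simp add: P algebra_simps)
    show ?thesis
    proof (intro exI[of _ ?Q] conjI allI impI)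
      fix z :: complex assume z: "norm z < 1"
      have "norm (cnj a * z) < 1"
        using a(1) z by (simp add: norm_mult) (metis mult_strict_mono' mult_1 norm_ge_zero)
      then have "1 - cnj a * z \<noteq> 0" by auto
      then show "poly ?Q z \<noteq> 0" using Q1(1)[OF z] unfolding Qz by simp
    next
      fix z :: complex assume z: "norm z = 1"
      show "norm (poly ?Q z) = norm (poly P z)"
        unfolding Qz Pz norm_mult using Q1(2)[OF z] root_reflection_norm(1)[OF a(1) z] by simp
    next
      fix z :: complex assume z: "norm z \<le> 1"
      show "norm (poly P z) \<le> norm (poly ?Q z)"
        unfolding Qz Pz norm_mult using Q1(3)[OF z] root_reflection_norm(2)[OF a(1) z]
        by (intro mult_mono) auto
    qed
  next
    case False
    then show ?thesis by (intro exI[of _ P]) auto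
  qed
qed

lemma radii_to_one: "\<exists>R::nat \<Rightarrow> real. (\<forall>n. 0 < R n) \<and> (\<forall>n. R n < 1) \<and> R \<longlonglongrightarrow> 1"
proof (intro exI conjI allI)
  show "(\<lambda>n. 1 - 1 / real (Suc (Suc n))) \<longlonglongrightarrow> 1"
    using tendsto_diff[OF tendsto_const LIMSEQ_Suc[OF LIMSEQ_Suc[OF lim_1_over_n[where 'a = real]]], of 1]
    by simp
qed (auto simp: field_simps)

text \<open>
  A polynomial without zeros in the disc has a holomorphic logarithm there, and the power is the
  modulus of a holomorphic function. Zeros on the circle are harmless because the bound is
  obtained on smaller circles first.
\<close>

lemma poly_powr_mean_bound:
  fixes Q :: "complex poly"
  assumes Q: "\<And>z. norm z < 1 \<Longrightarrow> poly Q z \<noteq> 0" and q: "q > 0" and z: "norm z < 1"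
  shows "norm (poly Q z) powr q \<le>
    1 / (1 - norm z) * integral {0..1} (\<lambda>t. norm (poly Q (circlepath 0 1 t)) powr q)"
proof -
  let ?e = "circlepath 0 1"
  have ne: "norm (?e t) = 1" for t
    by (simp add: circlepath)
  obtain g where g: "g holomorphic_on ball 0 1" "\<And>z. z \<in> ball 0 1 \<Longrightarrow> poly Q z = exp (g z)"
  proof (rule contractible_imp_holomorphic_log[of "poly Q" "ball 0 1"])
    show "contractible (ball (0::complex) 1)"
      by (intro convex_imp_contractible convex_ball)
  qed (use Q in \<open>auto intro!: holomorphic_intros\<close>)
  define I where "I r = integral {0..1} (\<lambda>t. norm (poly Q (of_real r * ?e t)) powr q)" for r :: real
  have ineq: "norm (poly Q (of_real r * z)) powr q \<le> 1 / (1 - norm z) * I r" if r: "0 < r" "r < 1" for r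
  proof -
    define H where "H w = exp (of_real q * g (of_real r * w))" for w :: complex
    have sub: "(\<lambda>w. complex_of_real r * w) ` ball 0 (1 / r) \<subseteq> ball 0 1"
      using r by (auto simp: dist_norm norm_mult field_simps)
    have H: "H holomorphic_on ball 0 (1 / r)"
    proof -
      have "(g \<circ> (\<lambda>w. complex_of_real r * w)) holomorphic_on ball 0 (1 / r)"
        by (rule holomorphic_on_compose_gen[OF _ g(1) sub]) (intro holomorphic_intros)
      then show ?thesis
        unfolding H_def o_def by (intro holomorphic_intros)
    qed
    have nH: "norm (H w) = norm (poly Q (of_real r * w)) powr q" if "norm w \<le> 1" for w
    proof -
      have "r * norm w \<le> r" using r that by (simp add: mult_left_le)
      then have "norm (of_real r * w) < 1"
        using r unfolding norm_mult norm_of_real by linarith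
      then have "poly Q (of_real r * w) = exp (g (r * w))"
        using g(2) by auto
      then show ?thesis
        unfolding H_def by (simp add: powr_def)
    qed
    have sub2: "cball 0 1 \<subseteq> ball (0::complex) (1 / r)"
    proof
      fix w :: complex assume "w \<in> cball 0 1"
      moreover have "1 < 1 / r" using r by simp
      ultimately show "w \<in> ball 0 (1 / r)" unfolding mem_ball_0 mem_cball_0 by linarith
    qed
    have "norm (H z) \<le> 1 / (1 - norm z) * integral {0..1} (\<lambda>t. norm (H (?e t)))"
      using z by (intro holomorphic_mean_bound holomorphic_on_imp_continuous_on
            holomorphic_on_subset[OF H]) (use sub2 in auto)
    then show ?thesis
      using z by (simp add: nH ne I_def)
  qed
  have contI: "continuous_on {0..1} I"
    unfolding I_def interval_cbox
  proof (rule integral_continuous_on_param)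
    show "continuous_on (cbox 0 1 \<times> cbox 0 1) (\<lambda>(r, t). norm (poly Q (complex_of_real r * ?e t)) powr q)"
      using q unfolding circlepath case_prod_unfold
      by (intro continuous_on_powr' continuous_intros) auto
  qed
  obtain R :: "nat \<Rightarrow> real" where R0: "\<And>n. 0 < R n" "\<And>n. R n < 1" and Rlim: "R \<longlonglongrightarrow> 1"
    using radii_to_one by metis
  then have R: "R n \<in> {0<..<1}" for n by simp
  have L1: "(\<lambda>n. I (R n)) \<longlonglongrightarrow> I 1"
    by (rule continuous_on_tendsto_compose[OF contI Rlim]) (use R in \<open>auto simp: less_imp_le\<close>)
  have L2: "(\<lambda>n. norm (poly Q (of_real (R n) * z)) powr q) \<longlonglongrightarrow> norm (poly Q (of_real 1 * z)) powr q"
    using q by (intro tendsto_powr' tendsto_norm isCont_tendsto_compose[OF poly_isCont] tendsto_intros Rlim) auto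
  have "norm (poly Q (of_real 1 * z)) powr q \<le> 1 / (1 - norm z) * I 1"
    by (rule LIMSEQ_le[OF L2 tendsto_mult_left[OF L1]]) (use ineq R in auto)
  then show ?thesis by (simp add: I_def)
qed

text \<open>
  Taylor polynomials converge uniformly on the closed disc, so the case of polynomials suffices;
  for these the zeros can be removed by \<open>poly_zero_free_majorant\<close>.
\<close>

lemma unit_disc_powr_mean_bound:
  assumes F: "F holomorphic_on ball 0 R" and R: "R > 1" and q: "q > 0" and z: "norm z < 1"
  shows "norm (F z) powr q \<le>
    1 / (1 - norm z) * integral {0..1} (\<lambda>t. norm (F (circlepath 0 1 t)) powr q)"
proof -
  let ?e = "circlepath 0 1"
  have ne: "norm (?e t) = 1" for t
    by (simp add: circlepath)
  define a where "a n = (deriv ^^ n) F 0 / fact n" for n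
  define P where "P n = (\<Sum>i<n. monom (a i) i)" for n
  have polyP: "poly (P n) w = (\<Sum>i<n. a i * (w - 0) ^ i)" for n w
    by (simp add: P_def poly_sum poly_monom)
  have sums: "(\<lambda>n. a n * (w - 0) ^ n) sums F w" if "w \<in> ball 0 R" for w
    unfolding a_def using holomorphic_power_series[OF F that] by simp
  have "1 < conv_radius a"
  proof -
    obtain r where r: "1 < r" "r < R" using R dense by blast
    have "ereal r \<le> conv_radius a"
      using conv_radius_geI[of a "of_real r :: complex"] r sums[of "of_real r"] by (auto simp: sums_iff)
    moreover have "1 < ereal r" using r by (simp add: one_ereal_def)
    ultimately show ?thesis by (rule less_le_trans[rotated])
  qed
  then have "uniform_limit (cball 0 1) (\<lambda>n w. poly (P n) w) (\<lambda>w. suminf (\<lambda>i. a i * (w - 0) ^ i)) sequentially"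
    unfolding polyP by (intro powser_uniform_limit) (simp add: one_ereal_def)
  then have ul: "uniform_limit (cball 0 1) (\<lambda>n w. poly (P n) w) F sequentially"
    by (rule uniform_limit_cong'[THEN iffD1, rotated -1])
       (use R sums in \<open>auto simp: sums_iff\<close>)
  have contF: "continuous_on (cball 0 1) F"
    using R by (intro holomorphic_on_imp_continuous_on holomorphic_on_subset[OF F]) auto
  have lim: "(\<lambda>n. poly (P n) w) \<longlonglongrightarrow> F w" if "norm w \<le> 1" for w
    using tendsto_uniform_limitI[OF ul] that by simp
  have lim': "(\<lambda>n. poly (P (n + k)) w) \<longlonglongrightarrow> F w" if "norm w \<le> 1" for w k
    using LIMSEQ_ignore_initial_segment[OF lim[OF that]] .
  obtain B where B: "\<And>w. norm w \<le> 1 \<Longrightarrow> norm (F w) \<le> B"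
    using compact_continuous_image[OF contF compact_cball]
    by (force simp: bounded_iff dest!: compact_imp_bounded)
  have "\<forall>\<^sub>F n in sequentially. \<forall>w\<in>cball 0 1. dist (poly (P n) w) (F w) < 1"
    using uniform_limitD[OF ul] by simp
  then obtain N where N: "\<And>n w. n \<ge> N \<Longrightarrow> norm w \<le> 1 \<Longrightarrow> dist (poly (P n) w) (F w) < 1"
    unfolding eventually_sequentially mem_cball_0[symmetric] by blast
  have bd: "norm (poly (P n) w) \<le> B + 1" if "n \<ge> N" "norm w \<le> 1" for n w
    using N[OF that] B[OF that(2)] norm_triangle_ineq2[of "poly (P n) w" "F w"]
    unfolding dist_norm by linarith
  have "B \<ge> 0" using B[of 0] norm_ge_zero[of "F 0"] by (simp del: norm_ge_zero)
  have ineq: "norm (poly (P n) z) powr q \<le>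
    1 / (1 - norm z) * integral {0..1} (\<lambda>t. norm (poly (P n) (?e t)) powr q)" for n
  proof (cases "P n = 0")
    case True
    then show ?thesis by simp
  next
    case False
    then obtain Q where Q: "\<And>z. norm z < 1 \<Longrightarrow> poly Q z \<noteq> 0"
      "\<And>z. norm z = 1 \<Longrightarrow> norm (poly Q z) = norm (poly (P n) z)"
      "\<And>z. norm z \<le> 1 \<Longrightarrow> norm (poly (P n) z) \<le> norm (poly Q z)"
      using poly_zero_free_majorant by blast
    have "norm (poly (P n) z) powr q \<le> norm (poly Q z) powr q"
      using Q(3)[of z] z q by (intro powr_mono2) auto
    also have "\<dots> \<le> 1 / (1 - norm z) * integral {0..1} (\<lambda>t. norm (poly Q (?e t)) powr q)"
      using poly_powr_mean_bound[OF Q(1) q z] by blast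
    finally show ?thesis by (simp add: Q(2) ne)
  qed
  have int: "(\<lambda>t. norm (poly (P n) (?e t)) powr q) integrable_on {0..1}" for n
    using q unfolding circlepath
    by (intro integrable_continuous_interval continuous_on_powr' continuous_intros) auto
  have L1: "(\<lambda>n. integral {0..1} (\<lambda>t. norm (poly (P (n + N)) (?e t)) powr q)) \<longlonglongrightarrow>
      integral {0..1} (\<lambda>t. norm (F (?e t)) powr q)"
  proof (rule dominated_convergence(2))
    show "(\<lambda>_. (B + 1) powr q) integrable_on {0..1::real}"
      by (rule integrable_const_ivl)
    fix n t
    show "norm (norm (poly (P (n + N)) (?e t)) powr q) \<le> (B + 1) powr q"
      using bd[of "n + N" "?e t"] q ne by (auto intro!: powr_mono2)
  next
    show "(\<lambda>n. norm (poly (P (n + N)) (?e t)) powr q) \<longlonglongrightarrow> norm (F (?e t)) powr q" for t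
      using q by (intro tendsto_powr' tendsto_norm lim') (auto simp: ne)
  qed (rule int)
  have L2: "(\<lambda>n. norm (poly (P (n + N)) z) powr q) \<longlonglongrightarrow> norm (F z) powr q"
    using q z by (intro tendsto_powr' tendsto_norm lim') auto
  show ?thesis
    by (rule LIMSEQ_le[OF L2 tendsto_mult_left[OF L1]]) (use ineq in blast)
qed

lemma powr_mean_bound:
  assumes F: "F holomorphic_on ball \<zeta> R" and r: "0 < r" "r < R" and q: "q > 0" and z: "norm (z - \<zeta>) < r"
  shows "norm (F z) powr q \<le>
    r / (r - norm (z - \<zeta>)) * integral {0..1} (\<lambda>t. norm (F (circlepath \<zeta> r t)) powr q)"
proof -
  define w where "w = (z - \<zeta>) / of_real r"
  have w: "norm w = norm (z - \<zeta>) / r" "\<zeta> + of_real r * w = z"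
    using r by (auto simp: w_def norm_divide)
  have "norm (F (\<zeta> + of_real r * w)) powr q \<le>
    1 / (1 - norm w) * integral {0..1} (\<lambda>t. norm (F (\<zeta> + of_real r * circlepath 0 1 t)) powr q)"
  proof (rule unit_disc_powr_mean_bound[where R = "R / r"])
    show "(\<lambda>x. F (\<zeta> + complex_of_real r * x)) holomorphic_on ball 0 (R / r)"
      by (rule holomorphic_on_compose_gen[OF _ F, unfolded o_def])
         (use r in \<open>auto intro!: holomorphic_intros simp: dist_norm norm_mult field_simps\<close>)
  qed (use r q z in \<open>auto simp: w\<close>)
  also have "1 / (1 - norm w) = r / (r - norm (z - \<zeta>))"
    using r z by (simp add: w field_simps)
  finally show ?thesis
    by (simp add: w circlepath)
qed

section \<open>Integrals over horizontal lines\<close>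

definition level_integral :: "real \<Rightarrow> (complex \<Rightarrow> complex) \<Rightarrow> real \<Rightarrow> ennreal" where
  "level_integral q F y = (\<integral>\<^sup>+x. ennreal (norm (F (Complex x y)) powr q) \<partial>lborel)"

lemma mem_upper_halfplane [simp]: "z \<in> upper_halfplane \<longleftrightarrow> Im z > 0"
  by (simp add: upper_halfplane_def)

lemma open_upper_halfplane: "open upper_halfplane"
  unfolding upper_halfplane_def by (rule open_halfspace_Im_gt)

lemma convex_upper_halfplane: "convex upper_halfplane"
  unfolding upper_halfplane_def by (rule convex_halfspace_Im_gt)

lemma nn_integral_lborel_swap:
  fixes f :: "real \<Rightarrow> real \<Rightarrow> ennreal"
  assumes "case_prod f \<in> borel_measurable borel"
  shows "(\<integral>\<^sup>+y. (\<integral>\<^sup>+x. f x y \<partial>lborel) \<partial>lborel) = (\<integral>\<^sup>+x. (\<integral>\<^sup>+y. f x y \<partial>lborel) \<partial>lborel)"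
  using assms by (intro lborel_pair.Fubini') (simp add: lborel_prod)

lemma borel_measurable_compose_norm_powr:
  assumes "continuous_on upper_halfplane F" "continuous_on UNIV g" "\<And>x. Im (g x) > 0"
  shows "(\<lambda>x. norm (F (g x)) powr q) \<in> borel_measurable borel"
proof -
  have "continuous_on UNIV (\<lambda>x. F (g x))"
    by (rule continuous_on_compose2[OF assms(1,2)]) (use assms(3) in auto)
  then have "(\<lambda>x. F (g x)) \<in> borel_measurable borel"
    by (rule borel_measurable_continuous_onI)
  then show ?thesis by measurable
qed

lemma continuous_on_horizontal_line:
  assumes "continuous_on upper_halfplane F" "y > 0"
  shows "continuous_on UNIV (\<lambda>x. F (Complex x y))"
  by (rule continuous_on_compose2[OF assms(1)]) (use assms(2) in \<open>auto intro!: continuous_intros\<close>)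

lemma borel_measurable_horizontal_line:
  assumes "F holomorphic_on upper_halfplane" "y > 0"
  shows "(\<lambda>x. F (Complex x y)) \<in> borel_measurable borel"
  using assms
  by (intro borel_measurable_continuous_onI continuous_on_horizontal_line holomorphic_on_imp_continuous_on)

lemma Im_circlepath_pos:
  assumes "0 < r" "r < Im w"
  shows "Im (circlepath w r t) > 0"
proof -
  have "\<bar>Im (circlepath w r t - w)\<bar> \<le> norm (circlepath w r t - w)"
    by (rule abs_Im_le_cmod)
  also have "\<dots> = r" using assms by (simp add: circlepath norm_mult)
  finally show ?thesis using assms by simp
qed

lemma continuous_circlepath_pair:
  "continuous_on A (\<lambda>p. circlepath (f p) r (g p))" if "continuous_on A f" "continuous_on A g"
  using that unfolding circlepath by (intro continuous_intros) auto

lemma continuous_on_circlepath_image: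
  assumes F: "F holomorphic_on ball \<zeta> R" and r: "0 < r" "r < R"
  shows "continuous_on UNIV (\<lambda>t. F (circlepath \<zeta> r t))"
proof (rule continuous_on_compose2[OF holomorphic_on_imp_continuous_on[OF F]])
  show "continuous_on UNIV (circlepath \<zeta> r)"
    by (intro continuous_circlepath_pair continuous_intros)
qed (use r in \<open>auto simp: circlepath dist_norm norm_mult\<close>)

lemma nn_integral_unit_interval:
  fixes h :: "real \<Rightarrow> real"
  assumes h: "continuous_on UNIV h" and nn: "\<And>t. h t \<ge> 0"
  shows "(\<integral>\<^sup>+t. ennreal (h t) * indicator {0..1} t \<partial>lborel) = ennreal (integral {0..1} h)"
proof -
  have "(h has_integral integral {0..1} h) {0..1}"
    by (intro integrable_integral integrable_continuous_interval continuous_on_subset[OF h]) auto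
  moreover have "(\<lambda>t. h t * indicator {0..1} t) = (\<lambda>t. if t \<in> {0..1} then h t else 0)"
    by (auto simp: indicator_def)
  ultimately have "((\<lambda>t. h t * indicator {0..1} t) has_integral integral {0..1} h) UNIV"
    by (simp only: has_integral_restrict_UNIV)
  moreover have "h \<in> borel_measurable borel"
    by (rule borel_measurable_continuous_onI[OF h])
  ultimately have "(\<integral>\<^sup>+t. ennreal (h t * indicator {0..1} t) \<partial>lborel) = integral {0..1} h"
    using nn by (intro nn_integral_has_integral_lborel) auto
  moreover have "ennreal (h t * indicator {0..1} t) = ennreal (h t) * indicator {0..1} t" for t
    by (auto simp: indicator_def)
  ultimately show ?thesis by simp
qed

text \<open>
  The same bound with a nonnegative Lebesgue integral, ready for the theorems of Fubini and Fatou.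
\<close>

lemma powr_mean_bound_nn:
  assumes F: "F holomorphic_on ball \<zeta> R" and q: "q > 0"
    and r: "0 < r" "r < R" and z: "norm (z - \<zeta>) < r"
  shows "ennreal (norm (F z) powr q) \<le> ennreal (r / (r - norm (z - \<zeta>))) *
    (\<integral>\<^sup>+t. ennreal (norm (F (circlepath \<zeta> r t)) powr q) * indicator {0..1} t \<partial>lborel)"
proof -
  let ?h = "\<lambda>t. norm (F (circlepath \<zeta> r t)) powr q"
  have h: "continuous_on UNIV ?h"
    by (intro continuous_on_powr' continuous_on_norm continuous_on_const continuous_on_circlepath_image[OF F])
       (use q r in auto)
  have "norm (F z) powr q \<le> r / (r - norm (z - \<zeta>)) * integral {0..1} ?h"
    using r q z by (intro powr_mean_bound[OF F]) auto
  then have "ennreal (norm (F z) powr q) \<le> ennreal (r / (r - norm (z - \<zeta>))) * ennreal (integral {0..1} ?h)"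
    using r z by (subst ennreal_mult[symmetric]) (auto intro!: ennreal_leI integral_nonneg
      integrable_continuous_interval continuous_on_subset[OF h])
  also have "ennreal (integral {0..1} ?h) =
     (\<integral>\<^sup>+t. ennreal (?h t) * indicator {0..1} t \<partial>lborel)"
    by (rule nn_integral_unit_interval[OF h, symmetric]) simp
  finally show ?thesis .
qed

lemma ball_Im_subset_upper_halfplane: "ball \<zeta> (Im \<zeta>) \<subseteq> upper_halfplane"
proof
  fix w assume "w \<in> ball \<zeta> (Im \<zeta>)"
  then have "\<bar>Im (\<zeta> - w)\<bar> < Im \<zeta>"
    by (metis abs_Im_le_cmod dist_norm le_less_trans mem_ball)
  then show "w \<in> upper_halfplane" by auto
qed

lemma level_integral_shift:
  assumes "continuous_on upper_halfplane F" "y > 0"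
  shows "(\<integral>\<^sup>+s. ennreal (norm (F (Complex (a + s) y)) powr q) \<partial>lborel) = level_integral q F y"
proof -
  have "(\<lambda>x. norm (F (Complex x y)) powr q) \<in> borel_measurable borel"
    by (rule borel_measurable_compose_norm_powr[OF assms(1)]) (use assms(2) in \<open>auto intro!: continuous_intros\<close>)
  then have m: "(\<lambda>x. ennreal (norm (F (Complex x y)) powr q)) \<in> borel_measurable borel"
    by measurable
  show ?thesis
    unfolding level_integral_def
    using nn_integral_real_affine[OF m, of 1 a] by simp
qed

text \<open>
  If the centre of the circle is shifted horizontally by \<open>s\<close>, the mean bound still estimates the
  same value \<open>|F(w)|\<^sup>q\<close>. Integration over \<open>s\<close> turns the right-hand side into an average of
  integrals over horizontal lines.
\<close>

lemma level_integral_pointwise_bound: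
  assumes F: "F holomorphic_on upper_halfplane" and q: "q > 0" and B: "B \<ge> 0"
    and le: "\<And>y. y > 0 \<Longrightarrow> level_integral q F y \<le> ennreal B"
    and w: "Im w > 0"
  shows "norm (F w) powr q \<le> 4 * B / Im w"
proof -
  note contF = holomorphic_on_imp_continuous_on[OF F]
  \<comment> \<open>circles of this radius around points at the height of \<open>w\<close> stay inside the half-plane; with shifts up to
    half the radius the factor in the mean bound is at most \<open>2\<close>\<close>
  define r where "r = Im w / 2"
  have r: "0 < r" "r < Im w" using w by (auto simp: r_def)
  let ?S = "{-r/2..r/2}"
  let ?u = "\<lambda>s t. ennreal (norm (F (circlepath (w + of_real s) r t)) powr q)"
  have circ: "circlepath (w + of_real s) r t =
      Complex (Re (circlepath w r t) + s) (Im (circlepath w r t))" for s t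
    by (simp add: circlepath complex_eq_iff)
  have meas: "(\<lambda>(t, s). ?u s t * indicator {0..1} t) \<in> borel_measurable borel"
  proof -
    have [measurable]: "(\<lambda>p. norm (F (circlepath (w + of_real (snd p)) r (fst p))) powr q) \<in> borel_measurable borel"
    proof (rule borel_measurable_compose_norm_powr[OF contF])
      show "continuous_on UNIV (\<lambda>p. circlepath (w + complex_of_real (snd p)) r (fst p))"
        by (intro continuous_circlepath_pair continuous_intros)
    qed (use Im_circlepath_pos r in auto)
    have [measurable]: "(\<lambda>p::real \<times> real. indicator {0..1} (fst p) :: ennreal) \<in> borel_measurable borel"
      by (rule measurable_compose[OF borel_measurable_continuous_onI[OF continuous_on_fst[OF continuous_on_id]]]) auto
    show ?thesis unfolding case_prod_unfold by measurable
  qed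
  have each: "ennreal (norm (F w) powr q) * indicator ?S s \<le>
     2 * (\<integral>\<^sup>+t. ?u s t * indicator {0..1} t \<partial>lborel)" for s
  proof (cases "s \<in> ?S")
    case True
    have n: "norm (w - (w + of_real s)) = \<bar>s\<bar>" by simp
    have s: "\<bar>s\<bar> \<le> r / 2" using True by auto
    have "ennreal (norm (F w) powr q) \<le> ennreal (r / (r - \<bar>s\<bar>)) * (\<integral>\<^sup>+t. ?u s t * indicator {0..1} t \<partial>lborel)"
      using powr_mean_bound_nn[OF holomorphic_on_subset[OF F ball_Im_subset_upper_halfplane] q r(1),
          of "w + of_real s" w] r s n by simp
    also have "\<dots> \<le> 2 * (\<integral>\<^sup>+t. ?u s t * indicator {0..1} t \<partial>lborel)"
    proof (rule mult_right_mono)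
      have "r / (r - \<bar>s\<bar>) \<le> 2" using s r by (simp add: field_simps)
      then show "ennreal (r / (r - \<bar>s\<bar>)) \<le> 2"
        by (metis ennreal_leI ennreal_numeral zero_le_numeral)
    qed simp
    finally show ?thesis using True by simp
  qed simp
  have "ennreal (norm (F w) powr q) * ennreal r = (\<integral>\<^sup>+s. ennreal (norm (F w) powr q) * indicator ?S s \<partial>lborel)"
    using r by (subst nn_integral_cmult_indicator) auto
  also have "\<dots> \<le> (\<integral>\<^sup>+s. 2 * (\<integral>\<^sup>+t. ?u s t * indicator {0..1} t \<partial>lborel) \<partial>lborel)"
    by (intro nn_integral_mono each)
  also have "\<dots> = 2 * (\<integral>\<^sup>+s. (\<integral>\<^sup>+t. ?u s t * indicator {0..1} t \<partial>lborel) \<partial>lborel)"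
  proof (rule nn_integral_cmult)
    have "(\<lambda>(s, t). ?u s t * indicator {0..1} t) \<in> borel_measurable (lborel \<Otimes>\<^sub>M lborel)"
      using measurable_compose[OF measurable_pair_swap'[of lborel lborel], of "\<lambda>(t, s). ?u s t * indicator {0..1} t" borel] meas
      by (simp add: lborel_prod case_prod_unfold prod.swap_def)
    then show "(\<lambda>s. \<integral>\<^sup>+t. ?u s t * indicator {0..1} t \<partial>lborel) \<in> borel_measurable lborel"
      using lborel.borel_measurable_nn_integral_fst by fastforce
  qed
  also have "(\<integral>\<^sup>+s. (\<integral>\<^sup>+t. ?u s t * indicator {0..1} t \<partial>lborel) \<partial>lborel) =
      (\<integral>\<^sup>+t. (\<integral>\<^sup>+s. ?u s t * indicator {0..1} t \<partial>lborel) \<partial>lborel)"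
    by (rule nn_integral_lborel_swap[OF meas])
  also have "\<dots> \<le> (\<integral>\<^sup>+t. ennreal B * indicator {0..1::real} t \<partial>lborel)"
  proof (rule nn_integral_mono)
    fix t :: real
    have "(\<integral>\<^sup>+s. ?u s t \<partial>lborel) \<le> ennreal B"
      unfolding circ
      using le[OF Im_circlepath_pos[OF r, of t]] level_integral_shift[OF contF Im_circlepath_pos[OF r, of t]]
      by simp
    then show "(\<integral>\<^sup>+s. ?u s t * indicator {0..1} t \<partial>lborel) \<le> ennreal B * indicator {0..1} t"
      by (cases "t \<in> {0..1}") auto
  qed
  also have "\<dots> = ennreal B"
    by (subst nn_integral_cmult_indicator) auto
  finally have "ennreal (norm (F w) powr q) * ennreal r \<le> 2 * ennreal B"
    by (simp add: mult_left_mono)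
  then have "ennreal (norm (F w) powr q * r) \<le> ennreal (2 * B)"
    using r B by (simp add: ennreal_mult)
  then have "norm (F w) powr q * r \<le> 2 * B"
    using B by (subst (asm) ennreal_le_iff) auto
  then show ?thesis using w by (simp add: r_def field_simps)
qed

section \<open>Poisson majorants and minorants in the half-plane\<close>

definition poisson_kernel :: "real \<Rightarrow> real \<Rightarrow> real" where
  "poisson_kernel Y s = Y / (pi * (s\<^sup>2 + Y\<^sup>2))"

text \<open>
  The conformal map of the unit disc onto the half-plane above the height of \<open>b\<close> that takes \<open>0\<close> to
  \<open>b + i Y\<close> and \<open>1\<close> to infinity.
\<close>

definition cayley :: "complex \<Rightarrow> real \<Rightarrow> complex \<Rightarrow> complex" where
  "cayley b Y w = b + \<i> * of_real Y * ((1 + w) / (1 - w))"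

lemma borel_measurable_tan: "tan \<in> borel_measurable (borel :: real measure)"
  unfolding tan_def by (intro borel_measurable_divide borel_measurable_continuous_onI continuous_intros)

text \<open>
  The Cayley map takes the point of the circle with parameter \<open>t\<close> to the point
  \<open>a + Y tan(\<pi> t - \<pi> / 2)\<close> of the boundary line. So this is the statement that the image of the
  uniform distribution on the circle has the Poisson kernel as density.
\<close>

lemma nn_integral_tan_substitution:
  fixes h :: "real \<Rightarrow> real"
  assumes h: "continuous_on UNIV h" and nn: "\<And>s. h s \<ge> 0" and Y: "Y > 0"
  shows "(\<integral>\<^sup>+t. ennreal (h (a + Y * tan (pi * t - pi / 2))) * indicator {0<..<1} t \<partial>lborel) =
         (\<integral>\<^sup>+s. ennreal (h s * poisson_kernel Y (s - a)) \<partial>lborel)"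
proof -
  define f where "f t = h (a + Y * tan (pi * t - pi / 2))" for t
  define g where "g s = 1 / 2 + arctan ((s - a) / Y) / pi" for s
  \<comment> \<open>the substitution rule covers compact intervals; these exhaust the line and the open unit interval\<close>
  define S where "S n = {a - real n .. a + real n}" for n
  define T where "T n = {g (a - real n) .. g (a + real n)}" for n
  have fg: "f (g s) = h s" for s
    using Y by (simp add: f_def g_def distrib_left tan_arctan)
  have gf: "g (a + Y * tan (pi * t - pi / 2)) = t" if "t \<in> {0<..<1}" for t
  proof -
    have "arctan (tan (pi * t - pi / 2)) = pi * t - pi / 2"
      using that by (intro arctan_tan) (auto simp: field_simps)
    then show ?thesis using Y by (simp add: g_def field_simps)
  qed
  have g01: "g s \<in> {0<..<1}" for s
    using arctan_bounded[of "(s - a) / Y"] by (auto simp: g_def field_simps)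
  have gmono: "g s \<le> g s' \<longleftrightarrow> s \<le> s'" for s s'
    using Y by (auto simp: g_def arctan_le_iff divide_le_cancel)
  have g': "(g has_real_derivative poisson_kernel Y (s - a)) (at s)" for s
  proof -
    have d: "((\<lambda>s. (s - a) / Y) has_real_derivative 1 / Y) (at s)"
      using Y by (auto intro!: derivative_eq_intros)
    have "1 + ((s - a) / Y)\<^sup>2 = ((s - a)\<^sup>2 + Y\<^sup>2) / Y\<^sup>2"
      using Y by (simp add: power_divide add_divide_distrib)
    then have "0 + inverse (1 + ((s - a) / Y)\<^sup>2) * (1 / Y) / pi = poisson_kernel Y (s - a)"
      using Y by (simp add: poisson_kernel_def power2_eq_square)
    then show ?thesis
      using DERIV_add[OF DERIV_const DERIV_cdivide[OF DERIV_chain2[OF DERIV_arctan d], of pi], of "1 / 2"]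
      unfolding g_def by (simp only:)
  qed
  have hm: "h \<in> borel_measurable borel"
    by (rule borel_measurable_continuous_onI[OF h])
  have fm: "f \<in> borel_measurable borel"
  proof -
    show ?thesis unfolding f_def using hm borel_measurable_tan by measurable
  qed
  have pm: "poisson_kernel Y \<in> borel_measurable borel"
    unfolding poisson_kernel_def by measurable
  have pnn: "poisson_kernel Y s \<ge> 0" for s
    using Y by (simp add: poisson_kernel_def)
  have eq: "(\<integral>\<^sup>+t. ennreal (f t) * indicator (T n) t \<partial>lborel) =
      (\<integral>\<^sup>+s. ennreal (h s * poisson_kernel Y (s - a)) * indicator (S n) s \<partial>lborel)" for n
  proof -
    have "(\<integral>\<^sup>+t. ennreal (f t * indicator (T n) t) \<partial>lborel) =
      (\<integral>\<^sup>+s. ennreal (f (g s) * poisson_kernel Y (s - a) * indicator (S n) s) \<partial>lborel)"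
      unfolding T_def S_def
    proof (rule nn_integral_substitution[OF _ g'])
      show "set_borel_measurable borel {g (a - real n)..g (a + real n)} f"
        unfolding set_borel_measurable_def using fm by measurable
      show "continuous_on {a - real n..a + real n} (\<lambda>s. poisson_kernel Y (s - a))"
        unfolding poisson_kernel_def using Y by (auto intro!: continuous_intros simp: sum_power2_eq_zero_iff)
    qed (use pnn in auto)
    moreover have "ennreal (f t * indicator (T n) t) = ennreal (f t) * indicator (T n) t" for t
      by (auto simp: indicator_def)
    moreover have "ennreal (f (g s) * poisson_kernel Y (s - a) * indicator (S n) s) =
       ennreal (h s * poisson_kernel Y (s - a)) * indicator (S n) s" for s
      by (auto simp: indicator_def fg)
    ultimately show ?thesis by simp
  qed
  let ?M = "density lborel (\<lambda>t. ennreal (f t))"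
  let ?N = "density lborel (\<lambda>s. ennreal (h s * poisson_kernel Y (s - a)))"
  have UT: "(\<Union>n. T n) = {0<..<1}"
  proof (intro equalityI subsetI)
    fix t assume "t \<in> (\<Union>n. T n)"
    then obtain n where "g (a - real n) \<le> t" "t \<le> g (a + real n)" by (auto simp: T_def)
    then show "t \<in> {0<..<1}" using g01[of "a - real n"] g01[of "a + real n"] by auto
  next
    fix t :: real assume t: "t \<in> {0<..<1}"
    define s where "s = a + Y * tan (pi * t - pi / 2)"
    obtain n where "\<bar>s - a\<bar> \<le> real n" using real_arch_simple by blast
    then have "g (a - real n) \<le> g s" "g s \<le> g (a + real n)" unfolding gmono by linarith+
    then show "t \<in> (\<Union>n. T n)" using gf[OF t] unfolding T_def s_def by auto
  qed
  have US: "(\<Union>n. S n) = UNIV"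
  proof (intro equalityI subsetI UNIV_I)
    fix s
    obtain n where "\<bar>s - a\<bar> \<le> real n" using real_arch_simple by blast
    then show "s \<in> (\<Union>n. S n)" by (auto simp: S_def intro!: exI[of _ n])
  qed
  have "emeasure ?M {0<..<1} = (SUP n. emeasure ?M (T n))"
    unfolding UT[symmetric]
    by (rule SUP_emeasure_incseq[symmetric]) (auto simp: T_def incseq_def gmono intro: order_trans[OF _ iffD2[OF gmono]] order_trans[OF iffD2[OF gmono]])
  also have "\<dots> = (SUP n. emeasure ?N (S n))"
  proof (rule SUP_cong[OF refl])
    fix n
    have "T n \<in> sets lborel" "S n \<in> sets lborel" by (auto simp: T_def S_def)
    then show "emeasure ?M (T n) = emeasure ?N (S n)"
      using fm hm pm eq[of n] by (simp add: emeasure_density)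
  qed
  also have "\<dots> = emeasure ?N UNIV"
    unfolding US[symmetric]
    by (rule SUP_emeasure_incseq) (auto simp: S_def incseq_def)
  finally show ?thesis
    unfolding f_def[symmetric] using fm hm pm by (simp add: emeasure_density)
qed

lemma Im_cayley:
  assumes "Y > 0" "norm w < 1"
  shows "Im (cayley b Y w) > Im b"
proof -
  have "w \<noteq> 1" using assms by auto
  then have ne: "norm (1 - w) > 0" by simp
  have "Re ((1 + w) / (1 - w)) = (1 - (norm w)\<^sup>2) / (norm (1 - w))\<^sup>2"
    unfolding Re_divide cmod_power2 by (simp add: algebra_simps power2_eq_square)
  also have "\<dots> > 0" using ne assms by (simp add: abs_square_less_1)
  finally have "Y * Re ((1 + w) / (1 - w)) > 0" using assms by (simp only: mult_pos_pos)
  moreover have "Im (\<i> * of_real Y * v) = Y * Re v" for v by simp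
  ultimately show ?thesis unfolding cayley_def by (metis plus_complex.sel(2) less_add_same_cancel1)
qed

lemma holomorphic_cayley: "cayley b Y holomorphic_on ball 0 1"
  unfolding cayley_def by (intro holomorphic_intros) auto

lemma cayley_0: "cayley b Y 0 = b + \<i> * of_real Y"
  by (simp add: cayley_def)

lemma cayley_circle:
  assumes "t \<in> {0<..<1}"
  shows "cayley b Y (circlepath 0 1 t) = b + of_real (Y * tan (pi * t - pi / 2))"
    and "circlepath 0 1 t \<noteq> 1"
proof -
  define c s where "c = cos (pi * t)" and "s = sin (pi * t)"
  have s: "s > 0" unfolding s_def using assms by (intro sin_gt_zero) auto
  define e where "e = Complex c s"
  have cs: "c\<^sup>2 + s\<^sup>2 = 1" by (simp add: c_def s_def)
  have "circlepath 0 1 t = exp (\<i> * of_real (pi * t)) * exp (\<i> * of_real (pi * t))"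
    by (simp add: circlepath exp_add[symmetric] algebra_simps)
  also have "exp (\<i> * of_real (pi * t)) = e"
    by (simp add: complex_eq_iff e_def c_def s_def Re_exp Im_exp)
  finally have w: "circlepath 0 1 t = e * e" .
  have m: "1 - e * e = - 2 * \<i> * of_real s * e"
    using cs by (simp add: e_def complex_eq_iff algebra_simps power2_eq_square)
  have p: "1 + e * e = 2 * of_real c * e"
    using cs by (simp add: e_def complex_eq_iff algebra_simps power2_eq_square)
  have e0: "e \<noteq> 0" using s by (auto simp: e_def complex_eq_iff)
  have q: "(1 + e * e) / (1 - e * e) = \<i> * of_real (c / s)" "1 - e * e \<noteq> 0"
    unfolding m p using s e0 by (auto simp: divide_simps)
  have "tan (pi * t - pi / 2) = - (c / s)"
    by (simp add: tan_def sin_diff cos_diff c_def s_def)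
  then show "cayley b Y (circlepath 0 1 t) = b + of_real (Y * tan (pi * t - pi / 2))"
    unfolding cayley_def w q by (simp add: algebra_simps)
  show "circlepath 0 1 t \<noteq> 1" using q(2) unfolding w by auto
qed

lemma cayley_radial_limit:
  assumes t: "t \<in> {0<..<1}" and R: "R \<longlonglongrightarrow> 1"
  shows "(\<lambda>n. cayley b Y (circlepath 0 (R n) t)) \<longlonglongrightarrow> b + of_real (Y * tan (pi * t - pi / 2))"
proof -
  have "(\<lambda>n. of_real (R n) * circlepath 0 1 t) \<longlonglongrightarrow> of_real 1 * circlepath 0 1 t"
    by (intro tendsto_intros R)
  moreover have "circlepath 0 (R n) t = of_real (R n) * circlepath 0 1 t" for n
    by (simp add: circlepath)
  ultimately have "(\<lambda>n. circlepath 0 (R n) t) \<longlonglongrightarrow> circlepath 0 1 t" by simp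
  then have "(\<lambda>n. cayley b Y (circlepath 0 (R n) t)) \<longlonglongrightarrow> cayley b Y (circlepath 0 1 t)"
    unfolding cayley_def using cayley_circle(2)[OF t] by (intro tendsto_intros) auto
  then show ?thesis using cayley_circle(1)[OF t] by simp
qed

lemma nn_integral_open_unit_interval:
  "(\<integral>\<^sup>+t. f t * indicator {0..1} t \<partial>lborel) = (\<integral>\<^sup>+t. f t * indicator {0<..<1::real} t \<partial>lborel)"
proof (rule nn_integral_cong_AE)
  have "AE t in lborel. t \<noteq> (0::real)" "AE t in lborel. t \<noteq> (1::real)"
    by (rule AE_lborel_singleton)+
  then show "AE t in lborel. f t * indicator {0..1} t = f t * indicator {0<..<1::real} t"
    by eventually_elim (auto simp: indicator_def)
qed

text \<open>
  The mean bound on circles around \<open>0\<close>, applied to the composition of \<open>F\<close> with the Cayley map. As the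
  radius tends to \<open>1\<close>, dominated convergence applies because \<open>F\<close> is bounded above the line.
\<close>

lemma poisson_majorant:
  assumes F: "F holomorphic_on upper_halfplane" and q: "q > 0" and \<delta>: "\<delta> > 0"
    and K: "\<And>z. Im z > \<delta> \<Longrightarrow> norm (F z) powr q \<le> K"
    and z: "Im z > 0"
  shows "ennreal (norm (F (z + \<i> * of_real \<delta>)) powr q) \<le>
    (\<integral>\<^sup>+s. ennreal (norm (F (Complex s \<delta>)) powr q * poisson_kernel (Im z) (s - Re z)) \<partial>lborel)"
proof -
  note contF = holomorphic_on_imp_continuous_on[OF F]
  let ?C = "cayley (Complex (Re z) \<delta>) (Im z)"
  let ?h = "\<lambda>s. norm (F (Complex s \<delta>)) powr q"
  define G where "G = F \<circ> ?C"
  have ImC: "Im (?C w) > \<delta>" if "norm w < 1" for w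
    using Im_cayley[OF z that, of "Complex (Re z) \<delta>"] by simp
  have G: "G holomorphic_on ball 0 1"
    unfolding G_def using ImC \<delta> by (intro holomorphic_on_compose_gen[OF holomorphic_cayley F]) force
  obtain R :: "nat \<Rightarrow> real" where R: "\<And>n. 0 < R n" "\<And>n. R n < 1" "R \<longlonglongrightarrow> 1" using radii_to_one by metis
  have n: "norm (circlepath 0 (R n) t) = R n" for n t
    using R(1)[of n] by (simp add: circlepath norm_mult)
  let ?v = "\<lambda>n t. ennreal (norm (G (circlepath 0 (R n) t)) powr q) * indicator {0<..<1} t"
  let ?v' = "\<lambda>t. ennreal (?h (Re z + Im z * tan (pi * t - pi / 2))) * indicator {0<..<1} t"
  have G0: "G 0 = F (z + \<i> * of_real \<delta>)"
    unfolding G_def by (simp add: cayley_0) (rule arg_cong[of _ _ F], simp add: complex_eq_iff)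
  have ineq: "ennreal (norm (F (z + \<i> * of_real \<delta>)) powr q) \<le> (\<integral>\<^sup>+t. ?v n t \<partial>lborel)" for n
    using powr_mean_bound_nn[OF G q R(1)[of n] R(2)[of n], of 0] R(1)[of n]
    unfolding G0 nn_integral_open_unit_interval by simp
  have hcont: "continuous_on UNIV ?h"
    by (intro continuous_on_powr' continuous_on_norm continuous_on_const continuous_on_horizontal_line contF \<delta>)
       (use q in auto)
  have "(\<lambda>n. \<integral>\<^sup>+t. ?v n t \<partial>lborel) \<longlonglongrightarrow> (\<integral>\<^sup>+t. ?v' t \<partial>lborel)"
  proof (rule nn_integral_dominated_convergence)
    show "?v n \<in> borel_measurable lborel" for n
    proof -
      have [measurable]: "(\<lambda>t. G (circlepath 0 (R n) t)) \<in> borel_measurable borel"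
        by (rule borel_measurable_continuous_onI[OF continuous_on_circlepath_image[OF G R(1,2)]])
      show ?thesis by measurable
    qed
    show "?v' \<in> borel_measurable lborel"
    proof -
      have [measurable]: "?h \<in> borel_measurable borel"
        by (rule borel_measurable_continuous_onI[OF hcont])
      note [measurable] = borel_measurable_tan
      show ?thesis by measurable
    qed
    show "(\<lambda>t. ennreal K * indicator {0<..<1::real} t) \<in> borel_measurable lborel" by measurable
    show "(\<integral>\<^sup>+t. ennreal K * indicator {0<..<1::real} t \<partial>lborel) < \<infinity>"
      by (subst nn_integral_cmult_indicator) (auto simp: ennreal_mult_less_top)
    show "AE t in lborel. ?v n t \<le> ennreal K * indicator {0<..<1} t" for n
      using K ImC n R(2) by (intro AE_I2 mult_right_mono ennreal_leI) (auto simp: G_def)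
    show "AE t in lborel. (\<lambda>n. ?v n t) \<longlonglongrightarrow> ?v' t"
    proof (rule AE_I2)
      fix t :: real
      show "(\<lambda>n. ?v n t) \<longlonglongrightarrow> ?v' t"
      proof (cases "t \<in> {0<..<1}")
        case True
        have "(\<lambda>n. ?C (circlepath 0 (R n) t)) \<longlonglongrightarrow> Complex (Re z + Im z * tan (pi * t - pi / 2)) \<delta>"
          using cayley_radial_limit[OF True R(3), of "Complex (Re z) \<delta>" "Im z"]
          by (simp add: complex_eq_iff Complex_eq algebra_simps)
        then have "(\<lambda>n. F (?C (circlepath 0 (R n) t))) \<longlonglongrightarrow> F (Complex (Re z + Im z * tan (pi * t - pi / 2)) \<delta>)"
          using ImC n R(2) \<delta> by (intro continuous_on_tendsto_compose[OF contF]) (auto intro!: always_eventually intro: less_trans)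
        then have "(\<lambda>n. ennreal (norm (F (?C (circlepath 0 (R n) t))) powr q)) \<longlonglongrightarrow>
            ennreal (?h (Re z + Im z * tan (pi * t - pi / 2)))"
          using q by (intro tendsto_ennrealI tendsto_powr' tendsto_norm tendsto_const) auto
        then show ?thesis
          using True by (simp add: G_def)
      qed simp
    qed
  qed
  then have "ennreal (norm (F (z + \<i> * of_real \<delta>)) powr q) \<le> (\<integral>\<^sup>+t. ?v' t \<partial>lborel)"
    by (rule LIMSEQ_le_const) (use ineq in auto)
  also have "\<dots> = (\<integral>\<^sup>+s. ennreal (?h s * poisson_kernel (Im z) (s - Re z)) \<partial>lborel)"
    by (rule nn_integral_tan_substitution[OF hcont _ z]) simp
  finally show ?thesis .
qed

lemma holomorphic_Im_mean:
  assumes G: "G holomorphic_on ball 0 1" and r: "0 < r" "r < 1"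
  shows "integral {0..1} (\<lambda>t. Im (G (circlepath 0 r t))) = Im (G 0)"
proof -
  have "((\<lambda>u. G u / (u - 0)) has_contour_integral (2 * of_real pi * \<i> * G 0)) (circlepath 0 r)"
    using r by (intro Cauchy_integral_circlepath holomorphic_on_imp_continuous_on holomorphic_on_subset[OF G]) auto
  then have "((\<lambda>t. 2 * of_real pi * \<i> * G (circlepath 0 r t)) has_integral (2 * of_real pi * \<i> * G 0)) {0..1}"
    unfolding has_contour_integral vector_derivative_circlepath
    using r by (simp add: circlepath field_simps)
  from has_integral_mult_right[OF this, of "inverse (2 * of_real pi * \<i>)"]
  have "((\<lambda>t. G (circlepath 0 r t)) has_integral G 0) {0..1}"
    by (simp add: field_simps)
  from has_integral_linear[OF this bounded_linear_Im] show ?thesis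
    by (simp add: o_def integral_unique)
qed

text \<open>
  For a positive harmonic function the mean value over circles is exact, and Fatou's lemma gives an
  inequality as the radius tends to \<open>1\<close>. Part of the mass may be lost at infinity, which is why there
  is no equality in general.
\<close>

lemma poisson_minorant:
  assumes g: "g holomorphic_on upper_halfplane" and nn: "\<And>z. Im z > 0 \<Longrightarrow> Im (g z) \<ge> 0"
    and y: "y > 0" and Y: "Y > 0"
  shows "(\<integral>\<^sup>+x. ennreal (Im (g (Complex x y)) * poisson_kernel Y x) \<partial>lborel) \<le>
    ennreal (Im (g (Complex 0 (y + Y))))"
proof -
  note contg = holomorphic_on_imp_continuous_on[OF g]
  let ?C = "cayley (Complex 0 y) Y"
  let ?h = "\<lambda>s. Im (g (Complex s y))"
  define G where "G = g \<circ> ?C"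
  have ImC: "Im (?C w) > y" if "norm w < 1" for w
    using Im_cayley[OF Y that, of "Complex 0 y"] by simp
  have G: "G holomorphic_on ball 0 1"
    unfolding G_def using ImC y by (intro holomorphic_on_compose_gen[OF holomorphic_cayley g]) force
  obtain R :: "nat \<Rightarrow> real" where R: "\<And>n. 0 < R n" "\<And>n. R n < 1" "R \<longlonglongrightarrow> 1" using radii_to_one by metis
  have n: "norm (circlepath 0 (R n) t) = R n" for n t
    using R(1)[of n] by (simp add: circlepath norm_mult)
  let ?v = "\<lambda>n t. ennreal (Im (G (circlepath 0 (R n) t))) * indicator {0<..<1} t"
  let ?v' = "\<lambda>t. ennreal (?h (0 + Y * tan (pi * t - pi / 2))) * indicator {0<..<1} t"
  have G0: "G 0 = g (Complex 0 (y + Y))"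
    unfolding G_def by (simp add: cayley_0) (rule arg_cong[of _ _ g], simp add: complex_eq_iff)
  note Gcont = continuous_on_circlepath_image[OF G R(1,2)]
  have eq: "(\<integral>\<^sup>+t. ?v n t \<partial>lborel) = ennreal (Im (G 0))" for n
  proof -
    have "(\<integral>\<^sup>+t. ennreal (Im (G (circlepath 0 (R n) t))) * indicator {0..1} t \<partial>lborel)
       = ennreal (integral {0..1} (\<lambda>t. Im (G (circlepath 0 (R n) t))))"
      by (rule nn_integral_unit_interval)
         (use Gcont nn[OF less_trans[OF y ImC]] n R(2) in \<open>auto intro!: continuous_on_Im simp: G_def\<close>)
    then show ?thesis
      unfolding nn_integral_open_unit_interval holomorphic_Im_mean[OF G R(1,2)] .
  qed
  have hcont: "continuous_on UNIV ?h"
    by (intro continuous_on_Im continuous_on_horizontal_line contg y)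
  have "(\<integral>\<^sup>+x. ennreal (?h x * poisson_kernel Y (x - 0)) \<partial>lborel) = (\<integral>\<^sup>+t. ?v' t \<partial>lborel)"
    by (rule nn_integral_tan_substitution[OF hcont _ Y, symmetric]) (use nn y in auto)
  also have "\<dots> \<le> (\<integral>\<^sup>+t. liminf (\<lambda>n. ?v n t) \<partial>lborel)"
  proof (rule nn_integral_mono)
    fix t :: real
    have "(\<lambda>n. ?v n t) \<longlonglongrightarrow> ?v' t"
    proof (cases "t \<in> {0<..<1}")
      case True
      have "(\<lambda>n. ?C (circlepath 0 (R n) t)) \<longlonglongrightarrow> Complex (0 + Y * tan (pi * t - pi / 2)) y"
        using cayley_radial_limit[OF True R(3), of "Complex 0 y" "Y"]
        by (simp add: complex_eq_iff Complex_eq algebra_simps)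
      then have "(\<lambda>n. g (?C (circlepath 0 (R n) t))) \<longlonglongrightarrow> g (Complex (0 + Y * tan (pi * t - pi / 2)) y)"
        using ImC n R(2) y by (intro continuous_on_tendsto_compose[OF contg]) (auto intro!: always_eventually intro: less_trans)
      then have "(\<lambda>n. ennreal (Im (g (?C (circlepath 0 (R n) t))))) \<longlonglongrightarrow>
          ennreal (?h (0 + Y * tan (pi * t - pi / 2)))"
        by (intro tendsto_ennrealI tendsto_Im)
      then show ?thesis
        using True by (simp add: G_def)
    qed simp
    then show "?v' t \<le> liminf (\<lambda>n. ?v n t)"
      by (simp add: lim_imp_Liminf)
  qed
  also have "\<dots> \<le> liminf (\<lambda>n. \<integral>\<^sup>+t. ?v n t \<partial>lborel)"
  proof (rule nn_integral_liminf)
    fix n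
    have [measurable]: "(\<lambda>t. G (circlepath 0 (R n) t)) \<in> borel_measurable borel"
      by (rule borel_measurable_continuous_onI[OF Gcont])
    show "?v n \<in> borel_measurable lborel" by measurable
  qed
  also have "\<dots> = ennreal (Im (g (Complex 0 (y + Y))))"
    unfolding eq G0 by (rule Liminf_const) simp
  finally show ?thesis by simp
qed

section \<open>Subordination and monotonicity of the line integrals\<close>

text \<open>
  As a function of \<open>z\<close>, the Poisson kernel at \<open>\<phi>(z)\<close> is the imaginary part of
  \<open>-1 / (\<phi>(z) - s)\<close> divided by \<open>\<pi>\<close>, and it is at most \<open>1 / (\<pi> c Im z)\<close>. The minorant with
  parameter \<open>Y\<close>, multiplied by \<open>\<pi> Y\<close>, has weights that increase to \<open>1\<close>, while the right-hand side
  stays below \<open>1 / c\<close>.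
\<close>

lemma total_poisson_mass_le:
  assumes \<phi>: "\<phi> holomorphic_on upper_halfplane" and c: "c > 0"
    and Im: "\<And>z. Im z > 0 \<Longrightarrow> Im (\<phi> z) \<ge> c * Im z" and y: "y > 0"
  shows "(\<integral>\<^sup>+x. ennreal (poisson_kernel (Im (\<phi> (Complex x y))) (s - Re (\<phi> (Complex x y)))) \<partial>lborel)
    \<le> ennreal (1 / c)"
proof -
  have pos: "Im (\<phi> z) > 0" if "Im z > 0" for z
    using Im[OF that] mult_pos_pos[OF c that] by linarith
  define g where "g z = - 1 / (\<phi> z - of_real s)" for z
  have ne: "\<phi> z - of_real s \<noteq> 0" if "Im z > 0" for z
    using pos[OF that] by (auto simp: complex_eq_iff)
  have g: "g holomorphic_on upper_halfplane"
    unfolding g_def using ne by (intro holomorphic_intros \<phi>) auto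
  have Img: "Im (g z) = pi * poisson_kernel (Im (\<phi> z)) (s - Re (\<phi> z))" for z
    by (simp add: g_def poisson_kernel_def Im_divide power2_commute)
  have pnn: "poisson_kernel (Im (\<phi> z)) u \<ge> 0" if "Im z > 0" for z u
    using pos[OF that] by (simp add: poisson_kernel_def)
  have le: "pi * poisson_kernel (Im (\<phi> z)) u \<le> 1 / (c * Im z)" if z: "Im z > 0" for z u
  proof -
    have "poisson_kernel (Im (\<phi> z)) u \<le> Im (\<phi> z) / (pi * (Im (\<phi> z))\<^sup>2)"
      unfolding poisson_kernel_def using pos[OF z]
      by (intro divide_left_mono mult_left_mono mult_pos_pos add_nonneg_pos) auto
    also have "\<dots> = 1 / (pi * Im (\<phi> z))"
      using pos[OF z] by (simp add: power2_eq_square)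
    also have "\<dots> \<le> 1 / (pi * (c * Im z))"
      using Im[OF z] pos[OF z] c z by (intro divide_left_mono mult_left_mono mult_pos_pos) auto
    finally have "pi * poisson_kernel (Im (\<phi> z)) u \<le> pi * (1 / (pi * (c * Im z)))"
      by (intro mult_left_mono) auto
    then show ?thesis by simp
  qed
  let ?p = "\<lambda>x. poisson_kernel (Im (\<phi> (Complex x y))) (s - Re (\<phi> (Complex x y)))"
  let ?Y = "\<lambda>n::nat. real (Suc n)"
  let ?w = "\<lambda>n x. (?Y n)\<^sup>2 / (x\<^sup>2 + (?Y n)\<^sup>2)"
  have bound: "(\<integral>\<^sup>+x. ennreal (?p x * ?w n x) \<partial>lborel) \<le> ennreal (1 / c)" for n
  proof -
    have "(\<integral>\<^sup>+x. ennreal (Im (g (Complex x y)) * poisson_kernel (?Y n) x) \<partial>lborel) \<le>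
        ennreal (Im (g (Complex 0 (y + ?Y n))))"
      by (rule poisson_minorant[OF g _ y]) (use pnn in \<open>auto simp: Img\<close>)
    also have "\<dots> \<le> ennreal (1 / (c * (y + ?Y n)))"
      using le[of "Complex 0 (y + ?Y n)" "s - Re (\<phi> (Complex 0 (y + ?Y n)))"] y c
      by (intro ennreal_leI) (simp add: Img)
    finally have "ennreal (?Y n) * (\<integral>\<^sup>+x. ennreal (Im (g (Complex x y)) * poisson_kernel (?Y n) x) \<partial>lborel)
       \<le> ennreal (?Y n) * ennreal (1 / (c * (y + ?Y n)))"
      by (rule mult_left_mono) simp
    also have "\<dots> = ennreal (?Y n * (1 / (c * (y + ?Y n))))"
      using y c by (intro ennreal_mult[symmetric]) auto
    also have "?Y n * (1 / (c * (y + ?Y n))) = (?Y n / (y + ?Y n)) * (1 / c)"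
      by simp
    also have "ennreal \<dots> \<le> ennreal (1 * (1 / c))"
      using y c by (intro ennreal_leI mult_right_mono) auto
    also have "1 * (1 / c) = 1 / c" by simp
    also have "ennreal (?Y n) * (\<integral>\<^sup>+x. ennreal (Im (g (Complex x y)) * poisson_kernel (?Y n) x) \<partial>lborel) =
      (\<integral>\<^sup>+x. ennreal (?Y n) * ennreal (Im (g (Complex x y)) * poisson_kernel (?Y n) x) \<partial>lborel)"
    proof (rule nn_integral_cmult[symmetric])
      have [measurable]: "(\<lambda>x. g (Complex x y)) \<in> borel_measurable borel"
        by (rule borel_measurable_horizontal_line[OF g y])
      show "(\<lambda>x. ennreal (Im (g (Complex x y)) * poisson_kernel (?Y n) x)) \<in> borel_measurable lborel"
        unfolding poisson_kernel_def by measurable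
    qed
    also have "\<dots> = (\<integral>\<^sup>+x. ennreal (?p x * ?w n x) \<partial>lborel)"
    proof (rule nn_integral_cong)
      fix x :: real
      have "?Y n * (Im (g (Complex x y)) * poisson_kernel (?Y n) x) = ?p x * ?w n x"
        by (simp add: Img poisson_kernel_def[of "?Y n"] power2_eq_square del: of_nat_Suc)
      then show "ennreal (?Y n) * ennreal (Im (g (Complex x y)) * poisson_kernel (?Y n) x) = ennreal (?p x * ?w n x)"
        by (subst ennreal_mult'[symmetric]) auto
    qed
    finally show ?thesis .
  qed
  have "(\<integral>\<^sup>+x. ennreal (?p x) \<partial>lborel) = (\<integral>\<^sup>+x. liminf (\<lambda>n. ennreal (?p x * ?w n x)) \<partial>lborel)"
  proof (rule nn_integral_cong)
    fix x :: real
    have "(\<lambda>n. (x / ?Y n)\<^sup>2) \<longlonglongrightarrow> 0\<^sup>2"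
      by (intro tendsto_power LIMSEQ_Suc[OF lim_const_over_n])
    then have "(\<lambda>n. 1 / ((x / ?Y n)\<^sup>2 + 1)) \<longlonglongrightarrow> 1 / (0\<^sup>2 + 1)"
      by (intro tendsto_intros) auto
    moreover have "1 / ((x / ?Y n)\<^sup>2 + 1) = ?w n x" for n
    proof -
      have "(x / ?Y n)\<^sup>2 + 1 = (x\<^sup>2 + (?Y n)\<^sup>2) / (?Y n)\<^sup>2"
        by (simp add: power_divide add_divide_distrib del: of_nat_Suc)
      then show ?thesis by simp
    qed
    ultimately have "(\<lambda>n. ?w n x) \<longlonglongrightarrow> 1" by simp
    then have "(\<lambda>n. ?p x * ?w n x) \<longlonglongrightarrow> ?p x * 1"
      by (rule tendsto_mult_left)
    then have "(\<lambda>n. ennreal (?p x * ?w n x)) \<longlonglongrightarrow> ennreal (?p x)"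
      by (intro tendsto_ennrealI) simp
    then show "ennreal (?p x) = liminf (\<lambda>n. ennreal (?p x * ?w n x))"
      by (simp add: lim_imp_Liminf)
  qed
  also have "\<dots> \<le> liminf (\<lambda>n. \<integral>\<^sup>+x. ennreal (?p x * ?w n x) \<partial>lborel)"
  proof (rule nn_integral_liminf)
    fix n
    have [measurable]: "(\<lambda>x. \<phi> (Complex x y)) \<in> borel_measurable borel"
      by (rule borel_measurable_horizontal_line[OF \<phi> y])
    show "(\<lambda>x. ennreal (?p x * ?w n x)) \<in> borel_measurable lborel"
      unfolding poisson_kernel_def by measurable
  qed
  also have "\<dots> \<le> ennreal (1 / c)"
    using bound by (intro Liminf_le) (auto intro!: always_eventually)
  finally show ?thesis .
qed

text \<open>
  The Poisson majorant of \<open>|F|\<^sup>q\<close> is evaluated at \<open>\<phi>\<close> and the order of integration is exchanged; the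
  inner integral is then the total mass from \<open>total_poisson_mass_le\<close>. The shift by \<open>\<delta>\<close> provides
  the continuity of \<open>F\<close> up to the boundary that the majorant requires.
\<close>

lemma level_integral_subordination_shifted:
  assumes F: "F holomorphic_on upper_halfplane" and q: "q > 0" and B: "B \<ge> 0"
    and le: "\<And>y. y > 0 \<Longrightarrow> level_integral q F y \<le> ennreal B"
    and \<phi>: "\<phi> holomorphic_on upper_halfplane" and c: "c > 0"
    and Im: "\<And>z. Im z > 0 \<Longrightarrow> Im (\<phi> z) \<ge> c * Im z" and y: "y > 0" and \<delta>: "\<delta> > 0"
  shows "level_integral q (\<lambda>z. F (\<phi> z + \<i> * of_real \<delta>)) y \<le> ennreal (1 / c) * level_integral q F \<delta>"
proof -
  have pos: "Im (\<phi> z) > 0" if "Im z > 0" for z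
    using Im[OF that] mult_pos_pos[OF c that] by linarith
  have K: "norm (F z) powr q \<le> 4 * B / \<delta>" if "Im z > \<delta>" for z
  proof -
    have "norm (F z) powr q \<le> 4 * B / Im z"
      using level_integral_pointwise_bound[OF F q B le] that \<delta> by auto
    also have "\<dots> \<le> 4 * B / \<delta>"
      using that \<delta> B by (intro divide_left_mono mult_pos_pos) auto
    finally show ?thesis .
  qed
  let ?u = "\<lambda>s. norm (F (Complex s \<delta>)) powr q"
  let ?P = "\<lambda>x s. poisson_kernel (Im (\<phi> (Complex x y))) (s - Re (\<phi> (Complex x y)))"
  have contF: "continuous_on UNIV (\<lambda>s. F (Complex s \<delta>))"
    by (intro continuous_on_horizontal_line holomorphic_on_imp_continuous_on F \<delta>)
  have cont\<phi>: "continuous_on UNIV (\<lambda>x. \<phi> (Complex x y))"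
    by (intro continuous_on_horizontal_line holomorphic_on_imp_continuous_on \<phi> y)
  have [measurable]: "(\<lambda>s. F (Complex s \<delta>)) \<in> borel_measurable borel"
    "(\<lambda>x. \<phi> (Complex x y)) \<in> borel_measurable borel"
    using contF cont\<phi> by (auto intro: borel_measurable_continuous_onI)
  have "level_integral q (\<lambda>z. F (\<phi> z + \<i> * of_real \<delta>)) y \<le>
     (\<integral>\<^sup>+x. (\<integral>\<^sup>+s. ennreal (?u s * ?P x s) \<partial>lborel) \<partial>lborel)"
    unfolding level_integral_def
    by (intro nn_integral_mono poisson_majorant[OF F q \<delta> K] pos) (use y in auto)
  also have "\<dots> = (\<integral>\<^sup>+s. (\<integral>\<^sup>+x. ennreal (?u s * ?P x s) \<partial>lborel) \<partial>lborel)"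
  proof (rule nn_integral_lborel_swap)
    have [measurable]: "(\<lambda>p. F (Complex (fst p) \<delta>)) \<in> borel_measurable (borel :: (real \<times> real) measure)"
      by (rule borel_measurable_continuous_onI) (rule continuous_on_compose2[OF contF], auto intro: continuous_intros)
    have [measurable]: "(\<lambda>p. \<phi> (Complex (snd p) y)) \<in> borel_measurable (borel :: (real \<times> real) measure)"
      by (rule borel_measurable_continuous_onI) (rule continuous_on_compose2[OF cont\<phi>], auto intro: continuous_intros)
    have [measurable]: "(fst :: real \<times> real \<Rightarrow> real) \<in> borel_measurable borel"
      by (rule borel_measurable_continuous_onI) (intro continuous_intros)
    show "(\<lambda>(s, x). ennreal (?u s * ?P x s)) \<in> borel_measurable borel"
      unfolding case_prod_unfold poisson_kernel_def by measurable
  qed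
  also have "\<dots> \<le> (\<integral>\<^sup>+s. ennreal (?u s) * ennreal (1 / c) \<partial>lborel)"
  proof (rule nn_integral_mono)
    fix s :: real
    have "(\<integral>\<^sup>+x. ennreal (?u s * ?P x s) \<partial>lborel) = (\<integral>\<^sup>+x. ennreal (?u s) * ennreal (?P x s) \<partial>lborel)"
      by (simp add: ennreal_mult')
    also have "\<dots> = ennreal (?u s) * (\<integral>\<^sup>+x. ennreal (?P x s) \<partial>lborel)"
      by (rule nn_integral_cmult) (unfold poisson_kernel_def, measurable)
    also have "\<dots> \<le> ennreal (?u s) * ennreal (1 / c)"
      by (intro mult_left_mono total_poisson_mass_le[OF \<phi> c Im y]) auto
    finally show "(\<integral>\<^sup>+x. ennreal (?u s * ?P x s) \<partial>lborel) \<le> ennreal (?u s) * ennreal (1 / c)" .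
  qed
  also have "\<dots> = ennreal (1 / c) * level_integral q F \<delta>"
    unfolding level_integral_def by (subst nn_integral_multc) (auto simp: mult.commute)
  finally show ?thesis .
qed

lemma level_integral_antimono:
  assumes F: "F holomorphic_on upper_halfplane" and q: "q > 0" and B: "B \<ge> 0"
    and le: "\<And>y. y > 0 \<Longrightarrow> level_integral q F y \<le> ennreal B"
    and y: "0 < y1" "y1 \<le> y2"
  shows "level_integral q F y2 \<le> level_integral q F y1"
proof (cases "y1 = y2")
  case False
  have "level_integral q (\<lambda>z. F (id z + \<i> * of_real y1)) (y2 - y1) \<le> ennreal (1 / 1) * level_integral q F y1"
    by (rule level_integral_subordination_shifted[OF F q B le]) (use y False in auto)
  moreover have "Complex x (y2 - y1) + \<i> * of_real y1 = Complex x y2" for x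
    by (simp add: complex_eq_iff)
  ultimately show ?thesis by (simp add: level_integral_def)
qed simp

lemma level_integral_Fatou:
  assumes F: "\<And>n. F n holomorphic_on upper_halfplane" and q: "q > 0" and y: "y > 0"
    and lim: "\<And>z. Im z > 0 \<Longrightarrow> (\<lambda>n. F n z) \<longlonglongrightarrow> G z"
  shows "level_integral q G y \<le> liminf (\<lambda>n. level_integral q (F n) y)"
proof -
  have "level_integral q G y = (\<integral>\<^sup>+x. liminf (\<lambda>n. ennreal (norm (F n (Complex x y)) powr q)) \<partial>lborel)"
    unfolding level_integral_def
  proof (rule nn_integral_cong)
    fix x :: real
    have "(\<lambda>n. ennreal (norm (F n (Complex x y)) powr q)) \<longlonglongrightarrow> ennreal (norm (G (Complex x y)) powr q)"
      using y q by (intro tendsto_ennrealI tendsto_powr' tendsto_norm lim tendsto_const) auto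
    then show "ennreal (norm (G (Complex x y)) powr q) = liminf (\<lambda>n. ennreal (norm (F n (Complex x y)) powr q))"
      by (rule lim_imp_Liminf[OF sequentially_bot, symmetric])
  qed
  also have "\<dots> \<le> liminf (\<lambda>n. level_integral q (F n) y)"
    unfolding level_integral_def
  proof (rule nn_integral_liminf)
    fix n
    have [measurable]: "(\<lambda>x. F n (Complex x y)) \<in> borel_measurable borel"
      by (rule borel_measurable_horizontal_line[OF F y])
    show "(\<lambda>x. ennreal (norm (F n (Complex x y)) powr q)) \<in> borel_measurable lborel" by measurable
  qed
  finally show ?thesis .
qed

lemma level_integral_subordination:
  assumes F: "F holomorphic_on upper_halfplane" and q: "q > 0" and B: "B \<ge> 0"
    and le: "\<And>y. y > 0 \<Longrightarrow> level_integral q F y \<le> ennreal B"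
    and \<phi>: "\<phi> holomorphic_on upper_halfplane" and c: "c > 0"
    and Im: "\<And>z. Im z > 0 \<Longrightarrow> Im (\<phi> z) \<ge> c * Im z" and y: "y > 0"
  shows "level_integral q (F \<circ> \<phi>) y \<le> ennreal (B / c)"
proof -
  have pos: "Im (\<phi> z) > 0" if "Im z > 0" for z
    using Im[OF that] mult_pos_pos[OF c that] by linarith
  define Fn where "Fn n z = F (\<phi> z + \<i> * of_real (1 / real (Suc n)))" for n z
  have "level_integral q (F \<circ> \<phi>) y \<le> liminf (\<lambda>n. level_integral q (Fn n) y)"
  proof (rule level_integral_Fatou[OF _ q y])
    fix n
    have "(F \<circ> (\<lambda>z. \<phi> z + \<i> * of_real (1 / real (Suc n)))) holomorphic_on upper_halfplane"
      by (rule holomorphic_on_compose_gen[OF _ F]) (use pos in \<open>auto intro!: holomorphic_intros \<phi> add_pos_pos\<close>)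
    moreover have "Fn n = F \<circ> (\<lambda>z. \<phi> z + \<i> * of_real (1 / real (Suc n)))"
      by (rule ext) (simp only: Fn_def o_def)
    ultimately show "Fn n holomorphic_on upper_halfplane" by (simp only:)
  next
    fix z assume z: "Im z > 0"
    have "(\<lambda>n. \<phi> z + \<i> * of_real (1 / real (Suc n))) \<longlonglongrightarrow> \<phi> z + \<i> * of_real 0"
      by (intro tendsto_intros LIMSEQ_Suc[OF lim_1_over_n])
    then have "(\<lambda>n. \<phi> z + \<i> * of_real (1 / real (Suc n))) \<longlonglongrightarrow> \<phi> z" by simp
    then show "(\<lambda>n. Fn n z) \<longlonglongrightarrow> (F \<circ> \<phi>) z"
      unfolding Fn_def o_def using pos[OF z]
      by (intro continuous_on_tendsto_compose[OF holomorphic_on_imp_continuous_on[OF F]])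
         (auto intro!: always_eventually add_pos_pos)
  qed
  also have "\<dots> \<le> ennreal (B / c)"
  proof (rule Liminf_le)
    show "\<forall>\<^sub>F n in sequentially. level_integral q (Fn n) y \<le> ennreal (B / c)"
    proof (rule always_eventually, rule allI)
      fix n
      have "level_integral q (Fn n) y \<le> ennreal (1 / c) * level_integral q F (1 / real (Suc n))"
        unfolding Fn_def by (rule level_integral_subordination_shifted[OF F q B le \<phi> c Im y]) auto
      also have "\<dots> \<le> ennreal (1 / c) * ennreal B"
        by (intro mult_left_mono le) auto
      also have "\<dots> = ennreal (B / c)"
        using B c by (subst ennreal_mult[symmetric]) auto
      finally show "level_integral q (Fn n) y \<le> ennreal (B / c)" .
    qed
  qed simp
  finally show ?thesis .
qed

section \<open>Hardy spaces\<close>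

lemma Hardy_space_holomorphic: "f \<in> Hardy_space p \<Longrightarrow> f holomorphic_on upper_halfplane"
  by (simp add: Hardy_space_def)

lemma Hardy_mean_le_norm:
  assumes "f \<in> Hardy_space p" "y > 0"
  shows "Hardy_mean p f y \<le> Hardy_norm p f"
  unfolding Hardy_norm_def using assms by (intro cSUP_upper) (auto simp: Hardy_space_def)

lemma Hardy_norm_nonneg:
  assumes "f \<in> Hardy_space p"
  shows "Hardy_norm p f \<ge> 0"
  using Hardy_mean_le_norm[OF assms, of 1] by (simp add: Hardy_mean_def order_trans[OF powr_ge_zero])

lemma Hardy_level_le:
  assumes f: "f \<in> Hardy_space p" and p: "p > 0" and y: "y > 0"
  shows "level_integral p f y \<le> ennreal (Hardy_norm p f powr p)"
proof -
  let ?I = "LINT x|lborel. norm (f (Complex x y)) powr p"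
  have int: "integrable lborel (\<lambda>x. norm (f (Complex x y)) powr p)"
    using f y by (simp add: Hardy_space_def)
  have "?I \<ge> 0" by (rule Bochner_Integration.integral_nonneg) auto
  then have "?I = Hardy_mean p f y powr p"
    using p by (simp add: Hardy_mean_def powr_powr)
  also have "\<dots> \<le> Hardy_norm p f powr p"
    using p Hardy_mean_le_norm[OF f y] by (intro powr_mono2) (auto simp: Hardy_mean_def)
  finally show ?thesis
    unfolding level_integral_def by (subst nn_integral_eq_integral[OF int]) (auto intro: ennreal_leI)
qed

text \<open>
  Together with \<open>Hardy_level_le\<close> this translates between the norm and uniform bounds for the line
  integrals, the form in which all estimates are carried out.
\<close>

lemma Hardy_spaceI:
  assumes f: "f holomorphic_on upper_halfplane" and p: "p > 0" and B: "B \<ge> 0"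
    and le: "\<And>y. y > 0 \<Longrightarrow> level_integral p f y \<le> ennreal B"
  shows "f \<in> Hardy_space p" "Hardy_norm p f \<le> B powr (1 / p)"
proof -
  have int: "integrable lborel (\<lambda>x. norm (f (Complex x y)) powr p)" if y: "y > 0" for y
  proof (rule integrableI_bounded)
    have [measurable]: "(\<lambda>x. f (Complex x y)) \<in> borel_measurable borel"
      by (rule borel_measurable_horizontal_line[OF f y])
    show "(\<lambda>x. norm (f (Complex x y)) powr p) \<in> borel_measurable lborel" by measurable
    show "(\<integral>\<^sup>+x. ennreal (norm (norm (f (Complex x y)) powr p)) \<partial>lborel) < \<infinity>"
      using le[OF y] by (simp add: level_integral_def le_less_trans)
  qed
  have mean: "Hardy_mean p f y \<le> B powr (1 / p)" if y: "y > 0" for y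
  proof -
    have "ennreal (LINT x|lborel. norm (f (Complex x y)) powr p) \<le> ennreal B"
      using le[OF y] unfolding level_integral_def by (subst (asm) nn_integral_eq_integral[OF int[OF y]]) auto
    then have "(LINT x|lborel. norm (f (Complex x y)) powr p) \<le> B"
      using B by (subst (asm) ennreal_le_iff) auto
    then show ?thesis
      unfolding Hardy_mean_def using p by (intro powr_mono2) (auto intro!: Bochner_Integration.integral_nonneg)
  qed
  show "f \<in> Hardy_space p"
    using f int mean by (auto simp: Hardy_space_def intro!: bdd_aboveI2)
  show "Hardy_norm p f \<le> B powr (1 / p)"
    unfolding Hardy_norm_def using mean by (intro cSUP_least) auto
qed

lemma Hardy_norm_powr_le:
  assumes f: "f holomorphic_on upper_halfplane" and p: "p > 0" and B: "B \<ge> 0"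
    and le: "\<And>y. y > 0 \<Longrightarrow> level_integral p f y \<le> ennreal B"
  shows "Hardy_norm p f powr p \<le> B"
proof -
  have "Hardy_norm p f powr p \<le> (B powr (1 / p)) powr p"
    using Hardy_spaceI[OF assms] Hardy_norm_nonneg p by (intro powr_mono2) auto
  then show ?thesis using p B by (simp add: powr_powr)
qed

lemma Hardy_level_near_norm:
  assumes f: "f \<in> Hardy_space p" and p: "p > 0" and e: "e > 0"
  obtains y where "y > 0" "ennreal (Hardy_norm p f powr p - e) \<le> level_integral p f y"
proof (rule ccontr)
  assume "\<not> thesis"
  with that have lt: "level_integral p f y < ennreal (Hardy_norm p f powr p - e)" if "y > 0" for y
    using \<open>y > 0\<close> not_le by blast
  have "Hardy_norm p f powr p - e \<ge> 0"
  proof (rule ccontr)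
    assume "\<not> ?thesis"
    then have "ennreal (Hardy_norm p f powr p - e) = 0" by (intro ennreal_neg) auto
    then show False using lt[of 1] by simp
  qed
  from Hardy_norm_powr_le[OF Hardy_space_holomorphic[OF f] p this] lt e
  show False by (auto simp: less_imp_le)
qed

lemma level_integral_dominated:
  assumes f: "f \<in> Hardy_space p" and g: "g \<in> Hardy_space p" and p: "p > 0" and K: "K \<ge> 0"
    and le: "\<And>z. Im z > 0 \<Longrightarrow> norm (H z) powr q \<le> K * (norm (f z) powr p + norm (g z) powr p)"
    and y: "y > 0"
  shows "level_integral q H y \<le> ennreal (K * (Hardy_norm p f powr p + Hardy_norm p g powr p))"
proof -
  have [measurable]: "(\<lambda>x. f (Complex x y)) \<in> borel_measurable borel" "(\<lambda>x. g (Complex x y)) \<in> borel_measurable borel"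
    using f g y by (auto intro!: borel_measurable_horizontal_line Hardy_space_holomorphic)
  have "level_integral q H y \<le> (\<integral>\<^sup>+x. ennreal K * (ennreal (norm (f (Complex x y)) powr p) + ennreal (norm (g (Complex x y)) powr p)) \<partial>lborel)"
    unfolding level_integral_def using le y K
    by (intro nn_integral_mono) (auto simp flip: ennreal_plus ennreal_mult intro!: ennreal_leI)
  also have "\<dots> = ennreal K * (level_integral p f y + level_integral p g y)"
    unfolding level_integral_def by (subst nn_integral_cmult, measurable, subst nn_integral_add) auto
  also have "\<dots> \<le> ennreal K * (ennreal (Hardy_norm p f powr p) + ennreal (Hardy_norm p g powr p))"
    by (intro mult_left_mono add_mono Hardy_level_le f g p y) auto
  also have "\<dots> = ennreal (K * (Hardy_norm p f powr p + Hardy_norm p g powr p))"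
    using K by (simp add: ennreal_mult ennreal_plus)
  finally show ?thesis .
qed

lemma norm_diff_powr_le:
  fixes a b :: complex
  assumes "p > 0"
  shows "norm (a - b) powr p \<le> 2 powr p * (norm a powr p + norm b powr p)"
proof -
  let ?m = "max (norm a) (norm b)"
  have "norm (a - b) \<le> 2 * ?m"
    using norm_triangle_ineq4[of a b] by linarith
  then have "norm (a - b) powr p \<le> (2 * ?m) powr p"
    using assms by (intro powr_mono2) auto
  also have "\<dots> = 2 powr p * ?m powr p"
    by (simp add: powr_mult)
  also have "?m powr p \<le> norm a powr p + norm b powr p"
    by (auto simp: max_def)
  finally show ?thesis by simp
qed

lemma Hardy_space_diff:
  assumes f: "f \<in> Hardy_space p" and g: "g \<in> Hardy_space p" and p: "p > 0"
  shows "(\<lambda>z. f z - g z) \<in> Hardy_space p"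
proof (rule Hardy_spaceI(1)[OF _ p])
  show "(\<lambda>z. f z - g z) holomorphic_on upper_halfplane"
    using f g by (intro holomorphic_intros Hardy_space_holomorphic)
  show "level_integral p (\<lambda>z. f z - g z) y \<le> ennreal (2 powr p * (Hardy_norm p f powr p + Hardy_norm p g powr p))"
    if "y > 0" for y
    by (rule level_integral_dominated[OF f g p _ _ that]) (use norm_diff_powr_le p in auto)
qed auto

lemma Hardy_space_cmult:
  assumes f: "f \<in> Hardy_space p" and p: "p > 0"
  shows "(\<lambda>z. c * f z) \<in> Hardy_space p"
proof (rule Hardy_spaceI(1)[OF _ p])
  show "(\<lambda>z. c * f z) holomorphic_on upper_halfplane"
    using f by (intro holomorphic_intros Hardy_space_holomorphic)
  show "level_integral p (\<lambda>z. c * f z) y \<le> ennreal (norm c powr p * (Hardy_norm p f powr p + Hardy_norm p f powr p))"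
    if "y > 0" for y
    by (rule level_integral_dominated[OF f f p _ _ that]) (auto simp: norm_mult powr_mult)
qed auto

lemma Hardy_space_cong:
  assumes f: "f \<in> Hardy_space p" and p: "p > 0" and eq: "\<And>z. Im z > 0 \<Longrightarrow> f z = g z"
  shows "g \<in> Hardy_space p"
proof (rule Hardy_spaceI(1)[OF _ p powr_ge_zero])
  show "g holomorphic_on upper_halfplane"
    using Hardy_space_holomorphic[OF f] by (rule holomorphic_transform) (use eq in auto)
  show "level_integral p g y \<le> ennreal (Hardy_norm p f powr p)" if "y > 0" for y
    using Hardy_level_le[OF f p that] that eq by (simp add: level_integral_def)
qed

lemma Hardy_pointwise_bound:
  assumes f: "f \<in> Hardy_space p" and p: "p > 0" and w: "Im w > 0"
  shows "norm (f w) powr p \<le> 4 * Hardy_norm p f powr p / Im w"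
  using f p w by (intro level_integral_pointwise_bound Hardy_space_holomorphic Hardy_level_le) auto

text \<open>
  Both subtracted terms are powers of moduli of functions that depend holomorphically on \<open>a\<close> and
  \<open>b\<close>, so for holomorphic \<open>a\<close>, \<open>b\<close> their line integrals decrease with the height.
\<close>

definition Hardy_defect :: "real \<Rightarrow> complex \<Rightarrow> complex \<Rightarrow> real" where
  "Hardy_defect p a b = norm a powr p + norm b powr p - norm ((a + b) / 2) powr p - norm (a * b) powr (p / 2)"

lemma norm_average_powr_le:
  fixes a b :: complex
  assumes "p \<ge> 1"
  shows "norm ((a + b) / 2) powr p \<le> (norm a powr p + norm b powr p) / 2"
proof -
  have "norm ((a + b) / 2) \<le> (norm a + norm b) / 2"
    using norm_triangle_ineq[of a b] by (simp add: norm_divide)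
  then have "norm ((a + b) / 2) powr p \<le> ((norm a + norm b) / 2) powr p"
    using assms by (intro powr_mono2) auto
  also have "\<dots> \<le> (norm a powr p + norm b powr p) / 2"
  proof -
    have half: "(x / 2) powr p \<le> x powr p / 2" if "x \<ge> 0" for x :: real
    proof -
      have "(1 / 2) powr p \<le> (1 / 2 :: real) powr 1"
        using assms by (intro powr_mono') auto
      then show ?thesis
        using mult_left_mono[of "(1 / 2) powr p" "1 / 2" "x powr p"] that
        by (simp add: powr_mult flip: powr_mult[of x "1 / 2"])
    qed
    show ?thesis
    proof (cases "a = 0 \<or> b = 0")
      case True
      then show ?thesis using half[of "norm a"] half[of "norm b"] by auto
    next
      case False
      then show ?thesis
        using convex_onD[OF powr_convex[OF assms], of "1 / 2" "norm a" "norm b"]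
        by (simp add: field_simps)
    qed
  qed
  finally show ?thesis .
qed

lemma norm_mult_powr_half_le:
  fixes a b :: complex
  shows "norm (a * b) powr (p / 2) \<le> (norm a powr p + norm b powr p) / 2"
    and "norm (a * b) powr (p / 2) = (norm a powr p + norm b powr p) / 2 \<Longrightarrow> p > 0 \<Longrightarrow> norm a = norm b"
proof -
  define X Y where "X = norm a powr (p / 2)" and "Y = norm b powr (p / 2)"
  have XY: "norm a powr p = X\<^sup>2" "norm b powr p = Y\<^sup>2" "norm (a * b) powr (p / 2) = X * Y"
    by (auto simp: X_def Y_def power2_eq_square norm_mult powr_mult simp flip: powr_add)
  have eq: "(X\<^sup>2 + Y\<^sup>2) / 2 - X * Y = (X - Y)\<^sup>2 / 2"
    by (simp add: power2_eq_square field_simps)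
  then show "norm (a * b) powr (p / 2) \<le> (norm a powr p + norm b powr p) / 2"
    unfolding XY using zero_le_power2[of "X - Y"] by linarith
  assume "norm (a * b) powr (p / 2) = (norm a powr p + norm b powr p) / 2" and p: "p > 0"
  then have "(X - Y)\<^sup>2 = 0" using eq unfolding XY by linarith
  then have "X = Y" by simp
  then have "X powr (2 / p) = Y powr (2 / p)" by simp
  then show "norm a = norm b" using p by (simp add: X_def Y_def powr_powr)
qed

lemma Hardy_defect_nonneg:
  assumes "p \<ge> 1"
  shows "Hardy_defect p a b \<ge> 0"
proof -
  have "0 \<le> A + B - x - y" if "x \<le> (A + B) / 2" "y \<le> (A + B) / 2" for A B x y :: real
    using that by argo
  from this[OF norm_average_powr_le[OF assms, of a b] norm_mult_powr_half_le(1)[of a b p]]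
  show ?thesis unfolding Hardy_defect_def .
qed

text \<open>
  Equality in the product term gives \<open>|a| = |b|\<close>; equality in the average then gives
  \<open>|a + b| = 2 |a|\<close>, and the parallelogram law leaves no room for \<open>a - b\<close>.
\<close>

lemma Hardy_defect_eq_0D:
  assumes p: "p \<ge> 1" and 0: "Hardy_defect p a b = 0"
  shows "a = b"
proof -
  have eq: "x = (A + B) / 2 \<and> y = (A + B) / 2"
    if "A + B - x - y = 0" "x \<le> (A + B) / 2" "y \<le> (A + B) / 2" for A B x y :: real
    using that by argo
  note e = eq[OF 0[unfolded Hardy_defect_def] norm_average_powr_le[OF p, of a b] norm_mult_powr_half_le(1)[of a b p]]
  note e1 = conjunct1[OF e] and e2 = conjunct2[OF e]
  have ab: "norm a = norm b" using norm_mult_powr_half_le(2)[OF e2] p by simp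
  have "(norm ((a + b) / 2) powr p) powr (1 / p) = (norm a powr p) powr (1 / p)"
    using e1 ab by simp
  then have "norm ((a + b) / 2) = norm a" using p by (simp add: powr_powr)
  then have 2: "norm (a + b) = 2 * norm a" by (simp add: norm_divide)
  have "(norm (a + b))\<^sup>2 + (norm (a - b))\<^sup>2 = 2 * (norm a)\<^sup>2 + 2 * (norm b)\<^sup>2"
    unfolding cmod_power2 by (simp add: algebra_simps power2_eq_square)
  then have "(norm (a - b))\<^sup>2 = 0" unfolding 2 ab by (simp add: power2_eq_square)
  then show ?thesis by simp
qed

text \<open>
  Both sides are homogeneous of degree \<open>p\<close>, so it suffices to consider pairs with
  \<open>max |a| |b| = 1\<close>. On the compact set of such pairs with \<open>|a - b|\<^sup>p \<ge> e\<close> the defect has a positive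
  minimum.
\<close>

lemma Hardy_defect_controls_difference:
  assumes p: "p \<ge> 1" and e: "e > 0"
  shows "\<exists>C\<ge>0. \<forall>a b. norm (a - b) powr p \<le> C * Hardy_defect p a b + e * (norm a powr p + norm b powr p)"
proof -
  define S where "S = {x :: complex \<times> complex. norm (fst x) \<le> 1 \<and> norm (snd x) \<le> 1 \<and>
      (norm (fst x) = 1 \<or> norm (snd x) = 1) \<and> norm (fst x - snd x) powr p \<ge> e}"
  have cl: "closed S"
    unfolding S_def using p
    by (intro closed_Collect_conj closed_Collect_disj closed_Collect_le closed_Collect_eq
          continuous_on_powr' continuous_intros) auto
  have "S \<subseteq> cball 0 1 \<times> cball 0 1" by (auto simp: S_def)
  with cl have cS: "compact S"
    using compact_Times[OF compact_cball compact_cball] by (metis compact_Int_closed inf.absorb_iff2)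
  have cont: "continuous_on S (\<lambda>x. Hardy_defect p (fst x) (snd x))"
    unfolding Hardy_defect_def using p
    by (intro continuous_on_add continuous_on_diff continuous_on_powr' continuous_intros) auto
  have "\<exists>m>0. \<forall>x\<in>S. m \<le> Hardy_defect p (fst x) (snd x)"
  proof (cases "S = {}")
    case False
    obtain x where x: "x \<in> S" "\<And>y. y \<in> S \<Longrightarrow> Hardy_defect p (fst x) (snd x) \<le> Hardy_defect p (fst y) (snd y)"
      using continuous_attains_inf[OF cS False cont] by blast
    have "fst x \<noteq> snd x" using x(1) e p by (auto simp: S_def)
    then have "Hardy_defect p (fst x) (snd x) > 0"
      using Hardy_defect_eq_0D[OF p] Hardy_defect_nonneg[OF p] by (metis less_eq_real_def)
    then show ?thesis using x(2) by blast
  qed (auto intro: exI[of _ 1])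
  then obtain m where m: "m > 0" "\<And>x. x \<in> S \<Longrightarrow> m \<le> Hardy_defect p (fst x) (snd x)" by blast
  define C where "C = 2 powr p / m"
  have C: "C \<ge> 0" using m by (simp add: C_def)
  have unit: "norm (a - b) powr p \<le> C * Hardy_defect p a b + e * (norm a powr p + norm b powr p)"
    if "norm a \<le> 1" "norm b \<le> 1" "norm a = 1 \<or> norm b = 1" for a b
  proof (cases "norm (a - b) powr p \<ge> e")
    case True
    then have "m \<le> Hardy_defect p a b" using m(2)[of "(a, b)"] that by (simp add: S_def)
    have "norm (a - b) \<le> 2" using norm_triangle_ineq4[of a b] that by linarith
    then have "norm (a - b) powr p \<le> 2 powr p" using p by (intro powr_mono2) auto
    also have "\<dots> = C * m" using m by (simp add: C_def)
    also have "\<dots> \<le> C * Hardy_defect p a b" using C \<open>m \<le> _\<close> by (intro mult_left_mono)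
    also have "\<dots> \<le> C * Hardy_defect p a b + e * (norm a powr p + norm b powr p)"
      using e by simp
    finally show ?thesis .
  next
    case False
    have "1 \<le> norm a powr p + norm b powr p" using that(3) by auto
    then have "e * 1 \<le> e * (norm a powr p + norm b powr p)" using e by (intro mult_left_mono) auto
    moreover have "0 \<le> C * Hardy_defect p a b" using C Hardy_defect_nonneg[OF p] by simp
    ultimately show ?thesis using False by linarith
  qed
  show ?thesis
  proof (intro exI[of _ C] conjI C allI)
    fix a b :: complex
    define r where "r = max (norm a) (norm b)"
    show "norm (a - b) powr p \<le> C * Hardy_defect p a b + e * (norm a powr p + norm b powr p)"
    proof (cases "r = 0")
      case True
      then have "norm a = 0" "norm b = 0" unfolding r_def by (smt (verit) norm_ge_zero)+
      then show ?thesis using p by (simp add: Hardy_defect_def)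
    next
      case False
      then have r: "r > 0" unfolding r_def by (smt (verit) norm_ge_zero)
      define a' b' where "a' = a / of_real r" and "b' = b / of_real r"
      have ab: "a = of_real r * a'" "b = of_real r * b'" using r by (auto simp: a'_def b'_def)
      have s: "norm (of_real r * z) powr p = r powr p * norm z powr p" for z :: complex
        using r by (simp add: norm_mult powr_mult)
      have d: "a - b = of_real r * (a' - b')" "(a + b) / 2 = of_real r * ((a' + b') / 2)"
        by (auto simp: ab algebra_simps)
      have m: "norm (a * b) powr (p / 2) = r powr p * norm (a' * b') powr (p / 2)"
      proof -
        have "norm (a * b) = (r * r) * norm (a' * b')" using r by (simp add: ab norm_mult)
        then have "norm (a * b) powr (p / 2) = (r * r) powr (p / 2) * norm (a' * b') powr (p / 2)"
          using r by (simp add: powr_mult)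
        also have "(r * r) powr (p / 2) = r powr p" using r by (simp add: powr_mult flip: powr_add)
        finally show ?thesis .
      qed
      have sa: "norm a powr p = r powr p * norm a' powr p" and sb: "norm b powr p = r powr p * norm b' powr p"
        using s[of a'] s[of b'] by (simp_all only: ab[symmetric])
      have D: "Hardy_defect p a b = r powr p * Hardy_defect p a' b'"
        unfolding Hardy_defect_def m d(2) s sa sb by (simp add: algebra_simps)
      have "norm (a' - b') powr p \<le> C * Hardy_defect p a' b' + e * (norm a' powr p + norm b' powr p)"
        using r by (intro unit) (auto simp: a'_def b'_def norm_divide r_def max_def split: if_splits)
      then have "r powr p * norm (a' - b') powr p \<le> r powr p * (C * Hardy_defect p a' b' + e * (norm a' powr p + norm b' powr p))"
        by (intro mult_left_mono) auto
      then show ?thesis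
        unfolding D d(1) s sa sb by (simp add: algebra_simps)
    qed
  qed
qed

section \<open>Pointwise convergence without increase of norm\<close>

lemma eventually_level_integral_ge:
  assumes F: "\<And>n. F n holomorphic_on upper_halfplane" and q: "q > 0" and y: "y > 0"
    and lim: "\<And>z. Im z > 0 \<Longrightarrow> (\<lambda>n. F n z) \<longlonglongrightarrow> G z"
    and lb: "ennreal a \<le> level_integral q G y" and b: "b < a"
  shows "\<forall>\<^sub>F n in sequentially. ennreal b \<le> level_integral q (F n) y"
proof (cases "b < 0")
  case False
  then have "ennreal b < ennreal a" using b by (intro ennreal_lessI) auto
  also note lb
  also have "level_integral q G y \<le> liminf (\<lambda>n. level_integral q (F n) y)"
    by (rule level_integral_Fatou[OF F q y lim])
  finally show ?thesis
    by (rule eventually_mono[OF less_LiminfD]) (auto simp: less_imp_le)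
qed (simp add: ennreal_neg)

lemma Hardy_defect_level_estimate:
  assumes f: "f \<in> Hardy_space p" and g: "g \<in> Hardy_space p" and p: "p > 0" and y: "y > 0"
    and C: "C \<ge> 0" and e: "e \<ge> 0"
    and ineq: "\<And>a b. norm (a - b) powr p \<le> C * Hardy_defect p a b + e * (norm a powr p + norm b powr p)"
    and Nf: "Hardy_norm p f powr p \<le> N" and Ng: "Hardy_norm p g powr p \<le> M"
    and avg: "ennreal b \<le> level_integral p (\<lambda>z. (f z + g z) / 2) y"
    and prd: "ennreal b \<le> level_integral (p / 2) (\<lambda>z. f z * g z) y"
  shows "level_integral p (\<lambda>z. f z - g z) y \<le> ennreal (C * (N + M - 2 * b) + e * (N + M))"
proof -
  let ?f = "\<lambda>x. f (Complex x y)" and ?g = "\<lambda>x. g (Complex x y)"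
  have [measurable]: "?f \<in> borel_measurable borel" "?g \<in> borel_measurable borel"
    using f g y by (auto intro!: borel_measurable_horizontal_line Hardy_space_holomorphic)
  have N0: "N \<ge> 0" "M \<ge> 0" using Nf Ng by (auto intro: order_trans[OF powr_ge_zero])
  let ?L = "level_integral p (\<lambda>z. f z - g z) y"
  let ?a = "\<lambda>x. norm ((?f x + ?g x) / 2) powr p" and ?m = "\<lambda>x. norm (?f x * ?g x) powr (p / 2)"
  have "?L + ennreal C * (level_integral p (\<lambda>z. (f z + g z) / 2) y + level_integral (p / 2) (\<lambda>z. f z * g z) y)
     = (\<integral>\<^sup>+x. ennreal (norm (?f x - ?g x) powr p) + ennreal C * (ennreal (?a x) + ennreal (?m x)) \<partial>lborel)"
    unfolding level_integral_def
    by (subst nn_integral_add, measurable, subst nn_integral_cmult, measurable, subst nn_integral_add) auto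
  also have "\<dots> \<le> (\<integral>\<^sup>+x. ennreal (C + e) * (ennreal (norm (?f x) powr p) + ennreal (norm (?g x) powr p)) \<partial>lborel)"
  proof (rule nn_integral_mono)
    fix x
    have "norm (?f x - ?g x) powr p + C * (?a x + ?m x) \<le> (C + e) * (norm (?f x) powr p + norm (?g x) powr p)"
      using ineq[of "?f x" "?g x"] unfolding Hardy_defect_def by (simp add: algebra_simps)
    then show "ennreal (norm (?f x - ?g x) powr p) + ennreal C * (ennreal (?a x) + ennreal (?m x))
      \<le> ennreal (C + e) * (ennreal (norm (?f x) powr p) + ennreal (norm (?g x) powr p))"
      using C e by (simp flip: ennreal_plus ennreal_mult add: ennreal_leI)
  qed
  also have "\<dots> = ennreal (C + e) * (level_integral p f y + level_integral p g y)"
    unfolding level_integral_def by (subst nn_integral_cmult, measurable, subst nn_integral_add) auto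
  also have "\<dots> \<le> ennreal (C + e) * (ennreal N + ennreal M)"
    by (intro mult_left_mono add_mono order_trans[OF Hardy_level_le] f g p y ennreal_leI Nf Ng) auto
  also have "\<dots> = ennreal ((C + e) * (N + M))"
    using C e N0 by (simp flip: ennreal_plus ennreal_mult)
  finally have up: "?L + ennreal C * (level_integral p (\<lambda>z. (f z + g z) / 2) y + level_integral (p / 2) (\<lambda>z. f z * g z) y)
     \<le> ennreal ((C + e) * (N + M))" .
  \<comment> \<open>\<open>ennreal\<close> truncates negative numbers, so only the positive part of \<open>b\<close> can be subtracted\<close>
  define b' where "b' = max b 0"
  have b': "ennreal b' = ennreal b" "b' \<ge> 0" "b \<le> b'"
    unfolding b'_def by (auto simp: max_def ennreal_neg)
  have sum: "?L + ennreal (C * (b' + b')) \<le> ennreal ((C + e) * (N + M))"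
  proof (rule order_trans[OF add_left_mono up])
    have "ennreal (C * (b' + b')) = ennreal C * (ennreal b + ennreal b)"
      unfolding b'(1)[symmetric] ennreal_plus[OF b'(2) b'(2), symmetric]
      by (rule ennreal_mult[OF C]) (use b' in simp)
    also have "\<dots> \<le> ennreal C * (level_integral p (\<lambda>z. (f z + g z) / 2) y + level_integral (p / 2) (\<lambda>z. f z * g z) y)"
      by (intro mult_left_mono add_mono avg prd) auto
    finally show "ennreal (C * (b' + b')) \<le> \<dots>" .
  qed
  then have "?L \<le> ennreal ((C + e) * (N + M))" by (rule order_trans[rotated]) simp
  then obtain l where l: "?L = ennreal l" "l \<ge> 0"
    by (metis ennreal_cases ennreal_less_top leD top.not_eq_extremum)
  have "ennreal (l + C * (b' + b')) \<le> ennreal ((C + e) * (N + M))"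
    using sum l C b' by (simp add: ennreal_plus)
  then have "l + C * (b' + b') \<le> (C + e) * (N + M)"
    using C e N0 by (subst (asm) ennreal_le_iff) auto
  moreover have "C * b \<le> C * b'" using C b' by (intro mult_left_mono)
  ultimately have "l \<le> C * (N + M - 2 * b) + e * (N + M)" by (simp add: algebra_simps)
  then show ?thesis unfolding l by (rule ennreal_leI)
qed

text \<open>
  The line integrals of the average and of the product are bounded from below on one line by Fatou's
  lemma and on all lower lines by monotonicity, so the defect has a small integral there. Higher lines
  need only the monotonicity for \<open>g n - f\<close> itself.
\<close>

proposition Hardy_Kadec_Klee:
  assumes f: "f \<in> Hardy_space p" and g: "\<And>n. g n \<in> Hardy_space p" and p: "p \<ge> 1"
    and lim: "\<And>z. Im z > 0 \<Longrightarrow> (\<lambda>n. g n z) \<longlonglongrightarrow> f z"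
    and limsup: "\<And>e. e > 0 \<Longrightarrow> \<forall>\<^sub>F n in sequentially. Hardy_norm p (g n) powr p \<le> Hardy_norm p f powr p + e"
  shows "(\<lambda>n. Hardy_norm p (\<lambda>z. g n z - f z)) \<longlonglongrightarrow> 0"
proof -
  have p0: "p > 0" using p by simp
  define N where "N = Hardy_norm p f powr p"
  have N: "N \<ge> 0" by (simp add: N_def)
  note holf = Hardy_space_holomorphic[OF f] and holg = Hardy_space_holomorphic[OF g]
  have key: "\<forall>\<^sub>F n in sequentially. \<forall>y>0. level_integral p (\<lambda>z. g n z - f z) y \<le> ennreal \<eta>"
    if \<eta>: "\<eta> > 0" for \<eta>
  proof -
    define e where "e = \<eta> / (2 * (2 * N + 1))"
    have e: "e > 0" using \<eta> N by (simp add: e_def)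
    obtain C where C: "C \<ge> 0"
      and ineq: "\<And>a b. norm (a - b) powr p \<le> C * Hardy_defect p a b + e * (norm a powr p + norm b powr p)"
      using Hardy_defect_controls_difference[OF p e] by blast
    \<comment> \<open>the defect will have integral at most \<open>5 d\<close>, and \<open>5 C d\<close> must not exceed \<open>\<eta> /
      2\<close>\<close>
    define d where "d = min 1 (\<eta> / (10 * (C + 1)))"
    have d: "d > 0" "d \<le> 1" using \<eta> C by (auto simp: d_def)
    have "(C + 1) * d \<le> (C + 1) * (\<eta> / (10 * (C + 1)))"
      unfolding d_def using C by (intro mult_left_mono) auto
    also have "\<dots> = \<eta> / 10"
    proof -
      have "x * (\<eta> / (10 * x)) = \<eta> / 10" if "x > 0" for x
        using that by simp
      then show ?thesis using C by (metis add_nonneg_pos zero_less_one)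
    qed
    finally have "C * d + d \<le> \<eta> / 10" by (simp add: distrib_right)
    then have Cd: "5 * (C * d) \<le> \<eta> / 2" using d by argo
    obtain y0 where y0: "y0 > 0" "ennreal (N - d) \<le> level_integral p f y0"
      using Hardy_level_near_norm[OF f p0 d(1)] unfolding N_def .
    have prod_level: "level_integral (p / 2) (\<lambda>z. f z * f z) y = level_integral p f y" for y
    proof -
      have "norm (w * w) powr (p / 2) = norm w powr p" for w :: complex
        by (simp add: norm_mult powr_mult flip: powr_add)
      then show ?thesis by (simp add: level_integral_def)
    qed
    have ev1: "\<forall>\<^sub>F n in sequentially. ennreal (N - 2 * d) \<le> level_integral p (\<lambda>z. (g n z + f z) / 2) y0"
    proof (rule eventually_level_integral_ge[OF _ p0 y0(1), where G = f])
      show "(\<lambda>n. (g n z + f z) / 2) \<longlonglongrightarrow> f z" if "Im z > 0" for z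
        using tendsto_divide[OF tendsto_add[OF lim[OF that] tendsto_const] tendsto_const, of 2 "f z"] by simp
    qed (use holf holg y0 d in \<open>auto intro!: holomorphic_intros\<close>)
    have ev2: "\<forall>\<^sub>F n in sequentially. ennreal (N - 2 * d) \<le> level_integral (p / 2) (\<lambda>z. g n z * f z) y0"
    proof (rule eventually_level_integral_ge[OF _ _ y0(1), where G = "\<lambda>z. f z * f z"])
      show "(\<lambda>n. g n z * f z) \<longlonglongrightarrow> f z * f z" if "Im z > 0" for z
        by (intro tendsto_intros lim[OF that])
      show "ennreal (N - d) \<le> level_integral (p / 2) (\<lambda>z. f z * f z) y0"
        unfolding prod_level by (rule y0)
    qed (use holf holg p0 d in \<open>auto intro!: holomorphic_intros\<close>)
    from ev1 ev2 limsup[OF d(1)] show ?thesis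
    proof eventually_elim
      case (elim n)
      have small: "level_integral p (\<lambda>z. g n z - f z) y \<le> ennreal \<eta>" if y: "0 < y" "y \<le> y0" for y
      proof -
        have avg: "level_integral p (\<lambda>z. (g n z + f z) / 2) y0 \<le> level_integral p (\<lambda>z. (g n z + f z) / 2) y"
        proof (rule level_integral_antimono[OF _ p0 _ _ y])
          show "level_integral p (\<lambda>z. (g n z + f z) / 2) y \<le> ennreal (1 * (Hardy_norm p (g n) powr p + Hardy_norm p f powr p))"
            if "y > 0" for y
          proof (rule level_integral_dominated[OF g f p0 _ _ that])
            fix z
            show "norm ((g n z + f z) / 2) powr p \<le> 1 * (norm (g n z) powr p + norm (f z) powr p)"
              using norm_average_powr_le[OF p, of "g n z" "f z"]
                add_nonneg_nonneg[OF powr_ge_zero powr_ge_zero, of "norm (g n z)" p "norm (f z)" p] by argo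
          qed simp
        qed (use holf holg in \<open>auto intro!: holomorphic_intros\<close>)
        have prd: "level_integral (p / 2) (\<lambda>z. g n z * f z) y0 \<le> level_integral (p / 2) (\<lambda>z. g n z * f z) y"
        proof (rule level_integral_antimono[OF _ _ _ _ y])
          show "level_integral (p / 2) (\<lambda>z. g n z * f z) y \<le> ennreal (1 * (Hardy_norm p (g n) powr p + Hardy_norm p f powr p))"
            if "y > 0" for y
          proof (rule level_integral_dominated[OF g f p0 _ _ that])
            fix z
            show "norm (g n z * f z) powr (p / 2) \<le> 1 * (norm (g n z) powr p + norm (f z) powr p)"
              using norm_mult_powr_half_le(1)[of "g n z" "f z" p]
                add_nonneg_nonneg[OF powr_ge_zero powr_ge_zero, of "norm (g n z)" p "norm (f z)" p] by argo
          qed simp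
        qed (use holf holg p0 in \<open>auto intro!: holomorphic_intros\<close>)
        have "level_integral p (\<lambda>z. g n z - f z) y \<le>
            ennreal (C * ((N + d) + N - 2 * (N - 2 * d)) + e * ((N + d) + N))"
        proof (rule Hardy_defect_level_estimate[OF g f p0 y(1) C _ ineq])
          show "ennreal (N - 2 * d) \<le> level_integral p (\<lambda>z. (g n z + f z) / 2) y"
            using elim(1) avg by (rule order_trans)
          show "ennreal (N - 2 * d) \<le> level_integral (p / 2) (\<lambda>z. g n z * f z) y"
            using elim(2) prd by (rule order_trans)
        qed (use elim(3) e in \<open>auto simp: N_def\<close>)
        also have "C * ((N + d) + N - 2 * (N - 2 * d)) + e * ((N + d) + N) \<le> \<eta>"
        proof -
          have "e * ((N + d) + N) \<le> e * (2 * N + 1)" using e d by (intro mult_left_mono) auto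
          also have "\<dots> = \<eta> / 2" using N by (simp add: e_def field_simps)
          finally have 1: "e * ((N + d) + N) \<le> \<eta> / 2" .
          have "C * ((N + d) + N - 2 * (N - 2 * d)) = 5 * (C * d)" by (simp add: algebra_simps)
          then show ?thesis using 1 Cd by argo
        qed
        finally show ?thesis by (simp add: ennreal_leI)
      qed
      show ?case
      proof (intro allI impI)
        fix y :: real assume y: "y > 0"
        show "level_integral p (\<lambda>z. g n z - f z) y \<le> ennreal \<eta>"
        proof (cases "y \<le> y0")
          case False
          have "level_integral p (\<lambda>z. g n z - f z) y \<le> level_integral p (\<lambda>z. g n z - f z) y0"
            by (rule level_integral_antimono[OF Hardy_space_holomorphic[OF Hardy_space_diff[OF g f p0]] p0
                  powr_ge_zero Hardy_level_le[OF Hardy_space_diff[OF g f p0] p0]]) (use False y0 in auto)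
          also have "\<dots> \<le> ennreal \<eta>" using small[of y0] y0 by simp
          finally show ?thesis .
        qed (use small y in auto)
      qed
    qed
  qed
  show ?thesis
  proof (rule LIMSEQ_I)
    fix r :: real assume r: "r > 0"
    define \<eta> where "\<eta> = (r / 2) powr p"
    have \<eta>: "\<eta> > 0" using r by (simp add: \<eta>_def)
    from key[OF \<eta>] obtain n0 where n0: "\<And>n y. n \<ge> n0 \<Longrightarrow> y > 0 \<Longrightarrow> level_integral p (\<lambda>z. g n z - f z) y \<le> ennreal \<eta>"
      unfolding eventually_sequentially by blast
    have "norm (Hardy_norm p (\<lambda>z. g n z - f z) - 0) < r" if n: "n \<ge> n0" for n
    proof -
      have "Hardy_norm p (\<lambda>z. g n z - f z) \<le> \<eta> powr (1 / p)"
        using Hardy_space_holomorphic[OF Hardy_space_diff[OF g f p0]] n0[OF n] \<eta>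
        by (intro Hardy_spaceI(2) p0) auto
      also have "\<dots> = r / 2" using r p0 by (simp add: \<eta>_def powr_powr)
      finally show ?thesis using Hardy_norm_nonneg[OF Hardy_space_diff[OF g f p0], of n] r by simp
    qed
    then show "\<exists>n0. \<forall>n\<ge>n0. norm (Hardy_norm p (\<lambda>z. g n z - f z) - 0) < r" by blast
  qed
qed

section \<open>Self-maps of the half-plane and their dilation at infinity\<close>

lemma nn_integral_poisson_kernel:
  assumes "Y > 0"
  shows "(\<integral>\<^sup>+s. ennreal (poisson_kernel Y (s - a)) \<partial>lborel) = 1"
  using nn_integral_tan_substitution[of "\<lambda>_. 1" Y a] assms by simp

text \<open>
  With \<open>v = Im w\<close>, the \<open>p\<close>-th power of the modulus is at most \<open>\<pi> v\<^sup>1\<^sup>-\<^sup>2\<^sup>p\<close> times a Poisson kernel, whose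
  integral is \<open>1\<close>.
\<close>

lemma Hardy_space_inverse_square:
  assumes p: "p \<ge> 1" and w: "Im w > 0"
  shows "(\<lambda>z. 1 / (z - cnj w)\<^sup>2) \<in> Hardy_space p" (is "?f \<in> _")
    and "Hardy_norm p (\<lambda>z. 1 / (z - cnj w)\<^sup>2) powr p \<le> pi * Im w powr (1 - 2 * p)"
proof -
  define v where "v = Im w"
  have v: "v > 0" using w by (simp add: v_def)
  have hol: "?f holomorphic_on upper_halfplane"
  proof (intro holomorphic_intros)
    fix z assume "z \<in> upper_halfplane"
    then have "Im (z - cnj w) > 0" using w by simp
    then have "z - cnj w \<noteq> 0" by force
    then show "(z - cnj w)\<^sup>2 \<noteq> 0" by simp
  qed
  have pt: "norm (?f (Complex x y)) powr p \<le> pi * v powr (1 - 2 * p) * poisson_kernel v (x - Re w)"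
    if y: "y > 0" for x y
  proof -
    let ?Q = "(x - Re w)\<^sup>2 + v\<^sup>2"
    have Q: "?Q > 0" "v\<^sup>2 \<le> ?Q" using v by (auto intro: add_nonneg_pos)
    have "norm (?f (Complex x y)) = 1 / ((x - Re w)\<^sup>2 + (y + v)\<^sup>2)"
      by (simp add: norm_divide norm_power cmod_power2 v_def)
    also have "\<dots> \<le> 1 / ?Q"
      using y v Q by (intro divide_left_mono add_left_mono power_mono mult_pos_pos add_nonneg_pos) auto
    finally have "norm (?f (Complex x y)) powr p \<le> (1 / ?Q) powr p"
      using p by (intro powr_mono2) auto
    also have "\<dots> = (1 / ?Q) powr (p - 1) * (1 / ?Q)"
      using Q by (subst powr_diff) auto
    also have "\<dots> \<le> (1 / v\<^sup>2) powr (p - 1) * (1 / ?Q)"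
      using Q v p by (intro mult_right_mono powr_mono2 divide_left_mono mult_pos_pos) auto
    also have "(1 / v\<^sup>2) powr (p - 1) = v powr (2 - 2 * p)"
    proof -
      have "1 / v\<^sup>2 = v powr (- 2)" using v by (simp add: powr_minus_divide powr_numeral)
      then show ?thesis by (simp add: powr_powr algebra_simps)
    qed
    also have "v powr (2 - 2 * p) = v powr (1 - 2 * p) * v"
      using v powr_add[of v "1 - 2 * p" 1] by simp
    also have "v powr (1 - 2 * p) * v * (1 / ?Q) = pi * v powr (1 - 2 * p) * poisson_kernel v (x - Re w)"
      by (simp add: poisson_kernel_def)
    finally show ?thesis .
  qed
  have le: "level_integral p ?f y \<le> ennreal (pi * v powr (1 - 2 * p))" if y: "y > 0" for y
  proof -
    have "level_integral p ?f y \<le> (\<integral>\<^sup>+x. ennreal (pi * v powr (1 - 2 * p)) * ennreal (poisson_kernel v (x - Re w)) \<partial>lborel)"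
      unfolding level_integral_def using pt[OF y] v
      by (intro nn_integral_mono) (simp flip: ennreal_mult add: poisson_kernel_def ennreal_leI)
    also have "\<dots> = ennreal (pi * v powr (1 - 2 * p)) * (\<integral>\<^sup>+x. ennreal (poisson_kernel v (x - Re w)) \<partial>lborel)"
      by (rule nn_integral_cmult) (unfold poisson_kernel_def, measurable)
    finally show ?thesis by (simp add: nn_integral_poisson_kernel[OF v])
  qed
  show "?f \<in> Hardy_space p"
    by (rule Hardy_spaceI(1)[OF hol _ _ le]) (use p in auto)
  show "Hardy_norm p ?f powr p \<le> pi * Im w powr (1 - 2 * p)"
    unfolding v_def[symmetric] by (rule Hardy_norm_powr_le[OF hol _ _ le]) (use p in auto)
qed

text \<open>
  The function \<open>(u - cnj w)\<^sup>-\<^sup>2\<close> with \<open>w = \<phi>(z)\<close> is as large at \<open>w\<close> as its norm allows, up to a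
  constant. Its composition with \<open>\<phi>\<close> takes this value at \<open>z\<close>, where it is bounded in terms of
  \<open>Im z\<close>.
\<close>

lemma bounded_composition_imp_Im_ge:
  assumes p: "p \<ge> 1" and \<phi>: "\<phi> \<in> upper_halfplane \<rightarrow> upper_halfplane"
    and bd: "Hardy_bounded_op p (\<lambda>f. f \<circ> \<phi>)"
  shows "\<exists>c>0. \<forall>z. Im z > 0 \<longrightarrow> c * Im z \<le> Im (\<phi> z)"
proof -
  obtain C0 where mem: "\<And>f. f \<in> Hardy_space p \<Longrightarrow> f \<circ> \<phi> \<in> Hardy_space p"
    and C0: "\<And>f. f \<in> Hardy_space p \<Longrightarrow> Hardy_norm p (f \<circ> \<phi>) \<le> C0 * Hardy_norm p f"
    using bd unfolding Hardy_bounded_op_def by blast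
  define C where "C = max C0 1"
  have C: "C > 0" by (simp add: C_def)
  have CC: "Hardy_norm p (f \<circ> \<phi>) \<le> C * Hardy_norm p f" if "f \<in> Hardy_space p" for f
    using C0[OF that] mult_right_mono[OF _ Hardy_norm_nonneg[OF that], of C0 C]
    by (simp add: C_def)
  \<comment> \<open>\<open>4\<close> from the pointwise bound, \<open>C powr p\<close> from the operator, \<open>pi\<close> from the norm of
    the test function, and \<open>2 powr (2 * p)\<close> from its value \<open>(2 * v) powr (- 2)\<close> in modulus\<close>
  define K where "K = 4 * C powr p * pi * 2 powr (2 * p)"
  have K: "K > 0" using C by (simp add: K_def)
  have "Im z \<le> K * Im (\<phi> z)" if z: "Im z > 0" for z
  proof -
    define v where "v = Im (\<phi> z)"
    have v: "v > 0" using \<phi> z by (auto simp: v_def)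
    let ?f = "\<lambda>u. 1 / (u - cnj (\<phi> z))\<^sup>2"
    note f = Hardy_space_inverse_square[OF p v[unfolded v_def]]
    have "norm ((?f \<circ> \<phi>) z) powr p \<le> 4 * Hardy_norm p (?f \<circ> \<phi>) powr p / Im z"
      by (rule Hardy_pointwise_bound[OF mem[OF f(1)] _ z]) (use p in simp)
    also have "\<dots> \<le> 4 * (C powr p * (pi * v powr (1 - 2 * p))) / Im z"
    proof -
      have "Hardy_norm p (?f \<circ> \<phi>) powr p \<le> (C * Hardy_norm p ?f) powr p"
        using p by (intro powr_mono2 CC f(1) Hardy_norm_nonneg[OF mem[OF f(1)]]) auto
      also have "\<dots> = C powr p * Hardy_norm p ?f powr p"
        using C Hardy_norm_nonneg[OF f(1)] by (intro powr_mult)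
      also have "\<dots> \<le> C powr p * (pi * v powr (1 - 2 * p))"
        using f(2) unfolding v_def by (intro mult_left_mono) auto
      finally show ?thesis using z by (intro divide_right_mono mult_left_mono) auto
    qed
    also have "norm ((?f \<circ> \<phi>) z) = (2 * v) powr (- 2)"
    proof -
      have "\<phi> z - cnj (\<phi> z) = of_real (2 * v) * \<i>" by (simp add: complex_eq_iff v_def)
      then have "norm (\<phi> z - cnj (\<phi> z)) = 2 * v" using v by (simp add: norm_mult)
      then show ?thesis using v by (simp add: norm_divide norm_power powr_minus_divide powr_numeral)
    qed
    also have "((2 * v) powr (- 2)) powr p = v powr (- 2 * p) / 2 powr (2 * p)"
    proof -
      have "((2 * v) powr (- 2)) powr p = (2 * v) powr (- (2 * p))"
        unfolding powr_powr by simp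
      also have "\<dots> = 2 powr (- (2 * p)) * v powr (- (2 * p))"
        by (rule powr_mult)
      finally show ?thesis by (simp add: powr_minus_divide)
    qed
    finally have "v powr (- 2 * p) * Im z \<le> 4 * (C powr p * (pi * v powr (1 - 2 * p))) * 2 powr (2 * p)"
      using z by (simp add: field_simps)
    also have "v powr (1 - 2 * p) = v powr (- 2 * p) * v"
      using v powr_add[of v "- 2 * p" 1] by simp
    finally have "v powr (- 2 * p) * Im z \<le> v powr (- 2 * p) * (K * v)"
      by (simp add: K_def mult_ac)
    then show ?thesis using v by (simp add: v_def)
  qed
  then have "(1 / K) * Im z \<le> Im (\<phi> z)" if "Im z > 0" for z
    using that K by (simp add: field_simps)
  then show ?thesis using K by (intro exI[of _ "1 / K"]) auto
qed

lemma norm_diff_cnj_power2: "(norm (a - cnj b))\<^sup>2 = (norm (a - b))\<^sup>2 + 4 * Im a * Im b"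
  unfolding cmod_power2 by (simp add: algebra_simps power2_eq_square)

text \<open>
  The Schwarz lemma after Cayley maps that take \<open>z0\<close> and \<open>h(z0)\<close> to \<open>0\<close>.
\<close>

lemma Schwarz_Pick_halfplane:
  assumes h: "h holomorphic_on upper_halfplane" "\<And>z. Im z > 0 \<Longrightarrow> Im (h z) > 0"
    and z: "Im z > 0" and z0: "Im z0 > 0"
  shows "norm (h z - h z0) * norm (z - cnj z0) \<le> norm (z - z0) * norm (h z - cnj (h z0))"
proof -
  have ne: "a - cnj b \<noteq> 0" if "Im a > 0" "Im b > 0" for a b
    using that by (auto simp: complex_eq_iff)
  have lt1: "norm ((a - b) / (a - cnj b)) < 1" if "Im a > 0" "Im b > 0" for a b
  proof -
    have "(norm (a - b))\<^sup>2 < (norm (a - cnj b))\<^sup>2"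
      unfolding norm_diff_cnj_power2 using that by simp
    then have "norm (a - b) < norm (a - cnj b)"
      by (rule power2_less_imp_less) simp
    then show ?thesis using ne[OF that] by (simp add: norm_divide divide_less_eq)
  qed
  define M where "M w = (z0 - cnj z0 * w) / (1 - w)" for w
  have MIm: "Im (M w) > 0" if "norm w < 1" for w
  proof -
    have "w \<noteq> 1" using that by auto
    then have "1 - w \<noteq> 0" by simp
    have "M w = of_real (Re z0) + of_real (Im z0) * \<i> * ((1 + w) / (1 - w))"
    proof -
      have "(a + b - (a - b) * w) / (1 - w) = a + b * ((1 + w) / (1 - w))" for a b :: complex
        using \<open>1 - w \<noteq> 0\<close> by (simp add: field_simps)
      moreover have "z0 = of_real (Re z0) + of_real (Im z0) * \<i>" "cnj z0 = of_real (Re z0) - of_real (Im z0) * \<i>"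
        by (simp_all add: complex_eq_iff)
      ultimately show ?thesis unfolding M_def by metis
    qed
    also have "\<dots> = cayley (of_real (Re z0)) (Im z0) w" by (simp add: cayley_def)
    finally show ?thesis using Im_cayley[OF z0 that, of "of_real (Re z0)"] by simp
  qed
  define B where "B w = (h (M w) - h z0) / (h (M w) - cnj (h z0))" for w
  have Mhol: "M holomorphic_on ball 0 1"
    unfolding M_def by (intro holomorphic_intros) auto
  have hM: "(h \<circ> M) holomorphic_on ball 0 1"
    by (rule holomorphic_on_compose_gen[OF Mhol h(1)]) (use MIm in auto)
  then have Bhol: "B holomorphic_on ball 0 1"
    unfolding B_def o_def by (intro holomorphic_intros) (use ne h(2) MIm z0 in auto)
  define w where "w = (z - z0) / (z - cnj z0)"
  have w: "norm w < 1" unfolding w_def by (rule lt1[OF z z0])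
  have Mw: "M w = z"
  proof -
    have d: "z - cnj z0 \<noteq> 0" "z0 - cnj z0 \<noteq> 0" using ne z z0 by auto
    have "1 - w = (z0 - cnj z0) / (z - cnj z0)"
      using d by (simp add: w_def field_simps)
    moreover have "z0 - cnj z0 * w = z * (z0 - cnj z0) / (z - cnj z0)"
      using d by (simp add: w_def field_simps)
    ultimately show ?thesis using d by (simp add: M_def)
  qed
  have "norm (B w) \<le> norm w"
  proof (rule Schwarz_Lemma(1)[OF Bhol _ _ w])
    show "B 0 = 0" by (simp add: B_def M_def)
    show "norm (B u) < 1" if "norm u < 1" for u
      unfolding B_def using lt1 h(2) MIm[OF that] z0 by auto
  qed
  then have "norm (h z - h z0) / norm (h z - cnj (h z0)) \<le> norm (z - z0) / norm (z - cnj z0)"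
    unfolding B_def Mw by (simp add: w_def norm_divide)
  moreover have "norm (h z - cnj (h z0)) > 0" "norm (z - cnj z0) > 0"
    using ne[OF z z0] ne[OF h(2)[OF z] h(2)[OF z0]] by auto
  ultimately show ?thesis by (simp add: field_simps)
qed

text \<open>
  A small ratio \<open>Im h(z0) / Im z0\<close> at a single point makes the growth of \<open>h\<close> at infinity slow; this is
  the source of the Julia-Caratheodory theorem.
\<close>

lemma halfplane_self_map_growth:
  assumes h: "h holomorphic_on upper_halfplane" "\<And>z. Im z > 0 \<Longrightarrow> Im (h z) > 0"
    and z: "Im z > 0" and z0: "Im z0 > 0"
  shows "norm (h z) \<le> norm (h z0) + Im (h z0) / Im z0 * (norm (z - cnj z0))\<^sup>2 / Im z"
proof -
  define N Q where "N = norm (h z - cnj (h z0))" and "Q = (norm (z - cnj z0))\<^sup>2"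
  have SP: "(norm (h z - h z0) * norm (z - cnj z0))\<^sup>2 \<le> (norm (z - z0) * norm (h z - cnj (h z0)))\<^sup>2"
    by (intro power_mono Schwarz_Pick_halfplane[OF h z z0]) auto
  have "(N\<^sup>2 - 4 * Im (h z) * Im (h z0)) * Q \<le> (Q - 4 * Im z * Im z0) * N\<^sup>2"
  proof -
    have "(norm (h z - h z0))\<^sup>2 = N\<^sup>2 - 4 * Im (h z) * Im (h z0)" "(norm (z - z0))\<^sup>2 = Q - 4 * Im z * Im z0"
      unfolding N_def Q_def norm_diff_cnj_power2 by simp_all
    then show ?thesis
      using SP by (simp add: power_mult_distrib N_def Q_def)
  qed
  then have 1: "Im z * Im z0 * N\<^sup>2 \<le> Im (h z) * Im (h z0) * Q"
    by (simp add: algebra_simps)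
  have "Im (h z) \<le> Im (h z - cnj (h z0))" using h(2)[OF z0] by simp
  also have "\<dots> \<le> N" unfolding N_def using abs_Im_le_cmod by (rule order_trans[OF abs_ge_self])
  finally have 2: "Im (h z) \<le> N" .
  then have N: "N > 0" using h(2)[OF z] by linarith
  have "Im (h z) * (Im (h z0) * Q) \<le> N * (Im (h z0) * Q)"
    using 2 h(2)[OF z0] by (intro mult_right_mono) (auto simp: Q_def)
  then have "N * (Im z * Im z0 * N) \<le> N * (Im (h z0) * Q)"
    using 1 by (simp add: power2_eq_square mult_ac)
  then have "Im z * Im z0 * N \<le> Im (h z0) * Q" using N by simp
  then have "N \<le> Im (h z0) / Im z0 * Q / Im z"
    using z z0 by (simp add: field_simps)
  moreover have "norm (h z) \<le> norm (h z0) + N"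
    unfolding N_def using norm_triangle_sub[of "h z" "cnj (h z0)"] by simp
  ultimately show ?thesis unfolding Q_def by linarith
qed

text \<open>
  By the theorem of Julia and Caratheodory below, this infimum is the angular limit of \<open>\<phi>(z) / z\<close>
  at infinity. The infimum makes upper semicontinuity in \<open>\<phi>\<close> evident, the limit multiplicativity.
\<close>

definition dilation_at_infinity :: "(complex \<Rightarrow> complex) \<Rightarrow> real" where
  "dilation_at_infinity \<phi> = (INF z\<in>upper_halfplane. Im (\<phi> z) / Im z)"

lemma dilation_at_infinity:
  assumes "\<And>z. Im z > 0 \<Longrightarrow> k * Im z \<le> Im (\<phi> z)"
  shows "k \<le> dilation_at_infinity \<phi>"
    and "Im z > 0 \<Longrightarrow> dilation_at_infinity \<phi> * Im z \<le> Im (\<phi> z)"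
    and "e > 0 \<Longrightarrow> \<exists>z. Im z > 0 \<and> Im (\<phi> z) \<le> (dilation_at_infinity \<phi> + e) * Im z"
proof -
  have ne: "upper_halfplane \<noteq> {}" by (auto simp: upper_halfplane_def intro: exI[of _ \<i>])
  have k: "k \<le> Im (\<phi> z) / Im z" if "z \<in> upper_halfplane" for z
    using assms[of z] that by (simp add: pos_le_divide_eq)
  then have bdd: "bdd_below ((\<lambda>z. Im (\<phi> z) / Im z) ` upper_halfplane)"
    by (intro bdd_belowI2)
  show "k \<le> dilation_at_infinity \<phi>"
    unfolding dilation_at_infinity_def by (intro cINF_greatest ne k)
  show "dilation_at_infinity \<phi> * Im z \<le> Im (\<phi> z)" if "Im z > 0"
  proof -
    have "dilation_at_infinity \<phi> \<le> Im (\<phi> z) / Im z"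
      unfolding dilation_at_infinity_def using that by (intro cINF_lower bdd) simp
    then show ?thesis using that by (simp add: pos_le_divide_eq)
  qed
  show "\<exists>z. Im z > 0 \<and> Im (\<phi> z) \<le> (dilation_at_infinity \<phi> + e) * Im z" if "e > 0"
  proof -
    have "dilation_at_infinity \<phi> < dilation_at_infinity \<phi> + e" using that by simp
    then obtain z where "z \<in> upper_halfplane" "Im (\<phi> z) / Im z < dilation_at_infinity \<phi> + e"
      unfolding dilation_at_infinity_def using cINF_less_iff[OF ne bdd] by blast
    then show ?thesis by (intro exI[of _ z]) (auto simp: pos_divide_less_eq)
  qed
qed

text \<open>
  After subtraction of a linear function with a slightly smaller slope, \<open>\<phi>\<close> is still a self-map of the
  half-plane, but at a point where \<open>Im \<phi>(z) / Im z\<close> nearly attains its infimum, the ratio for the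
  difference is tiny. Then \<open>halfplane_self_map_growth\<close> applies.
\<close>

lemma Julia_Caratheodory:
  assumes \<phi>: "\<phi> holomorphic_on upper_halfplane"
    and k: "\<And>z. Im z > 0 \<Longrightarrow> k * Im z \<le> Im (\<phi> z)"
    and zn: "filterlim z at_infinity sequentially"
    and K: "K > 0" "\<forall>\<^sub>F n in sequentially. Im (z n) > 0 \<and> norm (z n) \<le> K * Im (z n)"
  shows "(\<lambda>n. \<phi> (z n) / z n) \<longlonglongrightarrow> of_real (dilation_at_infinity \<phi>)"
proof (rule tendstoI)
  fix r :: real assume r: "r > 0"
  define c where "c = dilation_at_infinity \<phi>"
  have D2: "c * Im z \<le> Im (\<phi> z)" if "Im z > 0" for z
    unfolding c_def by (rule dilation_at_infinity(2)[of k]) (use k that in auto)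
  have D3: "\<exists>z. Im z > 0 \<and> Im (\<phi> z) \<le> (c + e) * Im z" if "e > 0" for e
    unfolding c_def by (rule dilation_at_infinity(3)[of k]) (use k that in auto)
  \<comment> \<open>the slope is lowered by \<open>e\<close>, and the remainder has slope at most \<open>8 K e\<close> at infinity\<close>
  define e where "e = r / (2 * (8 * K + 1))"
  have e: "e > 0" using r K by (simp add: e_def)
  have eK: "(8 * K + 1) * e = r / 2" using K by (simp add: e_def field_simps)
  obtain z0 where z0: "Im z0 > 0" "Im (\<phi> z0) \<le> (c + e) * Im z0" using D3[OF e] by blast
  \<comment> \<open>a slope below \<open>c\<close> keeps the imaginary part strictly positive\<close>
  define h where "h z = \<phi> z - of_real (c - e) * z" for z
  have hol: "h holomorphic_on upper_halfplane" unfolding h_def by (intro holomorphic_intros \<phi>)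
  have Imh: "Im (h z) > 0" if "Im z > 0" for z
  proof -
    have "Im (h z) = Im (\<phi> z) - c * Im z + e * Im z" by (simp add: h_def algebra_simps)
    moreover have "e * Im z > 0" using e that by simp
    ultimately show ?thesis using D2[OF that] by linarith
  qed
  have "Im (h z0) \<le> 2 * e * Im z0"
    using z0(2) by (simp add: h_def algebra_simps)
  then have q: "Im (h z0) / Im z0 \<le> 2 * e" using z0(1) by (simp add: pos_divide_le_eq)
  have big: "\<forall>\<^sub>F n in sequentially. norm (z n) > R" for R
    using zn unfolding filterlim_at_infinity[OF order_refl]
    by (metis (mono_tags, lifting) eventually_mono filterlim_at_infinity_conv_norm_at_top filterlim_at_top_dense zn)
  from K(2) big[of "norm z0"] big[of "2 * norm (h z0) / r + 1"]
  show "\<forall>\<^sub>F n in sequentially. dist (\<phi> (z n) / z n) (of_real (dilation_at_infinity \<phi>)) < r"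
  proof eventually_elim
    case (elim n)
    then have z: "Im (z n) > 0" and zK: "norm (z n) \<le> K * Im (z n)" and zz0: "norm z0 < norm (z n)"
      and zh: "2 * norm (h z0) / r + 1 < norm (z n)" by auto
    define m where "m = norm (z n)"
    have m: "m > 0" using z by (auto simp: m_def)
    have "(norm (z n - cnj z0))\<^sup>2 \<le> (2 * m)\<^sup>2"
      using norm_triangle_ineq4[of "z n" "cnj z0"] zz0 by (intro power_mono) (auto simp: m_def)
    then have "(norm (z n - cnj z0))\<^sup>2 / Im (z n) \<le> (2 * m)\<^sup>2 / (m / K)"
      using z zK m K by (intro frac_le) (auto simp: m_def field_simps)
    also have "\<dots> = 4 * K * m" using m K by (simp add: power2_eq_square)
    finally have "(Im (h z0) / Im z0) * ((norm (z n - cnj z0))\<^sup>2 / Im (z n)) \<le> (2 * e) * (4 * K * m)"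
      using q e z K m by (intro mult_mono) auto
    then have "norm (h (z n)) \<le> norm (h z0) + (2 * e) * (4 * K * m)"
      using halfplane_self_map_growth[OF hol Imh z z0(1)] by simp
    then have "norm (h (z n)) / m \<le> (norm (h z0) + (2 * e) * (4 * K * m)) / m"
      using m by (intro divide_right_mono) auto
    also have "\<dots> = norm (h z0) / m + 8 * K * e" using m by (simp add: field_simps)
    finally have 1: "norm (h (z n)) / m \<le> norm (h z0) / m + 8 * K * e" .
    have "2 * norm (h z0) / r < m" using zh by (simp add: m_def)
    then have 2: "norm (h z0) / m < r / 2" using m r by (simp add: field_simps)
    have "\<phi> (z n) / z n - of_real c = h (z n) / z n - of_real e"
      using m by (simp add: h_def m_def field_simps)
    then have "norm (\<phi> (z n) / z n - of_real c) \<le> norm (h (z n) / z n) + norm (of_real e :: complex)"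
      by (metis norm_triangle_ineq4)
    also have "\<dots> = norm (h (z n)) / m + e" using e by (simp add: norm_divide m_def)
    also have "\<dots> < r" using 1 2 eK by (simp add: algebra_simps)
    finally show ?case by (simp add: dist_norm c_def)
  qed
qed

text \<open>
  Along the imaginary axis \<open>\<psi>(z) / z\<close> tends to the positive dilation of \<open>\<psi>\<close>. Hence \<open>\<psi>(z)\<close> tends to
  infinity inside an angle, and the limit for \<open>\<phi>\<close> can be taken along \<open>\<psi>(z)\<close>.
\<close>

lemma dilation_at_infinity_compose:
  assumes \<phi>: "\<phi> holomorphic_on upper_halfplane" and k: "k > 0" "\<And>z. Im z > 0 \<Longrightarrow> k * Im z \<le> Im (\<phi> z)"
    and \<psi>: "\<psi> holomorphic_on upper_halfplane" and l: "l > 0" "\<And>z. Im z > 0 \<Longrightarrow> l * Im z \<le> Im (\<psi> z)"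
  shows "dilation_at_infinity (\<phi> \<circ> \<psi>) = dilation_at_infinity \<phi> * dilation_at_infinity \<psi>"
proof -
  have pos: "Im (\<psi> z) > 0" if "Im z > 0" for z
    using l(2)[OF that] mult_pos_pos[OF l(1) that] by linarith
  have comp: "(\<phi> \<circ> \<psi>) holomorphic_on upper_halfplane"
    by (rule holomorphic_on_compose_gen[OF \<psi> \<phi>]) (use pos in auto)
  have compk: "k * l * Im z \<le> Im ((\<phi> \<circ> \<psi>) z)" if "Im z > 0" for z
  proof -
    have "k * (l * Im z) \<le> k * Im (\<psi> z)" using l(2)[OF that] k(1) by (intro mult_left_mono) auto
    then show ?thesis using k(2)[OF pos[OF that]] by (simp only: o_def mult.assoc)
  qed
  define c d where "c = dilation_at_infinity \<phi>" and "d = dilation_at_infinity \<psi>"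
  have d: "d > 0" using dilation_at_infinity(1)[of l \<psi>, OF l(2)] l(1) by (simp add: d_def)
  define z where "z n = of_nat (Suc n) * \<i>" for n
  have z: "Im (z n) > 0" "norm (z n) \<le> 1 * Im (z n)" "norm (z n) = real (Suc n)" for n
    by (auto simp: z_def norm_mult simp del: of_nat_Suc)
  have top: "filterlim (\<lambda>n. real (Suc n)) at_top sequentially"
    by (rule filterlim_compose[OF filterlim_real_sequentially filterlim_Suc])
  have zinf: "filterlim z at_infinity sequentially"
    unfolding filterlim_at_infinity_conv_norm_at_top z(3) by (rule top)
  have zev: "\<forall>\<^sub>F n in sequentially. Im (z n) > 0 \<and> norm (z n) \<le> 1 * Im (z n)"
    using z by (intro always_eventually) auto
  have A: "(\<lambda>n. \<psi> (z n) / z n) \<longlonglongrightarrow> of_real d"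
    unfolding d_def by (rule Julia_Caratheodory[OF \<psi> l(2) zinf _ zev]) auto
  have B: "(\<lambda>n. (\<phi> \<circ> \<psi>) (z n) / z n) \<longlonglongrightarrow> of_real (dilation_at_infinity (\<phi> \<circ> \<psi>))"
    by (rule Julia_Caratheodory[OF comp compk zinf _ zev]) auto
  have Imge: "d * real (Suc n) \<le> Im (\<psi> (z n))" for n
    using dilation_at_infinity(2)[of l \<psi> "z n", OF l(2) z(1)] by (simp add: d_def z_def)
  have "filterlim (\<lambda>n. norm (\<psi> (z n))) at_top sequentially"
  proof (rule filterlim_at_top_mono)
    show "filterlim (\<lambda>n. d * real (Suc n)) at_top sequentially"
      by (rule filterlim_tendsto_pos_mult_at_top[OF tendsto_const d top])
    show "\<forall>\<^sub>F n in sequentially. d * real (Suc n) \<le> norm (\<psi> (z n))"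
      using Imge abs_Im_le_cmod by (intro always_eventually allI) (meson abs_ge_self order_trans)
  qed
  then have winf: "filterlim (\<lambda>n. \<psi> (z n)) at_infinity sequentially"
    by (simp add: filterlim_at_infinity_conv_norm_at_top)
  have "\<forall>\<^sub>F n in sequentially. norm (\<psi> (z n) / z n) < d + 1"
    using order_tendstoD(2)[OF tendsto_norm[OF A], of "d + 1"] d by simp
  then have wev: "\<forall>\<^sub>F n in sequentially. Im (\<psi> (z n)) > 0 \<and> norm (\<psi> (z n)) \<le> ((d + 1) / d) * Im (\<psi> (z n))"
  proof eventually_elim
    case (elim n)
    have "norm (\<psi> (z n)) \<le> (d + 1) * real (Suc n)"
      using elim z(3)[of n] by (simp add: norm_divide divide_less_eq del: of_nat_Suc)
    also have "\<dots> = ((d + 1) / d) * (d * real (Suc n))" using d by simp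
    also have "\<dots> \<le> ((d + 1) / d) * Im (\<psi> (z n))" using d Imge by (intro mult_left_mono) auto
    finally show ?case using pos[OF z(1)] by simp
  qed
  have "(\<lambda>n. \<phi> (\<psi> (z n)) / \<psi> (z n)) \<longlonglongrightarrow> of_real c"
    unfolding c_def by (rule Julia_Caratheodory[OF \<phi> k(2) winf _ wev]) (use d in auto)
  from tendsto_mult[OF this A]
  have "(\<lambda>n. \<phi> (\<psi> (z n)) / \<psi> (z n) * (\<psi> (z n) / z n)) \<longlonglongrightarrow> of_real (c * d)" by simp
  moreover have "\<phi> (\<psi> (z n)) / \<psi> (z n) * (\<psi> (z n) / z n) = (\<phi> \<circ> \<psi>) (z n) / z n" for n
    using pos[OF z(1)[of n]] by auto
  ultimately have "(\<lambda>n. (\<phi> \<circ> \<psi>) (z n) / z n) \<longlonglongrightarrow> of_real (c * d)" by (simp only:)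
  from LIMSEQ_unique[OF this B] show ?thesis by (simp only: of_real_eq_iff c_def d_def)
qed

text \<open>
  The closed sets \<open>{c \<ge> 1 / n}\<close> cover \<open>[0, 1]\<close>, so by Baire one of them contains an interval. By
  multiplicativity \<open>c\<close> is then bounded below near \<open>0\<close>, and \<open>c(m t) = c(t)\<^sup>m\<close> improves this bound to any
  \<open>k < 1\<close>.
\<close>

lemma multiplicative_function_near_zero:
  fixes c :: "real \<Rightarrow> real"
  assumes pos: "\<And>t. t \<ge> 0 \<Longrightarrow> c t > 0" and mult: "\<And>s t. s \<ge> 0 \<Longrightarrow> t \<ge> 0 \<Longrightarrow> c (s + t) = c s * c t"
    and closed: "\<And>k. k > 0 \<Longrightarrow> closed {t \<in> {0..1}. k \<le> c t}"
    and k: "0 < k" "k < 1"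
  shows "\<forall>\<^sub>F t in at_right 0. k \<le> c t"
proof -
  define A where "A n = {t \<in> {0..1}. 1 / real (Suc n) \<le> c t}" for n
  have clA: "closed (A n)" for n unfolding A_def by (rule closed) simp
  have "\<exists>n. \<not> {0..1} \<subseteq> closure ({0..1} - A n)"
  proof (rule ccontr)
    assume "\<not> ?thesis"
    then have dense: "{0..1} \<subseteq> closure ({0..1} - A n)" for n by blast
    have "{0..1::real} \<subseteq> closure (\<Inter>(range (\<lambda>n. {0..1} - A n)))"
    proof (rule Baire)
      fix T assume "T \<in> range (\<lambda>n. {0..1} - A n)"
      then obtain n where T: "T = {0..1} - A n" by blast
      have "T = {0..1} \<inter> - A n" unfolding T by blast
      then show "openin (top_of_set {0..1}) T \<and> {0..1} \<subseteq> closure T"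
        using dense[of n] clA[of n] T by (auto simp: openin_open)
    qed auto
    moreover have "(\<Inter>n. {0..1} - A n) = {}"
    proof (rule equals0I)
      fix t assume t: "t \<in> (\<Inter>n. {0..1} - A n)"
      then have "t \<in> {0..1}" by auto
      obtain n where "1 / real (Suc n) < c t"
        using reals_Archimedean[OF pos[of t]] \<open>t \<in> {0..1}\<close> by (auto simp: inverse_eq_divide)
      then have "t \<in> A n" using \<open>t \<in> {0..1}\<close> by (simp add: A_def)
      then show False using t by auto
    qed
    ultimately have "{0..1::real} \<subseteq> closure {}" by (simp only:)
    then show False by simp
  qed
  then obtain n x where x: "x \<in> {0..1}" "x \<notin> closure ({0..1} - A n)" by blast
  then obtain e where e: "e > 0" "\<forall>t\<in>{0..1} - A n. \<not> dist t x < e"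
    unfolding closure_approachable by blast
  define a b where "a = max 0 (x - e / 2)" and "b = min 1 (x + e / 2)"
  have ab: "0 \<le> a" "a < b" "b \<le> 1" using x e by (auto simp: a_def b_def)
  have sub: "t \<in> A n" if "a \<le> t" "t \<le> b" for t
  proof -
    have "dist t x < e" using that e by (auto simp: a_def b_def dist_real_def)
    moreover have "t \<in> {0..1}" using that ab by auto
    ultimately show ?thesis using e(2) by blast
  qed
  define \<kappa> where "\<kappa> = (1 / real (Suc n)) / c a"
  have \<kappa>: "\<kappa> > 0" using pos[OF ab(1)] by (simp add: \<kappa>_def)
  have low: "\<kappa> \<le> c t" if t: "0 \<le> t" "t \<le> b - a" for t
  proof -
    have "1 / real (Suc n) \<le> c (a + t)" using sub[of "a + t"] t by (simp add: A_def)
    then show ?thesis using pos[OF ab(1)] mult[OF ab(1) t(1)] by (simp add: \<kappa>_def pos_divide_le_eq mult_ac)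
  qed
  have c0: "c 0 = 1" using mult[of 0 0] pos[of 0] by simp
  have pow: "c (real m * t) = c t ^ m" if "t \<ge> 0" for m t
  proof (induction m)
    case (Suc m)
    have "c (real (Suc m) * t) = c (real m * t + t)" by (simp add: algebra_simps)
    also have "\<dots> = c t ^ m * c t" using that Suc mult[of "real m * t" t] by simp
    finally show ?case by (simp add: mult.commute)
  qed (simp add: c0)
  have "(\<lambda>m. k ^ m) \<longlonglongrightarrow> 0" using k by (intro LIMSEQ_power_zero) auto
  then have "\<forall>\<^sub>F m in sequentially. k ^ m < \<kappa>" using \<kappa> by (rule order_tendstoD)
  then obtain m where m: "m > 0" "k ^ m < \<kappa>"
    unfolding eventually_sequentially by (metis le_add1 add.commute zero_less_Suc plus_1_eq_Suc)
  have "k \<le> c t" if t: "0 < t" "t < (b - a) / real m" for t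
  proof (rule ccontr)
    assume "\<not> k \<le> c t"
    then have "c t ^ m \<le> k ^ m" using pos[of t] t by (intro power_mono) auto
    moreover have "\<kappa> \<le> c (real m * t)" using t m by (intro low) (auto simp: field_simps)
    ultimately show False using m pow[of t m] t by simp
  qed
  then show ?thesis
    unfolding eventually_at_right_field using ab m by (intro exI[of _ "(b - a) / real m"]) auto
qed

section \<open>Differentiability of the orbits\<close>

lemma has_vector_derivative_iff_quotient:
  fixes f :: "real \<Rightarrow> complex"
  shows "(f has_vector_derivative d) (at t within S) \<longleftrightarrow>
    ((\<lambda>s. (f s - f t) / of_real (s - t)) \<longlongrightarrow> d) (at t within S)"
proof -
  have "(f has_vector_derivative d) (at t within S) \<longleftrightarrow>
      ((\<lambda>s. (1 / norm (s - t)) *\<^sub>R (f s - (f t + (s - t) *\<^sub>R d))) \<longlongrightarrow> 0) (at t within S)"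
    unfolding has_vector_derivative_def has_derivative_within
    by (simp add: bounded_linear_scaleR_left)
  also have "\<dots> \<longleftrightarrow> ((\<lambda>s. norm ((1 / norm (s - t)) *\<^sub>R (f s - (f t + (s - t) *\<^sub>R d)))) \<longlongrightarrow> 0) (at t within S)"
    by (rule tendsto_norm_zero_iff[symmetric])
  also have "\<dots> \<longleftrightarrow> ((\<lambda>s. norm ((f s - f t) / of_real (s - t) - d)) \<longlongrightarrow> 0) (at t within S)"
  proof (rule filterlim_cong[OF refl refl])
    show "\<forall>\<^sub>F s in at t within S. norm ((1 / norm (s - t)) *\<^sub>R (f s - (f t + (s - t) *\<^sub>R d))) =
        norm ((f s - f t) / of_real (s - t) - d)"
      unfolding eventually_at_filter
    proof (rule always_eventually, safe)
      fix s assume "s \<noteq> t"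
      then have "(f s - f t) / of_real (s - t) - d = (f s - (f t + (s - t) *\<^sub>R d)) / of_real (s - t)"
        by (simp add: field_simps scaleR_conv_of_real)
      then show "norm ((1 / norm (s - t)) *\<^sub>R (f s - (f t + (s - t) *\<^sub>R d))) = norm ((f s - f t) / of_real (s - t) - d)"
        by (simp add: norm_divide flip: of_real_diff)
    qed
  qed
  also have "\<dots> \<longleftrightarrow> ((\<lambda>s. (f s - f t) / of_real (s - t)) \<longlongrightarrow> d) (at t within S)"
    unfolding tendsto_norm_zero_iff by (rule LIM_zero_iff)
  finally show ?thesis .
qed

text \<open>
  Differentiability of \<open>A \<circ> u\<close> passes to \<open>u\<close> where \<open>A\<close> is locally invertible; Caratheodory's form of
  the derivative replaces the inverse function.
\<close>

lemma has_vector_derivative_cancel_holomorphic: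
  fixes u :: "real \<Rightarrow> complex"
  assumes A: "(A has_field_derivative A') (at (u t))" and A': "A' \<noteq> 0"
    and comp: "((\<lambda>s. A (u s)) has_vector_derivative d) (at t within S)"
    and u: "(u \<longlongrightarrow> u t) (at t within S)"
  shows "(u has_vector_derivative (d / A')) (at t within S)"
proof -
  obtain q where q: "\<And>z. A z - A (u t) = q z * (z - u t)" "isCont q (u t)" "q (u t) = A'"
    using A unfolding CARAT_DERIV by blast
  have qlim: "((\<lambda>s. q (u s)) \<longlongrightarrow> A') (at t within S)"
    using isCont_tendsto_compose[OF q(2) u] q(3) by simp
  have lim: "((\<lambda>s. ((A (u s) - A (u t)) / of_real (s - t)) / q (u s)) \<longlongrightarrow> d / A') (at t within S)"
    using comp unfolding has_vector_derivative_iff_quotient by (intro tendsto_divide qlim A')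
  have "\<forall>\<^sub>F s in at t within S. q (u s) \<noteq> 0"
    by (rule tendsto_imp_eventually_ne[OF qlim A'])
  then have "\<forall>\<^sub>F s in at t within S. ((A (u s) - A (u t)) / of_real (s - t)) / q (u s) = (u s - u t) / of_real (s - t)"
    by eventually_elim (simp add: q(1))
  then show ?thesis
    unfolding has_vector_derivative_iff_quotient using lim by (rule Lim_transform_eventually[rotated])
qed

text \<open>
  Cauchy's estimate turns uniform closeness of \<open>f t\<close> and \<open>f t0\<close> on a disc into closeness of their
  derivatives on a smaller disc.
\<close>

lemma continuous_on_deriv_parametric:
  fixes f :: "real \<Rightarrow> complex \<Rightarrow> complex"
  assumes U: "open U" and T: "compact T"
    and hol: "\<And>t. t \<in> T \<Longrightarrow> f t holomorphic_on U"
    and cont: "continuous_on (T \<times> U) (\<lambda>(t, z). f t z)"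
  shows "continuous_on (U \<times> T) (\<lambda>(z, t). deriv (f t) z)"
  unfolding continuous_on_iff
proof (intro ballI allI impI)
  fix x e assume x: "x \<in> U \<times> T" and e: "(e::real) > 0"
  obtain z0 t0 where xz: "x = (z0, t0)" "z0 \<in> U" "t0 \<in> T" using x by auto
  obtain r where r: "r > 0" "cball z0 r \<subseteq> U" using U xz open_contains_cball by blast
  define \<rho> where "\<rho> = r / 2"
  have \<rho>: "\<rho> > 0" using r by (simp add: \<rho>_def)
  have "compact (T \<times> cball z0 r)" by (intro compact_Times T compact_cball)
  moreover have "continuous_on (T \<times> cball z0 r) (\<lambda>(t, z). f t z)"
    by (rule continuous_on_subset[OF cont]) (use r in auto)
  ultimately have "uniformly_continuous_on (T \<times> cball z0 r) (\<lambda>(t, z). f t z)"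
    by (rule compact_uniformly_continuous[rotated])
  then obtain d1 where d1: "d1 > 0" and
    unif: "\<And>x x'. x \<in> T \<times> cball z0 r \<Longrightarrow> x' \<in> T \<times> cball z0 r \<Longrightarrow> dist x' x < d1 \<Longrightarrow>
       dist (case x' of (t, z) \<Rightarrow> f t z) (case x of (t, z) \<Rightarrow> f t z) < e * \<rho> / 2"
    unfolding uniformly_continuous_on_def using e \<rho> by (metis half_gt_zero mult_pos_pos)
  have "continuous_on U (deriv (f t0))"
    using hol xz U by (intro holomorphic_on_imp_continuous_on holomorphic_deriv) auto
  then obtain d2 where d2: "d2 > 0" "\<And>z. z \<in> U \<Longrightarrow> dist z z0 < d2 \<Longrightarrow> dist (deriv (f t0) z) (deriv (f t0) z0) < e / 2"
    using e xz unfolding continuous_on_iff by (metis half_gt_zero)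
  define d where "d = min d1 (min d2 \<rho>)"
  show "\<exists>d>0. \<forall>x'\<in>U \<times> T. dist x' x < d \<longrightarrow> dist (case x' of (z, t) \<Rightarrow> deriv (f t) z) (case x of (z, t) \<Rightarrow> deriv (f t) z) < e"
  proof (intro exI[of _ d] conjI ballI impI)
    show "d > 0" using d1 d2 \<rho> by (simp add: d_def)
    fix x' assume x': "x' \<in> U \<times> T" "dist x' x < d"
    obtain z t where zt: "x' = (z, t)" "z \<in> U" "t \<in> T" using x' by auto
    have dz: "dist z z0 < d" and dt: "dist t t0 < d"
      using x'(2) dist_fst_le[of x' x] dist_snd_le[of x' x] by (auto simp: zt xz)
    have sub: "cball z \<rho> \<subseteq> cball z0 r"
    proof
      fix w assume "w \<in> cball z \<rho>"
      then have "dist z0 w \<le> dist z0 z + dist z w" "dist z w \<le> \<rho>" by (auto intro: dist_triangle)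
      moreover have "dist z0 z < \<rho>" using dz by (simp add: d_def dist_commute)
      ultimately show "w \<in> cball z0 r" by (simp add: \<rho>_def)
    qed
    let ?g = "\<lambda>w. f t w - f t0 w"
    have holt: "f t holomorphic_on U" "f t0 holomorphic_on U" using hol zt xz by auto
    have subU: "cball z \<rho> \<subseteq> U" using sub r by blast
    have "norm ((deriv ^^ 1) ?g z) \<le> fact 1 * (e * \<rho> / 2) / \<rho> ^ 1"
    proof (rule Cauchy_inequality)
      show "?g holomorphic_on ball z \<rho>"
        using subU by (intro holomorphic_intros holomorphic_on_subset[OF holt(1)] holomorphic_on_subset[OF holt(2)]) auto
      show "continuous_on (cball z \<rho>) ?g"
        using subU by (intro continuous_intros holomorphic_on_imp_continuous_on holomorphic_on_subset[OF holt(1)] holomorphic_on_subset[OF holt(2)]) auto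
      fix w assume "norm (z - w) = \<rho>"
      then have "w \<in> cball z0 r" using sub by (auto simp: dist_norm)
      then have "dist (f t w) (f t0 w) < e * \<rho> / 2"
        using unif[of "(t0, w)" "(t, w)"] zt xz dt by (auto simp: dist_Pair_Pair d_def)
      then show "norm (?g w) \<le> e * \<rho> / 2" by (simp add: dist_norm)
    qed (rule \<rho>)
    then have "norm (deriv ?g z) \<le> e / 2" using \<rho> by simp
    moreover have "deriv ?g z = deriv (f t) z - deriv (f t0) z"
      using holt zt U by (intro deriv_diff holomorphic_on_imp_differentiable_at) auto
    ultimately have "dist (deriv (f t) z) (deriv (f t0) z) \<le> e / 2" by (simp add: dist_norm)
    moreover have "dist (deriv (f t0) z) (deriv (f t0) z0) < e / 2"
      using d2(2)[OF zt(2)] dz by (simp add: d_def)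
    ultimately show "dist (case x' of (z, t) \<Rightarrow> deriv (f t) z) (case x of (z, t) \<Rightarrow> deriv (f t) z) < e"
      using dist_triangle[of "deriv (f t) z" "deriv (f t0) z0" "deriv (f t0) z"] by (simp add: zt xz)
  qed
qed

lemma analytic_semigroupD:
  assumes "analytic_semigroup \<phi>"
  shows "t \<ge> 0 \<Longrightarrow> \<phi> t holomorphic_on upper_halfplane"
    and "t \<ge> 0 \<Longrightarrow> Im z > 0 \<Longrightarrow> Im (\<phi> t z) > 0"
    and "Im z > 0 \<Longrightarrow> \<phi> 0 z = z"
    and "t \<ge> 0 \<Longrightarrow> s \<ge> 0 \<Longrightarrow> Im z > 0 \<Longrightarrow> \<phi> (t + s) z = \<phi> t (\<phi> s z)"
    and "continuous_on ({0..} \<times> upper_halfplane) (\<lambda>(t, z). \<phi> t z)"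
  using assms unfolding analytic_semigroup_def by (auto simp: Pi_iff)

lemma semigroup_orbit_continuous:
  assumes S: "analytic_semigroup \<phi>" and z: "Im z > 0"
  shows "continuous_on {0..} (\<lambda>t. \<phi> t z)"
proof -
  have "continuous_on {0..} ((\<lambda>(t, z). \<phi> t z) \<circ> (\<lambda>t. (t, z)))"
    using z by (intro continuous_on_compose continuous_on_subset[OF analytic_semigroupD(5)[OF S]] continuous_intros) auto
  then show ?thesis by (simp add: o_def)
qed

lemma semigroup_orbit_tendsto:
  assumes S: "analytic_semigroup \<phi>" and z: "Im z > 0"
  shows "((\<lambda>t. \<phi> t z) \<longlongrightarrow> z) (at_right 0)"
proof -
  have "((\<lambda>t. \<phi> t z) \<longlongrightarrow> \<phi> 0 z) (at 0 within {0..})"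
    using semigroup_orbit_continuous[OF S z] by (auto simp: continuous_on_def)
  then show ?thesis
    using z by (simp add: analytic_semigroupD(3)[OF S] at_within_Ici_at_right)
qed

lemma continuous_on_semigroup_deriv:
  assumes S: "analytic_semigroup \<phi>"
  shows "continuous_on (upper_halfplane \<times> cbox 0 \<epsilon>) (\<lambda>(z, s). deriv (\<phi> s) z)"
  using analytic_semigroupD(1)[OF S]
  by (intro continuous_on_deriv_parametric[OF open_upper_halfplane])
     (auto intro: continuous_on_subset[OF analytic_semigroupD(5)[OF S]])

definition orbit_integral :: "(real \<Rightarrow> complex \<Rightarrow> complex) \<Rightarrow> real \<Rightarrow> complex \<Rightarrow> complex" where
  "orbit_integral \<phi> \<epsilon> z = integral {0..\<epsilon>} (\<lambda>s. \<phi> s z)"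

lemma orbit_integral_deriv:
  assumes S: "analytic_semigroup \<phi>" and z: "Im z > 0" and \<epsilon>: "\<epsilon> > 0"
  shows "(orbit_integral \<phi> \<epsilon> has_field_derivative integral {0..\<epsilon>} (\<lambda>s. deriv (\<phi> s) z)) (at z)"
    and "continuous_on upper_halfplane (\<lambda>z. integral {0..\<epsilon>} (\<lambda>s. deriv (\<phi> s) z))"
proof -
  note sem = analytic_semigroupD[OF S]
  note cont = continuous_on_semigroup_deriv[OF S, of \<epsilon>]
  have "((\<lambda>z. integral (cbox 0 \<epsilon>) (\<lambda>s. \<phi> s z)) has_field_derivative
      integral (cbox 0 \<epsilon>) (\<lambda>s. deriv (\<phi> s) z)) (at z within upper_halfplane)"
  proof (rule leibniz_rule_field_derivative[OF _ _ cont])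
    fix w s assume "w \<in> upper_halfplane" "s \<in> cbox 0 \<epsilon>"
    then show "(\<phi> s has_field_derivative deriv (\<phi> s) w) (at w within upper_halfplane)"
      using sem(1)[of s] by (intro has_field_derivative_at_within[OF holomorphic_derivI[OF _ open_upper_halfplane]]) auto
  next
    fix w assume "w \<in> upper_halfplane"
    then show "(\<lambda>s. \<phi> s w) integrable_on cbox 0 \<epsilon>"
      using semigroup_orbit_continuous[OF S, of w]
      by (auto intro!: integrable_continuous_interval intro: continuous_on_subset)
  qed (use z convex_upper_halfplane in auto)
  then show "(orbit_integral \<phi> \<epsilon> has_field_derivative integral {0..\<epsilon>} (\<lambda>s. deriv (\<phi> s) z)) (at z)"
    using z unfolding orbit_integral_def[abs_def]
    by (subst (asm) at_within_open[OF _ open_upper_halfplane]) auto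
  show "continuous_on upper_halfplane (\<lambda>z. integral {0..\<epsilon>} (\<lambda>s. deriv (\<phi> s) z))"
    using integral_continuous_on_param[OF cont] by simp
qed

text \<open>
  The derivative of \<open>\<phi> s\<close> tends to \<open>1\<close> as \<open>s\<close> tends to \<open>0\<close>, so the integral is close to \<open>\<epsilon>\<close>.
\<close>

lemma orbit_integral_deriv_nonzero:
  assumes S: "analytic_semigroup \<phi>" and z: "Im z > 0"
  obtains \<epsilon> where "\<epsilon> > 0" "integral {0..\<epsilon>} (\<lambda>s. deriv (\<phi> s) z) \<noteq> 0"
proof -
  note sem = analytic_semigroupD[OF S]
  note cont = continuous_on_semigroup_deriv[OF S, of 1, unfolded cbox_interval]
  have "continuous_on {0..1} ((\<lambda>(z, s). deriv (\<phi> s) z) \<circ> (\<lambda>s. (z, s)))"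
    using z by (intro continuous_on_compose continuous_on_subset[OF cont] continuous_intros) auto
  then have c1: "continuous_on {0..1} (\<lambda>s. deriv (\<phi> s) z)" by (simp add: o_def)
  have "deriv (\<phi> 0) z = deriv (\<lambda>z. z) z"
  proof (rule deriv_cong_ev[OF _ refl])
    show "\<forall>\<^sub>F w in nhds z. \<phi> 0 w = w"
      using eventually_nhds_in_open[OF open_upper_halfplane, of z] z by (auto elim!: eventually_mono intro: sem(3))
  qed
  then have d0: "deriv (\<phi> 0) z = 1" by simp
  obtain d where d: "d > 0" "\<And>s. s \<in> {0..1} \<Longrightarrow> dist s 0 < d \<Longrightarrow> dist (deriv (\<phi> s) z) 1 < 1 / 2"
    using c1 d0 unfolding continuous_on_iff by (metis atLeastAtMost_iff half_gt_zero order_refl zero_less_one zero_le_one)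
  define \<epsilon> where "\<epsilon> = min 1 (d / 2)"
  have \<epsilon>: "\<epsilon> > 0" "\<epsilon> \<le> 1" "\<epsilon> < d" using d by (auto simp: \<epsilon>_def)
  have int: "(\<lambda>s. deriv (\<phi> s) z) integrable_on {0..\<epsilon>}"
    using \<epsilon> by (intro integrable_continuous_interval continuous_on_subset[OF c1]) auto
  have "norm (integral {0..\<epsilon>} (\<lambda>s. deriv (\<phi> s) z - 1)) \<le> integral {0..\<epsilon>} (\<lambda>s. 1 / 2)"
  proof (rule integral_norm_bound_integral)
    fix s assume "s \<in> {0..\<epsilon>}"
    then show "norm (deriv (\<phi> s) z - 1) \<le> 1 / 2"
      using d(2)[of s] \<epsilon> by (auto simp: dist_norm)
  qed (use int in \<open>auto intro!: integrable_diff integrable_const_ivl\<close>)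
  also have "\<dots> = \<epsilon> / 2" using \<epsilon> by simp
  also have "integral {0..\<epsilon>} (\<lambda>s. deriv (\<phi> s) z - 1) = integral {0..\<epsilon>} (\<lambda>s. deriv (\<phi> s) z) - of_real \<epsilon>"
    using \<epsilon> by (subst integral_diff[OF int integrable_const_ivl]) (simp add: scaleR_conv_of_real)
  finally have "norm (integral {0..\<epsilon>} (\<lambda>s. deriv (\<phi> s) z) - of_real \<epsilon>) \<le> \<epsilon> / 2" .
  then have "integral {0..\<epsilon>} (\<lambda>s. deriv (\<phi> s) z) \<noteq> 0" using \<epsilon> by auto
  then show thesis using that \<epsilon> by blast
qed

text \<open>
  By the semigroup law, \<open>orbit_integral \<phi> \<epsilon>\<close> at \<open>\<phi> u z\<close> is the integral of the orbit of \<open>z\<close> over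
  \<open>[u, u + \<epsilon>]\<close>. This is differentiable in \<open>u\<close>, and \<open>orbit_integral \<phi> \<epsilon>\<close> can be cancelled.
\<close>

lemma semigroup_orbit_derivative:
  assumes S: "analytic_semigroup \<phi>" and z: "Im z > 0" and \<epsilon>: "\<epsilon> > 0" and t: "t \<ge> 0"
    and ne: "integral {0..\<epsilon>} (\<lambda>s. deriv (\<phi> s) (\<phi> t z)) \<noteq> 0"
  shows "((\<lambda>t. \<phi> t z) has_vector_derivative
    (\<phi> \<epsilon> (\<phi> t z) - \<phi> t z) / integral {0..\<epsilon>} (\<lambda>s. deriv (\<phi> s) (\<phi> t z))) (at t within {0..})"
proof (rule has_vector_derivative_cancel_holomorphic[where u = "\<lambda>t. \<phi> t z" and A = "orbit_integral \<phi> \<epsilon>", OF _ ne])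
  note sem = analytic_semigroupD[OF S]
  show "(orbit_integral \<phi> \<epsilon> has_field_derivative integral {0..\<epsilon>} (\<lambda>s. deriv (\<phi> s) (\<phi> t z))) (at (\<phi> t z))"
    by (rule orbit_integral_deriv(1)[OF S sem(2)[OF t z] \<epsilon>])
  have cont: "continuous_on {0..} (\<lambda>t. \<phi> t z)" by (rule semigroup_orbit_continuous[OF S z])
  then show "((\<lambda>t. \<phi> t z) \<longlongrightarrow> \<phi> t z) (at t within {0..})"
    using t by (auto simp: continuous_on_def)
  define P where "P u = integral {0..u} (\<lambda>s. \<phi> s z)" for u
  have P: "(P has_vector_derivative \<phi> u z) (at u within {0..})" if "u \<ge> 0" for u
  proof -
    have "((\<lambda>u. integral {0..u} (\<lambda>s. \<phi> s z)) has_vector_derivative \<phi> u z) (at u within {0..u + 1})"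
      using that by (intro integral_has_vector_derivative continuous_on_subset[OF cont]) auto
    moreover have "at u within {0..u + 1} = at u within {0..}"
    proof (rule at_within_nhd)
      show "u \<in> {..<u + 1}" "open {..<u + 1}" by auto
    qed auto
    ultimately show ?thesis by (simp add: P_def[abs_def])
  qed
  have eq: "orbit_integral \<phi> \<epsilon> (\<phi> u z) = P (\<epsilon> + u) - P u" if u: "u \<ge> 0" for u
  proof -
    have "orbit_integral \<phi> \<epsilon> (\<phi> u z) = integral {0..\<epsilon>} (\<lambda>s. \<phi> (s + u) z)"
      unfolding orbit_integral_def using u z by (intro integral_cong) (auto simp: sem(4))
    also have "\<dots> = integral {u..\<epsilon> + u} (\<lambda>s. \<phi> s z)"
    proof -
      have "(\<lambda>s. \<phi> s z) integrable_on {u..\<epsilon> + u}"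
        using u by (intro integrable_continuous_interval continuous_on_subset[OF cont]) auto
      from has_integral_shift_real_ivl[OF integrable_integral[OF this], of u] show ?thesis
        by (simp add: integral_unique)
    qed
    also have "\<dots> = P (\<epsilon> + u) - P u"
    proof -
      have "integral {0..u} (\<lambda>s. \<phi> s z) + integral {u..\<epsilon> + u} (\<lambda>s. \<phi> s z) = integral {0..\<epsilon> + u} (\<lambda>s. \<phi> s z)"
        using u \<epsilon> by (intro Henstock_Kurzweil_Integration.integral_combine integrable_continuous_interval continuous_on_subset[OF cont]) auto
      then show ?thesis unfolding P_def by (simp add: algebra_simps)
    qed
    finally show ?thesis .
  qed
  have "((\<lambda>u. P (\<epsilon> + u) - P u) has_vector_derivative (\<phi> (\<epsilon> + t) z - \<phi> t z)) (at t within {0..})"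
  proof (rule has_vector_derivative_diff[OF _ P[OF t]])
    have "((\<lambda>u. \<epsilon> + u) has_vector_derivative 1) (at t within {0..})"
      by (auto intro!: derivative_eq_intros)
    moreover have "(P has_vector_derivative \<phi> (\<epsilon> + t) z) (at (\<epsilon> + t) within (\<lambda>u. \<epsilon> + u) ` {0..})"
      by (rule has_vector_derivative_within_subset[OF P]) (use \<epsilon> t in auto)
    ultimately have "(P \<circ> (\<lambda>u. \<epsilon> + u) has_vector_derivative 1 *\<^sub>R \<phi> (\<epsilon> + t) z) (at t within {0..})"
      by (intro vector_diff_chain_within) auto
    then show "((\<lambda>u. P (\<epsilon> + u)) has_vector_derivative \<phi> (\<epsilon> + t) z) (at t within {0..})"
      by (simp add: o_def)
  qed
  then show "((\<lambda>s. orbit_integral \<phi> \<epsilon> (\<phi> s z)) has_vector_derivative \<phi> \<epsilon> (\<phi> t z) - \<phi> t z) (at t within {0..})"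
    using sem(4)[of \<epsilon> t z] \<epsilon> t z
    by (subst has_vector_derivative_cong_ev[where g = "\<lambda>u. P (\<epsilon> + u) - P u"]) (auto intro!: always_eventually simp: eq)
qed

text \<open>
  The formula for the derivative at time \<open>t\<close> depends on \<open>t\<close> only through \<open>\<phi> t z\<close>, and with a fixed
  \<open>\<epsilon>\<close> it is continuous in this point. Therefore the limit that defines the generator exists and
  equals the derivative at \<open>0\<close>.
\<close>

proposition semigroup_generator_ODE:
  assumes S: "analytic_semigroup \<phi>"
    and z: "Im z > 0" and t: "t \<ge> 0"
  shows "((\<lambda>t. \<phi> t z) has_vector_derivative semigroup_generator \<phi> (\<phi> t z)) (at t within {0..})"
proof -
  note sem = analytic_semigroupD[OF S]
  define g where "g w = vector_derivative (\<lambda>t. \<phi> t w) (at 0 within {0..})" for w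
  let ?A' = "\<lambda>\<epsilon> w. integral {0..\<epsilon>} (\<lambda>s. deriv (\<phi> s) w)"
  have g_eq: "g w = (\<phi> \<epsilon> w - w) / ?A' \<epsilon> w" if w: "Im w > 0" and \<epsilon>: "\<epsilon> > 0" "?A' \<epsilon> w \<noteq> 0" for w \<epsilon>
  proof -
    have "at 0 within {0::real..} \<noteq> bot"
      using trivial_limit_at_right_real[of 0] at_within_Ici_at_right[of "0::real"] by simp
    moreover have "((\<lambda>t. \<phi> t w) has_vector_derivative (\<phi> \<epsilon> w - w) / ?A' \<epsilon> w) (at 0 within {0..})"
      using semigroup_orbit_derivative[OF S w \<epsilon>(1), of 0] \<epsilon>(2) w by (simp add: sem(3))
    ultimately show ?thesis unfolding g_def by (rule vector_derivative_within)
  qed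
  have ode: "((\<lambda>t. \<phi> t z) has_vector_derivative g (\<phi> t z)) (at t within {0..})" if z: "Im z > 0" and t: "t \<ge> 0" for z t
  proof -
    have w: "Im (\<phi> t z) > 0" by (rule sem(2)[OF t z])
    obtain \<epsilon> where \<epsilon>: "\<epsilon> > 0" "?A' \<epsilon> (\<phi> t z) \<noteq> 0" using orbit_integral_deriv_nonzero[OF S w] .
    show ?thesis
      using semigroup_orbit_derivative[OF S z \<epsilon>(1) t \<epsilon>(2)] unfolding g_eq[OF w \<epsilon>] .
  qed
  have contg: "continuous_on upper_halfplane g"
    unfolding continuous_on_eq_continuous_at[OF open_upper_halfplane]
  proof
    fix w assume "w \<in> upper_halfplane"
    then have w: "Im w > 0" by simp
    obtain \<epsilon> where \<epsilon>: "\<epsilon> > 0" "?A' \<epsilon> w \<noteq> 0" using orbit_integral_deriv_nonzero[OF S w] .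
    have cA: "isCont (?A' \<epsilon>) w"
      using orbit_integral_deriv(2)[OF S w \<epsilon>(1)] w open_upper_halfplane by (simp add: continuous_on_eq_continuous_at)
    have cphi: "isCont (\<phi> \<epsilon>) w"
      using holomorphic_on_imp_continuous_on[OF sem(1)[of \<epsilon>]] w \<epsilon> open_upper_halfplane by (simp add: continuous_on_eq_continuous_at)
    have "\<forall>\<^sub>F u in at w. ?A' \<epsilon> u \<noteq> 0"
      by (rule tendsto_imp_eventually_ne[OF cA[unfolded isCont_def] \<epsilon>(2)])
    moreover have "\<forall>\<^sub>F u in at w. u \<in> upper_halfplane"
      using w by (intro eventually_at_in_open' open_upper_halfplane) simp
    ultimately have "\<forall>\<^sub>F u in at w. (\<phi> \<epsilon> u - u) / ?A' \<epsilon> u = g u"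
      by eventually_elim (use g_eq \<epsilon> in auto)
    moreover have "((\<lambda>u. (\<phi> \<epsilon> u - u) / ?A' \<epsilon> u) \<longlongrightarrow> (\<phi> \<epsilon> w - w) / ?A' \<epsilon> w) (at w)"
      using cA cphi \<epsilon>(2) unfolding isCont_def by (intro tendsto_intros)
    ultimately show "isCont g w"
      unfolding isCont_def g_eq[OF w \<epsilon>] by (rule Lim_transform_eventually[rotated])
  qed
  have gen: "semigroup_generator \<phi> z = g z" if z: "Im z > 0" for z
  proof -
    note semigroup_orbit_tendsto[OF S z]
    then have "((\<lambda>t. g (\<phi> t z)) \<longlongrightarrow> g z) (at_right 0)"
      using contg z open_upper_halfplane by (intro isCont_tendsto_compose[of z g]) (auto simp: continuous_on_eq_continuous_at)
    moreover have "\<forall>\<^sub>F t in at_right 0. g (\<phi> t z) = vector_derivative (\<lambda>s. \<phi> s z) (at t)"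
    proof -
      have "g (\<phi> t z) = vector_derivative (\<lambda>s. \<phi> s z) (at t)" if t: "t > 0" for t
      proof -
        have "at t within {0..} = at t" using t by (intro at_within_interior) simp
        then have "((\<lambda>s. \<phi> s z) has_vector_derivative g (\<phi> t z)) (at t)" using ode[OF z, of t] t by simp
        then show ?thesis by (simp add: vector_derivative_at)
      qed
      then show ?thesis by (auto simp: eventually_at_right_field intro: exI[of _ 1])
    qed
    ultimately have "((\<lambda>t. vector_derivative (\<lambda>s. \<phi> s z) (at t)) \<longlongrightarrow> g z) (at_right 0)"
      by (rule Lim_transform_eventually)
    then show ?thesis
      unfolding semigroup_generator_def by (intro tendsto_Lim) auto
  qed
  show ?thesis
    using ode[OF z t] gen[OF sem(2)[OF t z]] by simp
qed

section \<open>The semigroup of composition operators\<close>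

text \<open>
  The set of times with \<open>k \<le> dilation_at_infinity (\<phi> t)\<close> is cut out by the inequalities
  \<open>k Im z \<le> Im (\<phi> t z)\<close>, each of them closed in \<open>t\<close>.
\<close>

lemma semigroup_dilation:
  assumes S: "analytic_semigroup \<phi>" and p: "p \<ge> 1"
    and bd: "\<forall>t\<ge>0. Hardy_bounded_op p (composition_op \<phi> t)"
  shows "t \<ge> 0 \<Longrightarrow> dilation_at_infinity (\<phi> t) > 0"
    and "t \<ge> 0 \<Longrightarrow> Im z > 0 \<Longrightarrow> dilation_at_infinity (\<phi> t) * Im z \<le> Im (\<phi> t z)"
    and "0 < k \<Longrightarrow> k < 1 \<Longrightarrow> \<forall>\<^sub>F t in at_right 0. k \<le> dilation_at_infinity (\<phi> t)"
proof -
  note sem = analytic_semigroupD[OF S]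
  have ex: "\<exists>c>0. \<forall>z. Im z > 0 \<longrightarrow> c * Im z \<le> Im (\<phi> t z)" if t: "t \<ge> 0" for t
  proof (rule bounded_composition_imp_Im_ge[OF p])
    show "\<phi> t \<in> upper_halfplane \<rightarrow> upper_halfplane" using sem(2)[OF t] by auto
    show "Hardy_bounded_op p (\<lambda>f. f \<circ> \<phi> t)"
      using bd t unfolding composition_op_def[abs_def] by blast
  qed
  then obtain l where l: "\<And>t. t \<ge> 0 \<Longrightarrow> l t > 0"
    "\<And>t z. t \<ge> 0 \<Longrightarrow> Im z > 0 \<Longrightarrow> l t * Im z \<le> Im (\<phi> t z)"
    by metis
  let ?c = "\<lambda>t. dilation_at_infinity (\<phi> t)"
  have pos: "?c t > 0" if "t \<ge> 0" for t
    using dilation_at_infinity(1)[of "l t" "\<phi> t"] l that by force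
  then show "t \<ge> 0 \<Longrightarrow> ?c t > 0" .
  have low: "?c t * Im z \<le> Im (\<phi> t z)" if "t \<ge> 0" "Im z > 0" for t z
    by (rule dilation_at_infinity(2)[of "l t"]) (use l that in auto)
  then show "t \<ge> 0 \<Longrightarrow> Im z > 0 \<Longrightarrow> ?c t * Im z \<le> Im (\<phi> t z)" .
  show "\<forall>\<^sub>F t in at_right 0. k \<le> ?c t" if "0 < k" "k < 1"
  proof (rule multiplicative_function_near_zero[OF pos _ _ that])
    fix s t :: real assume s: "s \<ge> 0" and t: "t \<ge> 0"
    have "?c (s + t) = dilation_at_infinity (\<phi> s \<circ> \<phi> t)"
      unfolding dilation_at_infinity_def using sem(4)[OF s t] by (intro INF_cong) auto
    also have "\<dots> = ?c s * ?c t"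
      by (rule dilation_at_infinity_compose[OF sem(1)[OF s] l(1)[OF s] l(2)[OF s] sem(1)[OF t] l(1)[OF t] l(2)[OF t]])
    finally show "?c (s + t) = ?c s * ?c t" .
  next
    fix k :: real
    have iff: "k \<le> ?c t \<longleftrightarrow> (\<forall>z\<in>upper_halfplane. k * Im z \<le> Im (\<phi> t z))" if t: "t \<ge> 0" for t
    proof
      assume k: "k \<le> ?c t"
      show "\<forall>z\<in>upper_halfplane. k * Im z \<le> Im (\<phi> t z)"
      proof
        fix z assume "z \<in> upper_halfplane"
        then show "k * Im z \<le> Im (\<phi> t z)"
          using order_trans[OF mult_right_mono[OF k] low[OF t]] by simp
      qed
    qed (auto intro!: dilation_at_infinity(1))
    have "{t \<in> {0..1}. k \<le> ?c t} = (\<Inter>z\<in>upper_halfplane. {t \<in> {0..1}. k * Im z \<le> Im (\<phi> t z)})"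
    proof -
      have "\<i> \<in> upper_halfplane" by simp
      then show ?thesis using iff by (auto simp del: mem_upper_halfplane)
    qed
    also have "closed \<dots>"
    proof (intro closed_INT ballI)
      fix z assume z: "z \<in> upper_halfplane"
      show "closed {t \<in> {0..1}. k * Im z \<le> Im (\<phi> t z)}"
        using z by (intro continuous_on_closed_Collect_le continuous_intros
            continuous_on_subset[OF semigroup_orbit_continuous[OF S]]) auto
    qed
    finally show "closed {t \<in> {0..1}. k \<le> ?c t}" .
  qed
qed

lemma composition_op_Hardy:
  assumes "\<forall>t\<ge>0. Hardy_bounded_op p (composition_op \<phi> t)" "t \<ge> 0" "f \<in> Hardy_space p"
  shows "composition_op \<phi> t f \<in> Hardy_space p"
  using assms unfolding Hardy_bounded_op_def by blast

proposition composition_semigroup_strongly_continuous: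
  assumes S: "analytic_semigroup \<phi>" and p: "p \<ge> 1"
    and bd: "\<forall>t\<ge>0. Hardy_bounded_op p (composition_op \<phi> t)"
  shows "Hardy_strongly_continuous p (composition_op \<phi>)"
  unfolding Hardy_strongly_continuous_def tendsto_at_iff_sequentially
proof (intro ballI allI impI)
  fix f and X :: "nat \<Rightarrow> real"
  assume f: "f \<in> Hardy_space p" and X: "\<forall>i. X i \<in> {0<..} - {0}" "X \<longlonglongrightarrow> 0"
  note sem = analytic_semigroupD[OF S]
  note dil = semigroup_dilation[OF S p bd]
  have p0: "p > 0" using p by simp
  have X0: "X n > 0" for n using X(1) by auto
  have "X n \<noteq> 0" for n using X0[of n] by simp
  then have Xlim: "filterlim X (at_right 0) sequentially"
    using X X0 by (simp add: filterlim_at)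
  let ?N = "Hardy_norm p f powr p"
  have "(\<lambda>n. Hardy_norm p (\<lambda>z. composition_op \<phi> (X n) f z - f z)) \<longlonglongrightarrow> 0"
  proof (rule Hardy_Kadec_Klee[OF f _ p])
    show "composition_op \<phi> (X n) f \<in> Hardy_space p" for n
      by (rule composition_op_Hardy[OF bd _ f]) (use X0 in \<open>auto simp: less_imp_le\<close>)
    show "(\<lambda>n. composition_op \<phi> (X n) f z) \<longlonglongrightarrow> f z" if z: "Im z > 0" for z
    proof -
      have "isCont f z"
        using holomorphic_on_imp_continuous_on[OF Hardy_space_holomorphic[OF f]] z open_upper_halfplane
        by (simp add: continuous_on_eq_continuous_at)
      then show ?thesis
        unfolding composition_op_def o_def
        by (rule isCont_tendsto_compose) (rule filterlim_compose[OF semigroup_orbit_tendsto[OF S z] Xlim])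
    qed
  next
    fix e :: real assume e: "e > 0"
    \<comment> \<open>\<open>k < 1\<close> is chosen such that \<open>?N / k \<le> ?N + e\<close>; the summand \<open>1\<close> keeps
      \<open>k\<close> positive\<close>
    define k where "k = (?N + 1) / (?N + 1 + e)"
    have N: "?N \<ge> 0" by simp
    have k: "0 < k" "k < 1" using e N by (auto simp: k_def add_nonneg_pos pos_divide_less_eq)
    have Nk: "?N / k \<le> ?N + e"
    proof -
      have "?N * (?N + 1 + e) \<le> (?N + e) * (?N + 1)" using e by (simp add: algebra_simps)
      then show ?thesis using N e by (simp add: k_def pos_divide_le_eq add_nonneg_pos)
    qed
    have "\<forall>\<^sub>F n in sequentially. k \<le> dilation_at_infinity (\<phi> (X n))"
      by (rule filterlim_iff[THEN iffD1, OF Xlim, rule_format]) (rule dil(3)[OF k])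
    then show "\<forall>\<^sub>F n in sequentially. Hardy_norm p (composition_op \<phi> (X n) f) powr p \<le> ?N + e"
    proof eventually_elim
      case (elim n)
      have t: "X n \<ge> 0" using X0[of n] by simp
      let ?c = "dilation_at_infinity (\<phi> (X n))"
      have "Hardy_norm p (f \<circ> \<phi> (X n)) powr p \<le> ?N / ?c"
      proof (rule Hardy_norm_powr_le[OF _ p0])
        show "f \<circ> \<phi> (X n) holomorphic_on upper_halfplane"
          by (rule holomorphic_on_compose_gen[OF sem(1)[OF t] Hardy_space_holomorphic[OF f]]) (use sem(2)[OF t] in auto)
        show "level_integral p (f \<circ> \<phi> (X n)) y \<le> ennreal (?N / ?c)" if "y > 0" for y
          by (rule level_integral_subordination[OF Hardy_space_holomorphic[OF f] p0 N Hardy_level_le[OF f p0]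
                sem(1)[OF t] dil(1)[OF t] dil(2)[OF t] that])
      qed (use dil(1)[OF t] in simp)
      also have "\<dots> \<le> ?N / k" using elim k N dil(1)[OF t] by (intro divide_left_mono mult_pos_pos) auto
      also note Nk
      finally show ?case unfolding composition_op_def .
    qed
  qed
  then show "((\<lambda>t. Hardy_norm p (\<lambda>z. composition_op \<phi> t f z - f z)) \<circ> X) \<longlonglongrightarrow> 0"
    by (simp add: o_def)
qed

text \<open>
  Jensen's inequality, from the tangent of \<open>x \<mapsto> x powr p\<close> at the mean of \<open>norm (k s)\<close>.
\<close>

lemma Jensen_powr_unit_interval:
  fixes k :: "real \<Rightarrow> complex"
  assumes p: "p \<ge> 1" and k: "continuous_on UNIV k"
  shows "norm (integral {0..1} k) powr p \<le> integral {0..1} (\<lambda>s. norm (k s) powr p)"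
proof -
  have ck: "continuous_on {0..1} k" by (rule continuous_on_subset[OF k]) simp
  have in1: "(\<lambda>s. norm (k s)) integrable_on {0..1}"
    by (intro integrable_continuous_interval continuous_intros ck)
  have in2: "(\<lambda>s. norm (k s) powr p) integrable_on {0..1}"
    using p by (intro integrable_continuous_interval continuous_on_powr' continuous_on_norm continuous_on_const ck) auto
  define m where "m = integral {0..1} (\<lambda>s. norm (k s))"
  have m0: "m \<ge> 0" unfolding m_def by (intro Henstock_Kurzweil_Integration.integral_nonneg in1) auto
  have nm: "norm (integral {0..1} k) \<le> m"
    unfolding m_def by (rule integral_norm_bound_integral[OF integrable_continuous_interval[OF ck] in1]) auto
  have "m powr p \<le> integral {0..1} (\<lambda>s. norm (k s) powr p)"
  proof (cases "m = 0")
    case True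
    then show ?thesis
      by (simp add: Henstock_Kurzweil_Integration.integral_nonneg in2)
  next
    case False
    then have m: "m > 0" using m0 by simp
    define d where "d = p * m powr (p - 1)"
    have tangent: "m powr p + d * (x - m) \<le> x powr p" if x: "x \<ge> 0" for x
    proof (cases "x = 0")
      case True
      have "d * m = p * m powr p" using m powr_add[of m "p - 1" 1] by (simp add: d_def)
      moreover have "1 * m powr p \<le> p * m powr p" using p by (intro mult_right_mono) auto
      ultimately show ?thesis using True by (simp add: algebra_simps)
    next
      case False
      have "x powr p - m powr p \<ge> d * (x - m)"
      proof (rule convex_on_imp_above_tangent[where A = "{0<..}"])
        show "((\<lambda>x. x powr p) has_field_derivative d) (at m within {0<..})"
          unfolding d_def by (rule has_field_derivative_at_within[OF has_real_derivative_powr[OF m]])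
      qed (use m x False p powr_convex in \<open>auto simp: interior_open\<close>)
      then show ?thesis by simp
    qed
    have "integral {0..1} (\<lambda>s. m powr p + d * (norm (k s) - m)) = m powr p + d * (m - m)"
    proof (rule integral_unique)
      have c: "((\<lambda>s::real. c) has_integral c) {0..1}" for c :: real
        using has_integral_const_real[of c 0 1] by simp
      have "((\<lambda>s. norm (k s)) has_integral m) {0..1}"
        unfolding m_def by (rule integrable_integral[OF in1])
      then show "((\<lambda>s. m powr p + d * (norm (k s) - m)) has_integral m powr p + d * (m - m)) {0..1}"
        by (intro has_integral_add has_integral_mult_right has_integral_diff c)
    qed
    then have "m powr p = integral {0..1} (\<lambda>s. m powr p + d * (norm (k s) - m))" by simp
    also have "\<dots> \<le> integral {0..1} (\<lambda>s. norm (k s) powr p)"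
    proof (rule integral_le[OF _ in2])
      show "(\<lambda>s. m powr p + d * (norm (k s) - m)) integrable_on {0..1}"
        by (intro integrable_continuous_interval continuous_intros ck)
    qed (use tangent in auto)
    finally show ?thesis .
  qed
  moreover have "norm (integral {0..1} k) powr p \<le> m powr p"
    using nm p by (intro powr_mono2) auto
  ultimately show ?thesis by linarith
qed

lemma difference_quotient_integral:
  assumes S: "analytic_semigroup \<phi>" and f: "f holomorphic_on upper_halfplane" and z: "Im z > 0" and t: "t > 0"
  shows "((\<lambda>s. semigroup_generator \<phi> (\<phi> (t * s) z) * deriv f (\<phi> (t * s) z)) has_integral
     (f (\<phi> t z) - f z) / of_real t) {0..1}"
proof -
  note sem = analytic_semigroupD[OF S]
  let ?h = "\<lambda>z. semigroup_generator \<phi> z * deriv f z"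
  have "((\<lambda>s. t *\<^sub>R ?h (\<phi> (t * s) z)) has_integral (f (\<phi> (t * 1) z) - f (\<phi> (t * 0) z))) {0..1}"
  proof (rule fundamental_theorem_of_calculus)
    fix s :: real assume s: "s \<in> {0..1}"
    have ts: "t * s \<ge> 0" using s t by simp
    have "((\<lambda>s. t * s) has_vector_derivative t) (at s within {0..1})"
      by (auto intro!: derivative_eq_intros)
    moreover have "((\<lambda>u. \<phi> u z) has_vector_derivative semigroup_generator \<phi> (\<phi> (t * s) z)) (at (t * s) within (\<lambda>s. t * s) ` {0..1})"
      by (rule has_vector_derivative_within_subset[OF semigroup_generator_ODE[OF S z ts]]) (use t in auto)
    ultimately have d: "((\<lambda>u. \<phi> u z) \<circ> (\<lambda>s. t * s) has_vector_derivative t *\<^sub>R semigroup_generator \<phi> (\<phi> (t * s) z)) (at s within {0..1})"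
      by (rule vector_diff_chain_within)
    have "(f has_field_derivative deriv f (\<phi> (t * s) z)) (at (\<phi> (t * s) z))"
      using sem(2)[OF ts z] by (intro holomorphic_derivI[OF f open_upper_halfplane]) simp
    then have "(f has_field_derivative deriv f (\<phi> (t * s) z)) (at (((\<lambda>u. \<phi> u z) \<circ> (\<lambda>s. t * s)) s) within ((\<lambda>u. \<phi> u z) \<circ> (\<lambda>s. t * s)) ` {0..1})"
      by (simp add: has_field_derivative_at_within)
    from field_vector_diff_chain_within[OF d this]
    show "((\<lambda>s. f (\<phi> (t * s) z)) has_vector_derivative t *\<^sub>R ?h (\<phi> (t * s) z)) (at s within {0..1})"
      by (simp add: o_def)
  qed simp
  then have "((\<lambda>s. (1 / t) *\<^sub>R (t *\<^sub>R ?h (\<phi> (t * s) z))) has_integral (1 / t) *\<^sub>R (f (\<phi> t z) - f z)) {0..1}"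
    using z by (intro has_integral_cmul) (simp add: sem(3))
  moreover have "(1 / t) *\<^sub>R (t *\<^sub>R w) = w" "(1 / t) *\<^sub>R w = w / of_real t" for w :: complex
    using t by (simp_all add: scaleR_conv_of_real divide_inverse)
  ultimately show ?thesis by (simp only:)
qed

text \<open>
  By \<open>difference_quotient_integral\<close> the error of the difference quotient is a mean of \<open>T s h - h\<close> over
  times \<open>s \<le> t\<close>. Jensen's inequality on each line and Fubini's theorem bound its norm by the largest of
  the norms of these functions.
\<close>

lemma has_generator_limit_of_product:
  assumes S: "analytic_semigroup \<phi>" and p: "p \<ge> 1"
    and bd: "\<forall>t\<ge>0. Hardy_bounded_op p (composition_op \<phi> t)"
    and f: "f \<in> Hardy_space p" and h: "(\<lambda>z. semigroup_generator \<phi> z * deriv f z) \<in> Hardy_space p"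
  shows "has_generator_limit p (composition_op \<phi>) f (\<lambda>z. semigroup_generator \<phi> z * deriv f z)"
proof -
  note sem = analytic_semigroupD[OF S]
  let ?h = "\<lambda>z. semigroup_generator \<phi> z * deriv f z"
  let ?T = "composition_op \<phi>"
  have p0: "p > 0" using p by simp
  note holh = Hardy_space_holomorphic[OF h] and holf = Hardy_space_holomorphic[OF f]
  let ?q = "\<lambda>t z. (?T t f z - f z) / of_real t - ?h z"
  have Tf: "?T t f \<in> Hardy_space p" if "t > 0" for t
    by (rule composition_op_Hardy[OF bd _ f]) (use that in auto)
  have Th: "(\<lambda>z. ?T t ?h z - ?h z) \<in> Hardy_space p" if "t \<ge> 0" for t
    by (rule Hardy_space_diff[OF composition_op_Hardy[OF bd that h] h p0])
  have qH: "?q t \<in> Hardy_space p" if "t > 0" for t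
    using Hardy_space_diff[OF Hardy_space_cmult[OF Hardy_space_diff[OF Tf[OF that] f p0] p0, of "1 / of_real t"] h p0]
    by simp
  have level: "level_integral p (?q t) y \<le> ennreal \<eta>"
    if t: "t > 0" and y: "y > 0" and \<eta>: "\<eta> \<ge> 0"
      and le: "\<And>s. 0 < s \<Longrightarrow> s \<le> t \<Longrightarrow> Hardy_norm p (\<lambda>z. ?T s ?h z - ?h z) powr p \<le> \<eta>" for t y \<eta>
  proof -
    \<comment> \<open>the absolute value extends the integrand continuously to all real \<open>s\<close>\<close>
    let ?k = "\<lambda>x s. ?h (\<phi> (t * \<bar>s\<bar>) (Complex x y)) - ?h (Complex x y)"
    have cont: "continuous_on UNIV (\<lambda>u. ?k (fst u) (snd u))"
    proof -
      have "continuous_on UNIV (\<lambda>u::real \<times> real. (case (t * \<bar>snd u\<bar>, Complex (fst u) y) of (t, z) \<Rightarrow> \<phi> t z))"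
        by (rule continuous_on_compose2[OF sem(5)]) (use t y in \<open>auto intro!: continuous_intros\<close>)
      then have "continuous_on UNIV (\<lambda>u. \<phi> (t * \<bar>snd u\<bar>) (Complex (fst u) y))" by simp
      then have "continuous_on UNIV (\<lambda>u. ?h (\<phi> (t * \<bar>snd u\<bar>) (Complex (fst u) y)))"
        by (intro continuous_on_compose2[OF holomorphic_on_imp_continuous_on[OF holh]]) (use t y sem(2) in auto)
      moreover have "continuous_on UNIV (\<lambda>u::real \<times> real. ?h (Complex (fst u) y))"
        by (rule continuous_on_compose2[OF holomorphic_on_imp_continuous_on[OF holh]]) (use y in \<open>auto intro!: continuous_intros\<close>)
      ultimately show ?thesis by (intro continuous_on_diff)
    qed
    have contx: "continuous_on UNIV (?k x)" for x
      using continuous_on_compose2[OF cont, of UNIV "\<lambda>s. (x, s)"] by (simp add: continuous_intros)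
    have pt: "ennreal (norm (?q t (Complex x y)) powr p) \<le>
        (\<integral>\<^sup>+s. ennreal (norm (?k x s) powr p) * indicator {0..1} s \<partial>lborel)" for x
    proof -
      let ?z = "Complex x y"
      have "((\<lambda>s. ?h (\<phi> (t * s) ?z) - ?h ?z) has_integral ((f (\<phi> t ?z) - f ?z) / of_real t - ?h ?z)) {0..1}"
        using has_integral_diff[OF difference_quotient_integral[OF S holf _ t, of ?z] has_integral_const_real[of "?h ?z" 0 1]] y
        by simp
      then have "(?k x has_integral ((f (\<phi> t ?z) - f ?z) / of_real t - ?h ?z)) {0..1}"
        by (rule has_integral_eq[rotated]) auto
      then have "?q t ?z = integral {0..1} (?k x)"
        unfolding composition_op_def o_def by (rule integral_unique[symmetric])
      then have "norm (?q t ?z) powr p \<le> integral {0..1} (\<lambda>s. norm (?k x s) powr p)"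
        using Jensen_powr_unit_interval[OF p contx] by simp
      then have "ennreal (norm (?q t ?z) powr p) \<le> ennreal (integral {0..1} (\<lambda>s. norm (?k x s) powr p))"
        by (rule ennreal_leI)
      also have "\<dots> = (\<integral>\<^sup>+s. ennreal (norm (?k x s) powr p) * indicator {0..1} s \<partial>lborel)"
        using p by (intro nn_integral_unit_interval[symmetric] continuous_on_powr' continuous_on_norm contx continuous_on_const) auto
      finally show ?thesis .
    qed
    have "level_integral p (?q t) y \<le> (\<integral>\<^sup>+x. (\<integral>\<^sup>+s. ennreal (norm (?k x s) powr p) * indicator {0..1} s \<partial>lborel) \<partial>lborel)"
      unfolding level_integral_def by (intro nn_integral_mono pt)
    also have "\<dots> = (\<integral>\<^sup>+s. (\<integral>\<^sup>+x. ennreal (norm (?k x s) powr p) * indicator {0..1} s \<partial>lborel) \<partial>lborel)"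
    proof (rule nn_integral_lborel_swap)
      have "continuous_on UNIV (\<lambda>u. ?k (snd u) (fst u))"
        using continuous_on_compose2[OF cont, of UNIV "\<lambda>u. (snd u, fst u)"] by (simp add: continuous_intros)
      then have [measurable]: "(\<lambda>u. ?k (snd u) (fst u)) \<in> borel_measurable borel"
        by (rule borel_measurable_continuous_onI)
      have [measurable]: "(\<lambda>u::real \<times> real. indicator {0..1} (fst u) :: ennreal) \<in> borel_measurable borel"
        by (rule measurable_compose[OF borel_measurable_continuous_onI[OF continuous_on_fst[OF continuous_on_id]]]) auto
      show "(\<lambda>(s, x). ennreal (norm (?k x s) powr p) * indicator {0..1} s) \<in> borel_measurable borel"
        unfolding case_prod_unfold by measurable
    qed
    also have "\<dots> \<le> (\<integral>\<^sup>+s. ennreal \<eta> * indicator {0..1::real} s \<partial>lborel)"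
    proof (rule nn_integral_mono)
      fix s :: real
      have "(\<integral>\<^sup>+x. ennreal (norm (?k x s) powr p) \<partial>lborel) \<le> ennreal \<eta>" if s: "s \<in> {0..1}"
      proof (cases "s = 0")
        case True
        then show ?thesis using y p0 by (simp add: sem(3))
      next
        case False
        then have s0: "t * s > 0" "t * s \<le> t" "\<bar>s\<bar> = s" using s t by (auto simp: mult_le_cancel_left1)
        have "(\<integral>\<^sup>+x. ennreal (norm (?k x s) powr p) \<partial>lborel) = level_integral p (\<lambda>z. ?T (t * s) ?h z - ?h z) y"
          by (simp add: level_integral_def composition_op_def s0)
        also have "\<dots> \<le> ennreal (Hardy_norm p (\<lambda>z. ?T (t * s) ?h z - ?h z) powr p)"
          by (rule Hardy_level_le[OF Th p0 y]) (use s0 in simp)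
        also have "\<dots> \<le> ennreal \<eta>" by (intro ennreal_leI le s0)
        finally show ?thesis .
      qed
      then show "(\<integral>\<^sup>+x. ennreal (norm (?k x s) powr p) * indicator {0..1} s \<partial>lborel) \<le> ennreal \<eta> * indicator {0..1} s"
        by (cases "s \<in> {0..1}") auto
    qed
    also have "\<dots> = ennreal \<eta>" by (subst nn_integral_cmult_indicator) auto
    finally show ?thesis .
  qed
  have sc: "((\<lambda>t. Hardy_norm p (\<lambda>z. ?T t ?h z - ?h z)) \<longlongrightarrow> 0) (at_right 0)"
    using composition_semigroup_strongly_continuous[OF S p bd] h unfolding Hardy_strongly_continuous_def by blast
  have "((\<lambda>t. Hardy_norm p (?q t)) \<longlongrightarrow> 0) (at_right 0)"
  proof (rule tendstoI)
    fix e :: real assume e: "e > 0"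
    have "\<forall>\<^sub>F t in at_right 0. dist (Hardy_norm p (\<lambda>z. ?T t ?h z - ?h z)) 0 < e / 2"
      using tendstoD[OF sc, of "e / 2"] e by simp
    then obtain b where b: "b > 0" "\<And>t. 0 < t \<Longrightarrow> t < b \<Longrightarrow> dist (Hardy_norm p (\<lambda>z. ?T t ?h z - ?h z)) 0 < e / 2"
      unfolding eventually_at_right_field by auto
    have "dist (Hardy_norm p (?q t)) 0 < e" if t: "0 < t" "t < b" for t
    proof -
      have "Hardy_norm p (?q t) \<le> ((e / 2) powr p) powr (1 / p)"
      proof (rule Hardy_spaceI(2)[OF Hardy_space_holomorphic[OF qH[OF t(1)]] p0 _ level[OF t(1)]])
        fix s assume s: "0 < s" "s \<le> t"
        show "Hardy_norm p (\<lambda>z. ?T s ?h z - ?h z) powr p \<le> (e / 2) powr p"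
          using b(2)[of s] s t p0 Hardy_norm_nonneg[OF Th[of s]] by (intro powr_mono2) auto
      qed auto
      also have "\<dots> = e / 2" using e p0 by (simp add: powr_powr)
      finally show ?thesis using e Hardy_norm_nonneg[OF qH[OF t(1)]] by simp
    qed
    then show "\<forall>\<^sub>F t in at_right 0. dist (Hardy_norm p (?q t)) 0 < e"
      unfolding eventually_at_right_field using b(1) by auto
  qed
  then show ?thesis using h unfolding has_generator_limit_def by blast
qed

text \<open>
  Convergence in norm implies pointwise convergence by \<open>Hardy_pointwise_bound\<close>, and the pointwise
  derivative of \<open>f \<circ> \<phi> t\<close> at \<open>0\<close> is given by the chain rule.
\<close>

lemma has_generator_limit_unique:
  assumes S: "analytic_semigroup \<phi>" and p: "p \<ge> 1"
    and bd: "\<forall>t\<ge>0. Hardy_bounded_op p (composition_op \<phi> t)"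
    and f: "f \<in> Hardy_space p" and lim: "has_generator_limit p (composition_op \<phi>) f g" and z: "Im z > 0"
  shows "g z = semigroup_generator \<phi> z * deriv f z"
proof -
  note sem = analytic_semigroupD[OF S]
  have p0: "p > 0" using p by simp
  let ?T = "composition_op \<phi>"
  let ?q = "\<lambda>t z. (?T t f z - f z) / of_real t - g z"
  have g: "g \<in> Hardy_space p" and norm: "((\<lambda>t. Hardy_norm p (?q t)) \<longlongrightarrow> 0) (at_right 0)"
    using lim by (auto simp: has_generator_limit_def)
  have qH: "?q t \<in> Hardy_space p" if "t > 0" for t
    using Hardy_space_diff[OF Hardy_space_cmult[OF Hardy_space_diff[OF composition_op_Hardy[OF bd _ f] f p0] p0, of t "1 / of_real t"] g p0] that
    by simp
  have "((\<lambda>t. Hardy_norm p (?q t) * (4 / Im z) powr (1 / p)) \<longlongrightarrow> 0 * (4 / Im z) powr (1 / p)) (at_right 0)"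
    by (intro tendsto_mult_right norm)
  then have "((\<lambda>t. Hardy_norm p (?q t) * (4 / Im z) powr (1 / p)) \<longlongrightarrow> 0) (at_right 0)" by simp
  moreover have "\<forall>\<^sub>F t in at_right 0. norm (?q t z) \<le> Hardy_norm p (?q t) * (4 / Im z) powr (1 / p)"
  proof -
    have "norm (?q t z) \<le> Hardy_norm p (?q t) * (4 / Im z) powr (1 / p)" if t: "t > 0" for t
    proof -
      have "(norm (?q t z) powr p) powr (1 / p) \<le> (4 * Hardy_norm p (?q t) powr p / Im z) powr (1 / p)"
        using Hardy_pointwise_bound[OF qH[OF t] p0 z] p0 by (intro powr_mono2) auto
      also have "4 * Hardy_norm p (?q t) powr p / Im z = Hardy_norm p (?q t) powr p * (4 / Im z)" by simp
      also have "\<dots> powr (1 / p) = (Hardy_norm p (?q t) powr p) powr (1 / p) * (4 / Im z) powr (1 / p)"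
        by (rule powr_mult)
      finally show ?thesis using p0 Hardy_norm_nonneg[OF qH[OF t]] by (simp add: powr_powr)
    qed
    then show ?thesis by (auto simp: eventually_at_right_field intro: exI[of _ 1])
  qed
  ultimately have "((\<lambda>t. ?q t z) \<longlongrightarrow> 0) (at_right 0)"
    by (rule Lim_null_comparison[rotated])
  then have L1: "((\<lambda>t. (?T t f z - f z) / of_real t) \<longlongrightarrow> g z) (at_right 0)"
    by (rule LIM_zero_cancel)
  have "((\<lambda>t. \<phi> t z) has_vector_derivative semigroup_generator \<phi> z) (at 0 within {0..})"
    using semigroup_generator_ODE[OF S z, of 0] z by (simp add: sem(3))
  moreover have "(f has_field_derivative deriv f z) (at (\<phi> 0 z) within (\<lambda>t. \<phi> t z) ` {0..})"
    using holomorphic_derivI[OF Hardy_space_holomorphic[OF f] open_upper_halfplane, of z] z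
    by (simp add: sem(3) has_field_derivative_at_within)
  ultimately have "(f \<circ> (\<lambda>t. \<phi> t z) has_vector_derivative semigroup_generator \<phi> z * deriv f z) (at 0 within {0..})"
    by (rule field_vector_diff_chain_within)
  then have L2: "((\<lambda>t. (?T t f z - f z) / of_real t) \<longlongrightarrow> semigroup_generator \<phi> z * deriv f z) (at_right 0)"
    unfolding has_vector_derivative_iff_quotient using z
    by (simp add: composition_op_def o_def sem(3) at_within_Ici_at_right)
  show ?thesis by (rule tendsto_unique[OF _ L1 L2]) simp
qed

theorem theorem3p3:
  fixes p :: real and \<phi> :: "real \<Rightarrow> complex \<Rightarrow> complex"
  assumes "1 \<le> p"
    and "analytic_semigroup \<phi>"
    and "\<And>t. t \<ge> 0 \<Longrightarrow> Hardy_bounded_op p (composition_op \<phi> t)"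
  shows "Hardy_strongly_continuous p (composition_op \<phi>) \<and>
    generator_domain p (composition_op \<phi>) =
      {f \<in> Hardy_space p. (\<lambda>z. semigroup_generator \<phi> z * deriv f z) \<in> Hardy_space p} \<and>
    (\<forall>f\<in>generator_domain p (composition_op \<phi>). \<forall>z\<in>upper_halfplane.
      generator_op p (composition_op \<phi>) f z = semigroup_generator \<phi> z * deriv f z)"
proof (intro conjI ballI)
  note p = assms(1) and S = assms(2)
  have bd: "\<forall>t\<ge>0. Hardy_bounded_op p (composition_op \<phi> t)" using assms(3) by blast
  have p0: "p > 0" using p by simp
  show "Hardy_strongly_continuous p (composition_op \<phi>)"
    by (rule composition_semigroup_strongly_continuous[OF S p bd])
  show "generator_domain p (composition_op \<phi>) =
      {f \<in> Hardy_space p. (\<lambda>z. semigroup_generator \<phi> z * deriv f z) \<in> Hardy_space p}"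
  proof (intro equalityI subsetI)
    fix f assume "f \<in> generator_domain p (composition_op \<phi>)"
    then obtain g where f: "f \<in> Hardy_space p" and g: "has_generator_limit p (composition_op \<phi>) f g"
      by (auto simp: generator_domain_def)
    have "(\<lambda>z. semigroup_generator \<phi> z * deriv f z) \<in> Hardy_space p"
    proof (rule Hardy_space_cong[OF _ p0])
      show "g \<in> Hardy_space p" using g by (simp add: has_generator_limit_def)
      show "g z = semigroup_generator \<phi> z * deriv f z" if "Im z > 0" for z
        by (rule has_generator_limit_unique[OF S p bd f g that])
    qed
    then show "f \<in> {f \<in> Hardy_space p. (\<lambda>z. semigroup_generator \<phi> z * deriv f z) \<in> Hardy_space p}"
      using f by simp
  next
    fix f assume "f \<in> {f \<in> Hardy_space p. (\<lambda>z. semigroup_generator \<phi> z * deriv f z) \<in> Hardy_space p}"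
    then show "f \<in> generator_domain p (composition_op \<phi>)"
      using has_generator_limit_of_product[OF S p bd] by (auto simp: generator_domain_def)
  qed
  fix f z assume f: "f \<in> generator_domain p (composition_op \<phi>)" and z: "z \<in> upper_halfplane"
  then obtain g where "f \<in> Hardy_space p" and g: "has_generator_limit p (composition_op \<phi>) f g"
    by (auto simp: generator_domain_def)
  moreover have "has_generator_limit p (composition_op \<phi>) f (generator_op p (composition_op \<phi>) f)"
    unfolding generator_op_def by (rule someI[of "has_generator_limit p (composition_op \<phi>) f", OF g])
  ultimately show "generator_op p (composition_op \<phi>) f z = semigroup_generator \<phi> z * deriv f z"
    using has_generator_limit_unique[OF S p bd, of f "generator_op p (composition_op \<phi>) f" z] z by simp
qed

end
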